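(* Let $K\ge 1$, $\mathcal{K}=\{1,\dots,K\}$, $\alpha>2$, and for each $i\in\mathcal{K}$ let $\lambda_i>0$, $P_i>0$, $p_i\in[0,1]$ (with the $p_i$ not all zero) and $\beta_i>1$. In the $K$-tier network described in the context, the open access coverage probability $$\mathtt{P_c} = 1-\mathbb{E}\left[\prod_{i\in \mathcal{K}}\mathbf{1} \left(\frac{M(\Psi_i)}{I-M(\Psi)}<\beta_i\right)\mathbf{1} \left(\frac{M(\Delta_i)}{I}<\beta_i\right)\right]$$ is given by $$\mathtt{P_c}= \frac{\pi}{C(\alpha)}\, \frac{\sum_{i\in\mathcal{K}} p_i \lambda_iP_i^{2/\alpha} \beta_i^{-2/\alpha}}{\sum_{i=1}^K p_i \lambda_i P_i^{2/\alpha}}-\sum_{m=1}^\infty g(m),$$ where $$C(\alpha)=\frac{2\pi^2\csc(2\pi/\alpha)}{\alpha},$$ $$g(m)=\left(-\frac{A}{\eta}\right)^m\left\{\frac{1}{\Gamma\left(1+\frac{2m}{\alpha}\right)}-\frac{B_m}{\eta}\,\frac{\pi\,\Gamma\left(1+\frac{2}{\alpha}\right)}{\Gamma\left(1+\frac{2(m+1)}{\alpha}\right)}\right\},$$ $$A=\pi\Gamma\left(1+\tfrac{2}{\alpha}\right)\sum_{l\in \mathcal{K}}(1-p_l)\lambda_l P_l^{2/\alpha}\beta_l^{-2/\alpha},\qquad \eta=C(\alpha)\sum_{l=1}^K p_l\lambda_lP_l^{2/\alpha},$$ $$B_m= \sum_{i\in\mathcal{K}}\frac{\lambda_ip_iP_i^{2/\alpha}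 \beta_i^{-2/\alpha}\;{}_2F_1\left(1,\frac{2m}{\alpha},1+\frac{2(m+1)}{\alpha},\frac{1}{1+\beta_i}\right)}{(1+\beta_i)^{2m/\alpha}},$$ and ${}_2F_1(a,b,c,z)=\frac{\Gamma(c)}{\Gamma(b)\Gamma(c-b)}\int_0^1\frac{t^{b-1}(1-t)^{c-b-1}}{(1-tz)^a}\,dt$.
   Context: Network model. $\mathcal{K}=\{1,\dots,K\}$ indexes the tiers of base stations (BSs). Tier $i$ has BS density $\lambda_i$, transmit power $P_i$, target signal-to-interference ratio $\beta_i$ and activity factor $p_i$. The BSs of tier $i$ form a homogeneous Poisson point process (PPP) $\Phi_i$ on $\mathbb{R}^2$ of density $\lambda_i$, independent across tiers. Each $\Phi_i$ is independently partitioned into $\Psi_i$ (active BSs) and $\Delta_i$ (idle BSs), which are independent homogeneous PPPs of densities $p_i\lambda_i$ and $(1-p_i)\lambda_i$. All $2K$ processes $\Psi_i,\Delta_i$ are mutually independent. Each BS location $x$ carries a fading variable $h_x$; the $h_x$ are i.i.d. exponential with mean $1$ (Rayleigh fading), independent of the point processes. A BS at $x\in\Phi_i$ is received at the origin (the typical mobile) with power $P_ih_x\|x\|^{-\alpha}$. There is no thermal noise. Notation. $\Psi=\bigcup_{i\in\mathcal{K}}\Psi_i$. For a set of BSs, $M(\cdot)$ is the maximum received power at the origin from it: $M(\Psi_i)=\sup_{x\in\Psi_i}P_ih_x\|x\|^{-\alpha}$, $M(\Delta_i)=\sup_{x\in\Delta_i}P_ih_x\|x\|^{-\alpha}$, $M(\Psi)=\max_{i\in\mathcal{K}}M(\Psi_i)$,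 with $M(\emptyset)=0$. $I=\sum_{i=1}^K\sum_{x\in\Psi_i}P_ih_x\|x\|^{-\alpha}$ is the total power received from the active BSs. $\mathbf{1}(\cdot)$ is the indicator function. *)

theory Defs
  imports "HOL-Probability.Probability"
begin

section \<open>Homogeneous Poisson point processes\<close>

text \<open>
  A point process is given by an enumeration \<open>X 0, X 1, \<dots>\<close> of random points together with a
  random set \<open>S \<omega>\<close> of those indices that belong to the process; it is the random counting
  measure putting mass one at \<open>X n \<omega>\<close> for every \<open>n \<in> S \<omega>\<close>. The process may be empty or infinite.
\<close>

definition num_points :: "(nat \<Rightarrow> 'w \<Rightarrow> 'a) \<Rightarrow> ('w \<Rightarrow> nat set) \<Rightarrow> 'a set \<Rightarrow> 'w \<Rightarrow> ennreal" where
  "num_points X S B \<omega> = emeasure (count_space UNIV) {n \<in> S \<omega>. X n \<omega> \<in> B}"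

definition bounded_borel :: "'a::euclidean_space set set" where
  "bounded_borel = {B \<in> sets borel. bounded B}"

text \<open>
  The Poisson probabilities are written out because \<^const>\<open>poisson_pmf\<close> excludes rate \<open>0\<close>, which
  occurs for null sets and for density \<open>0\<close> (the empty process). They sum to one, so the process
  is almost surely locally finite.
\<close>

definition (in prob_space) homogeneous_PPP ::
    "real \<Rightarrow> (nat \<Rightarrow> 'a \<Rightarrow> 'b::euclidean_space) \<Rightarrow> ('a \<Rightarrow> nat set) \<Rightarrow> bool" where
  "homogeneous_PPP d X S \<longleftrightarrow>
     (\<forall>B\<in>bounded_borel. random_variable borel (num_points X S B) \<and>
        (\<forall>k::nat. prob {\<omega> \<in> space M. num_points X S B \<omega> = of_nat k} =
                  (d * measure lborel B) ^ k / fact k * exp (- (d * measure lborel B)))) \<and>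
     (\<forall>(m::nat) B. (\<forall>j<m. B j \<in> bounded_borel) \<and> disjoint_family_on B {..<m} \<longrightarrow>
        indep_vars (\<lambda>_. borel) (\<lambda>j. num_points X S (B j)) {..<m})"

text \<open>
  A point process as a random element: its counts on all bounded Borel sets, in the product space.
  Independence of point processes is independence of these random elements.
\<close>

definition count_process ::
    "(nat \<Rightarrow> 'w \<Rightarrow> 'a::euclidean_space) \<Rightarrow> ('w \<Rightarrow> nat set) \<Rightarrow> 'w \<Rightarrow> 'a set \<Rightarrow> ennreal" where
  "count_process X S \<omega> = (\<lambda>B\<in>bounded_borel. num_points X S B \<omega>)"

definition count_space_PiM :: "('a::euclidean_space set \<Rightarrow> ennreal) measure" where
  "count_space_PiM = PiM bounded_borel (\<lambda>_. borel)"

section \<open>The multi-tier network\<close>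

text \<open>
  The base stations of tier \<open>i\<close> are the indices \<open>n\<close>: station \<open>n\<close> is at \<open>X i n\<close>, has fading \<open>h i n\<close>,
  and is active iff \<open>act i n\<close>. All indices are used, since a homogeneous process of
  positive density in the plane is almost surely infinite. Fading is attached to the enumerated
  stations rather than given as a family over all locations, because an uncountable family of
  independent variables, evaluated at random locations, does not have a determined law.

  The fading family is independent of all locations and activity states. The activity states
  themselves are only required to split \<open>\<Phi>\<^sub>i\<close> into independent Poisson processes of densities
  \<open>p i * dens i\<close> and \<open>(1 - p i) * dens i\<close>; independent thinning of \<open>\<Phi>\<^sub>i\<close> is an instance.
  Independence of the \<open>\<Phi>\<^sub>i\<close> across tiers follows from that of the active and idle parts.
\<close>

locale multi_tier_network = prob_space M
  for M :: "'w measure" +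
  fixes K :: nat and dens p :: "nat \<Rightarrow> real"
    and X :: "nat \<Rightarrow> nat \<Rightarrow> 'w \<Rightarrow> real ^ 2"
    and act :: "nat \<Rightarrow> nat \<Rightarrow> 'w \<Rightarrow> bool"
    and h :: "nat \<Rightarrow> nat \<Rightarrow> 'w \<Rightarrow> real"
  assumes location_measurable: "\<And>i n. i \<in> {1..K} \<Longrightarrow> random_variable borel (X i n)"
    and active_measurable: "\<And>i n. i \<in> {1..K} \<Longrightarrow> random_variable (count_space UNIV) (act i n)"
    and PPP_all: "\<And>i. i \<in> {1..K} \<Longrightarrow> homogeneous_PPP (dens i) (X i) (\<lambda>_. UNIV)"
    and PPP_active:
      "\<And>i. i \<in> {1..K} \<Longrightarrow> homogeneous_PPP (p i * dens i) (X i) (\<lambda>\<omega>. {n. act i n \<omega>})"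
    and PPP_idle:
      "\<And>i. i \<in> {1..K} \<Longrightarrow> homogeneous_PPP ((1 - p i) * dens i) (X i) (\<lambda>\<omega>. {n. \<not> act i n \<omega>})"
    and indep_processes:
      "indep_vars (\<lambda>_. count_space_PiM)
         (\<lambda>(i, b). count_process (X i) (\<lambda>\<omega>. {n. act i n \<omega> = b})) ({1..K} \<times> (UNIV :: bool set))"
    and fading_exponential:
      "\<And>i n. i \<in> {1..K} \<Longrightarrow> distributed M lborel (h i n) (exponential_density 1)"
    and fading_indep:
      "indep_vars (\<lambda>_. borel) (\<lambda>(i, n). h i n) ({1..K} \<times> (UNIV :: nat set))"
    and fading_indep_stations:
      "indep_set
         (sets (vimage_algebra (space M)
            (\<lambda>\<omega>. \<lambda>(i, n)\<in>{1..K} \<times> (UNIV :: nat set). h i n \<omega>)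
            (PiM ({1..K} \<times> (UNIV :: nat set)) (\<lambda>_. borel))))
         (sets (vimage_algebra (space M)
            (\<lambda>\<omega>. \<lambda>(i, n)\<in>{1..K} \<times> (UNIV :: nat set). (X i n \<omega>, act i n \<omega>))
            (PiM ({1..K} \<times> (UNIV :: nat set)) (\<lambda>_. borel \<Otimes>\<^sub>M count_space UNIV))))"

text \<open>
  Powers and their ratios are extended nonnegative reals, so that suprema and sums always exist
  and the supremum over no stations is \<open>0\<close>. For \<open>p i > 0\<close> for some \<open>i\<close>, the conventions
  \<open>x / 0 = \<infinity>\<close> for \<open>x > 0\<close>, \<open>0 / 0 = 0\<close> and \<open>\<infinity> - \<infinity> = \<infinity>\<close> matter on null events only.
\<close>

definition received_power ::
    "real \<Rightarrow> (nat \<Rightarrow> real) \<Rightarrow> (nat \<Rightarrow> nat \<Rightarrow> 'w \<Rightarrow> real ^ 2) \<Rightarrow> (nat \<Rightarrow> nat \<Rightarrow> 'w \<Rightarrow> real) \<Rightarrow>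
     nat \<Rightarrow> nat \<Rightarrow> 'w \<Rightarrow> ennreal" where
  "received_power \<alpha> P X h i n \<omega> = ennreal (P i * h i n \<omega> * norm (X i n \<omega>) powr (- \<alpha>))"

context
  fixes K :: nat and \<alpha> :: real and P :: "nat \<Rightarrow> real"
    and X :: "nat \<Rightarrow> nat \<Rightarrow> 'w \<Rightarrow> real ^ 2"
    and act :: "nat \<Rightarrow> nat \<Rightarrow> 'w \<Rightarrow> bool"
    and h :: "nat \<Rightarrow> nat \<Rightarrow> 'w \<Rightarrow> real"
begin

definition max_active :: "nat \<Rightarrow> 'w \<Rightarrow> ennreal" where
  "max_active i \<omega> = (SUP n\<in>{n. act i n \<omega>}. received_power \<alpha> P X h i n \<omega>)"

definition max_idle :: "nat \<Rightarrow> 'w \<Rightarrow> ennreal" where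
  "max_idle i \<omega> = (SUP n\<in>{n. \<not> act i n \<omega>}. received_power \<alpha> P X h i n \<omega>)"

definition max_active_all :: "'w \<Rightarrow> ennreal" where
  "max_active_all \<omega> = (MAX i\<in>{1..K}. max_active i \<omega>)"

definition total_active :: "'w \<Rightarrow> ennreal" where
  "total_active \<omega> = (\<Sum>i=1..K. \<Sum>\<^sub>\<infinity>n\<in>{n. act i n \<omega>}. received_power \<alpha> P X h i n \<omega>)"

definition coverage_prob :: "'w measure \<Rightarrow> (nat \<Rightarrow> real) \<Rightarrow> real" where
  "coverage_prob M \<beta> =
     1 - (\<integral>\<omega>. (\<Prod>i\<in>{1..K}.
              of_bool (max_active i \<omega> / (total_active \<omega> - max_active_all \<omega>) < ennreal (\<beta> i)) *
              of_bool (max_idle i \<omega> / total_active \<omega> < ennreal (\<beta> i))) \<partial>M)"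

end

section \<open>The quantities in the coverage formula\<close>

definition hyp2F1 :: "real \<Rightarrow> real \<Rightarrow> real \<Rightarrow> real \<Rightarrow> real" where
  "hyp2F1 a b c z = Gamma c / (Gamma b * Gamma (c - b)) *
     (LBINT t:{0..1}. t powr (b - 1) * (1 - t) powr (c - b - 1) / (1 - t * z) powr a)"

definition C_const :: "real \<Rightarrow> real" where
  "C_const \<alpha> = 2 * pi\<^sup>2 * (1 / sin (2 * pi / \<alpha>)) / \<alpha>"

context
  fixes K :: nat and \<alpha> :: real and dens P p \<beta> :: "nat \<Rightarrow> real"
begin

definition A_const :: real where
  "A_const = pi * Gamma (1 + 2 / \<alpha>) *
     (\<Sum>l=1..K. (1 - p l) * dens l * P l powr (2 / \<alpha>) * \<beta> l powr (- 2 / \<alpha>))"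

definition eta_const :: real where
  "eta_const = C_const \<alpha> * (\<Sum>l=1..K. p l * dens l * P l powr (2 / \<alpha>))"

definition B_coeff :: "nat \<Rightarrow> real" where
  "B_coeff m =
     (\<Sum>i=1..K. dens i * p i * P i powr (2 / \<alpha>) * \<beta> i powr (- 2 / \<alpha>) *
        hyp2F1 1 (2 * real m / \<alpha>) (1 + 2 * (real m + 1) / \<alpha>) (1 / (1 + \<beta> i)) /
        (1 + \<beta> i) powr (2 * real m / \<alpha>))"

definition g_coeff :: "nat \<Rightarrow> real" where
  "g_coeff m = (- A_const / eta_const) ^ m *
     (1 / Gamma (1 + 2 * real m / \<alpha>)
      - B_coeff m / eta_const * (pi * Gamma (1 + 2 / \<alpha>) / Gamma (1 + 2 * (real m + 1) / \<alpha>)))"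

end

end

theory Submission
  imports Defs "HOL-Real_Asymp.Real_Asymp"
begin

text \<open>
  The received powers of the stations of a tier form, after integrating out the fading, a Poisson
  process on the half-line whose intensity has tail proportional to \<open>s powr (- \<delta>)\<close>, \<open>\<delta> = 2 / \<alpha>\<close>.
  Hence the total active power \<open>I\<close> is one-sided \<open>\<delta>\<close>-stable, with \<open>E (I powr (- \<delta> m)) = m! / (\<Gamma>(1 + \<delta> m) \<eta>^m)\<close>,
  and the idle tiers are harmless for the power level \<open>y\<close> with probability \<open>exp (- A y powr (- \<delta>))\<close>,
  independently of \<open>I\<close>. Since all thresholds exceed 1, at most one active station, necessarily the
  strongest one, can beat its threshold against the sum of the others, so the probability
  that one does is the expected number of such stations, which the Palm formula turns into an
  integral over the power of one extra station. Expanding \<open>exp (- A y powr (- \<delta>))\<close> into its power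
  series and integrating termwise yields the coefficients; the remaining one-dimensional integral is
  an incomplete beta integral, that is, a hypergeometric function.
\<close>

section \<open>Poisson processes and the Laplace functional\<close>

text \<open>The data give Poisson counts on bounded sets, independence of count processes, and
  fading attached to indices; no law of the received powers is at hand. Everything is read off one
  functional, the expectation of \<open>eexp\<close> of a sum over stations. Since
  \<open>eexp \<top> = 0\<close>, a weight \<open>\<top>\<close> on a region demands that the region
  be void, so one computation covers total power, counts in a window and the idle maximum jointly.
  The Palm formula comes from the same functional, differentiated in the weight of a counting term.
  This yields only Laplace transforms in the interference, which are turned back into an identity of
  measures on triples (station power, interference, idle maximum). The intensity has infinite mass
  near power 0, so counts are cut off at a level \<open>c > 0\<close>, removed at the end. The index
  \<open>m = 0\<close> supplies the closed leading term, because there the hypergeometric factor is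
  1 and the constant 1 cancels.\<close>

definition eexp :: "ennreal \<Rightarrow> real" where
  "eexp x = (if x = \<top> then 0 else exp (- enn2real x))"

lemma eexp_0 [simp]: "eexp 0 = 1"
  by (simp add: eexp_def)

lemma eexp_top [simp]: "eexp \<top> = 0"
  by (simp add: eexp_def)

lemma eexp_ennreal: "0 \<le> r \<Longrightarrow> eexp (ennreal r) = exp (- r)"
  by (simp add: eexp_def)

lemma eexp_nonneg [simp]: "0 \<le> eexp x" and eexp_le_1 [simp]: "eexp x \<le> 1"
  by (auto simp: eexp_def)

lemma eexp_add: "eexp (x + y) = eexp x * eexp y"
  by (cases x; cases y) (auto simp: eexp_ennreal simp flip: ennreal_plus exp_add)

lemma eexp_sum: "finite A \<Longrightarrow> eexp (\<Sum>i\<in>A. f i) = (\<Prod>i\<in>A. eexp (f i))"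
  by (induction A rule: finite_induct) (auto simp: eexp_add)

lemma eexp_mult_of_nat: "eexp (c * of_nat k) = eexp c ^ k"
  by (induction k) (auto simp: eexp_add algebra_simps)

lemma eexp_antimono: "x \<le> y \<Longrightarrow> eexp y \<le> eexp x"
  by (cases x; cases y) (auto simp: eexp_ennreal top_unique)

text \<open>The point at issue is continuity at \<open>\<top>\<close>: weights may increase to
  \<open>\<top>\<close>, and their limits have to pass through \<open>eexp\<close>.\<close>

lemma tendsto_eexp:
  assumes "(f \<longlongrightarrow> L) F"
  shows "((\<lambda>x. eexp (f x)) \<longlongrightarrow> eexp L) F"
proof (cases L)
  case (real r)
  have "((\<lambda>x. exp (- enn2real (f x))) \<longlongrightarrow> exp (- r)) F"
    using assms real by (intro tendsto_intros) auto
  moreover have "\<forall>\<^sub>F x in F. f x < \<top>"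
    using order_tendstoD(2)[OF assms, of \<top>] real by auto
  then have "\<forall>\<^sub>F x in F. exp (- enn2real (f x)) = eexp (f x)"
    by eventually_elim (auto simp: eexp_def)
  ultimately show ?thesis
    using real by (auto simp: eexp_ennreal intro: Lim_transform_eventually)
next
  case top
  show ?thesis
  proof (rule order_tendstoI)
    fix a assume "a < eexp L"
    with top show "\<forall>\<^sub>F x in F. a < eexp (f x)"
      by (auto intro!: always_eventually intro: less_le_trans)
  next
    fix a assume "eexp L < a"
    with top have a: "0 < a" by simp
    \<comment> \<open>Beyond \<open>- ln a\<close> the exponential is below \<open>a\<close>; the
      extra 1 makes this strict, and \<open>max 0\<close> keeps the level nonnegative.\<close>
    have "\<forall>\<^sub>F x in F. ennreal (max 0 (1 - ln a)) < f x"
      using order_tendstoD(1)[OF assms] top by auto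
    then show "\<forall>\<^sub>F x in F. eexp (f x) < a"
    proof eventually_elim
      case (elim x)
      have "eexp (f x) \<le> eexp (ennreal (max 0 (1 - ln a)))"
        using elim by (intro eexp_antimono) auto
      also have "\<dots> \<le> exp (ln a - 1)" by (subst eexp_ennreal) auto
      also have "\<dots> < exp (ln a)" by simp
      finally show ?case using a by simp
    qed
  qed
qed

lemma borel_measurable_eexp [measurable]: "eexp \<in> borel_measurable borel"
  by (intro borel_measurable_continuous_onI)
     (auto simp: continuous_on_eq_continuous_at isCont_def intro!: tendsto_eexp tendsto_ident_at)

section \<open>Sums over the points of a process and their approximation by step functions\<close>

definition psum :: "(nat \<Rightarrow> 'w \<Rightarrow> 'a) \<Rightarrow> ('w \<Rightarrow> nat set) \<Rightarrow> ('a \<Rightarrow> ennreal) \<Rightarrow> 'w \<Rightarrow> ennreal" where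
  "psum X S u \<omega> = (\<Sum>n. u (X n \<omega>) * indicator (S \<omega>) n)"

lemma num_points_eq_psum: "num_points X S B \<omega> = psum X S (indicator B) \<omega>"
proof -
  have "num_points X S B \<omega> = (\<integral>\<^sup>+n. indicator {n \<in> S \<omega>. X n \<omega> \<in> B} n \<partial>count_space UNIV)"
    by (simp add: num_points_def)
  also have "\<dots> = (\<Sum>n. indicator {n \<in> S \<omega>. X n \<omega> \<in> B} n)"
    by (rule nn_integral_count_space_nat)
  finally show ?thesis
    by (auto simp: psum_def indicator_def intro!: suminf_cong)
qed

lemma psum_mono: "(\<And>x. u x \<le> v x) \<Longrightarrow> psum X S u \<omega> \<le> psum X S v \<omega>"
  unfolding psum_def by (intro suminf_le mult_right_mono) auto

lemma psum_SUP:
  assumes "incseq u"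
  shows "psum X S (\<lambda>x. SUP k. u k x) \<omega> = (SUP k. psum X S (u k) \<omega>)"
proof -
  have "psum X S (\<lambda>x. SUP k. u k x) \<omega> =
    (\<integral>\<^sup>+n. (SUP k. u k (X n \<omega>) * indicator (S \<omega>) n) \<partial>count_space UNIV)"
    by (simp add: psum_def nn_integral_count_space_nat SUP_mult_right_ennreal)
  also have "\<dots> = (SUP k. \<integral>\<^sup>+n. u k (X n \<omega>) * indicator (S \<omega>) n \<partial>count_space UNIV)"
    using assms by (intro nn_integral_monotone_convergence_SUP)
      (auto simp: incseq_def le_fun_def intro!: mult_right_mono)
  finally show ?thesis by (simp add: psum_def nn_integral_count_space_nat)
qed

text \<open>The Poisson hypotheses speak of finitely many disjoint bounded sets, so weights are
  first built from such pieces. Coefficients may be \<open>\<top>\<close>.\<close>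

definition step_fun :: "nat \<Rightarrow> (nat \<Rightarrow> ennreal) \<Rightarrow> (nat \<Rightarrow> 'a set) \<Rightarrow> 'a \<Rightarrow> ennreal" where
  "step_fun m c B x = (\<Sum>l<m. c l * indicator (B l) x)"

lemma psum_step_fun: "psum X S (step_fun m c B) \<omega> = (\<Sum>l<m. c l * num_points X S (B l) \<omega>)"
proof -
  have "psum X S (step_fun m c B) \<omega> = (\<Sum>n. \<Sum>l<m. c l * (indicator (B l) (X n \<omega>) * indicator (S \<omega>) n))"
    by (simp only: psum_def step_fun_def sum_distrib_right mult.assoc)
  also have "\<dots> = (\<Sum>l<m. \<Sum>n. c l * (indicator (B l) (X n \<omega>) * indicator (S \<omega>) n))"
    by (intro suminf_sum) auto
  finally show ?thesis
    by (simp add: num_points_eq_psum psum_def)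
qed

lemma step_fun_in:
  assumes "disjoint_family_on B {..<m}" "l < m" "x \<in> B l"
  shows "step_fun m c B x = c l"
proof -
  have "step_fun m c B x = (\<Sum>j\<in>{l}. c j * indicator (B j) x)"
    unfolding step_fun_def using assms
    by (intro sum.mono_neutral_right) (auto simp: disjoint_family_on_def indicator_def)
  with assms show ?thesis by simp
qed

lemma step_fun_notin: "(\<And>l. l < m \<Longrightarrow> x \<notin> B l) \<Longrightarrow> step_fun m c B x = 0"
  by (auto simp: step_fun_def)

lemma step_fun_comp:
  assumes "disjoint_family_on B {..<m}"
  shows "ennreal (1 - eexp (step_fun m c B x)) = step_fun m (\<lambda>l. ennreal (1 - eexp (c l))) B x"
proof (cases "\<exists>l<m. x \<in> B l")
  case True
  then obtain l where "l < m" "x \<in> B l" by auto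
  then show ?thesis by (simp add: step_fun_in[OF assms])
next
  case False
  then show ?thesis by (simp add: step_fun_notin)
qed

text \<open>The pieces are the level sets of the nonzero values. The value 0 is left out because its
  level set is unbounded.\<close>

lemma step_fun_exists:
  fixes f :: "'a::euclidean_space \<Rightarrow> ennreal"
  assumes f: "simple_function borel f" and supp: "\<And>x. f x \<noteq> 0 \<Longrightarrow> x \<in> ball 0 r"
  obtains m c B where "\<And>l. l < m \<Longrightarrow> B l \<in> bounded_borel" "disjoint_family_on B {..<m}"
    "f = step_fun m c B"
proof -
  let ?V = "range f - {0}"
  have "finite ?V" using f by (auto simp: simple_function_def)
  then obtain h where h: "bij_betw h {..<card ?V} ?V"
    using ex_bij_betw_nat_finite[of ?V] by (auto simp: atLeast0LessThan)
  define B where "B l = f -` {h l}" for l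
  have *: "disjoint_family_on B {..<card ?V}"
    using h by (auto simp: disjoint_family_on_def B_def bij_betw_def inj_on_def)
  show thesis
  proof (rule that)
    fix l assume "l < card ?V"
    then have "h l \<in> ?V" using h by (auto simp: bij_betw_def)
    then have "B l \<subseteq> ball 0 r" using supp by (auto simp: B_def)
    moreover have "B l \<in> sets borel"
      using measurable_sets[OF borel_measurable_simple_function[OF f], of "{h l}"] by (simp add: B_def)
    ultimately show "B l \<in> bounded_borel"
      by (auto simp: bounded_borel_def intro: bounded_subset[OF bounded_ball])
  next
    show "f = step_fun (card ?V) h B"
    proof
      fix x show "f x = step_fun (card ?V) h B x"
      proof (cases "f x = 0")
        case True
        have "x \<notin> B l" if "l < card ?V" for l
          using that h True by (auto simp: B_def bij_betw_def)
        with True show ?thesis by (simp add: step_fun_notin)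
      next
        case False
        then have "f x \<in> h ` {..<card ?V}" using h by (auto simp: bij_betw_def)
        then obtain l where "l < card ?V" "h l = f x" by auto
        then show ?thesis by (subst step_fun_in[OF *, of l]) (auto simp: B_def)
      qed
    qed
  qed (fact *)
qed

lemma step_fun_approx:
  fixes u :: "'a::euclidean_space \<Rightarrow> ennreal"
  assumes "u \<in> borel_measurable borel"
  obtains m c B where "\<And>k l. l < m k \<Longrightarrow> B k l \<in> bounded_borel"
    "\<And>k. disjoint_family_on (B k) {..<m k}"
    "incseq (\<lambda>k. step_fun (m k) (c k) (B k))" "u = (\<lambda>x. SUP k. step_fun (m k) (c k) (B k) x)"
proof -
  obtain F where F: "\<And>i. simple_function borel (F i)" "incseq F" "\<And>x. (SUP i. F i x) = u x"
    using borel_measurable_implies_simple_function_sequence'[OF assms] by metis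
  \<comment> \<open>Cutting off with growing balls bounds the supports without changing the
    supremum.\<close>
  define G where "G k x = F k x * indicator (ball 0 (real k)) x" for k x
  have "simple_function borel (G k)" for k
    unfolding G_def using F(1) by (intro simple_function_mult simple_function_indicator) auto
  moreover have "x \<in> ball 0 (real k)" if "G k x \<noteq> 0" for k x
    using that unfolding G_def by (metis indicator_simps(2) mult_zero_right)
  ultimately have "\<exists>m c B. (\<forall>l<m. B l \<in> bounded_borel) \<and> disjoint_family_on B {..<m} \<and>
      G k = step_fun m c B" for k
    by (rule step_fun_exists) auto
  then obtain m c B where *: "\<And>k l. l < m k \<Longrightarrow> B k l \<in> bounded_borel"
    "\<And>k. disjoint_family_on (B k) {..<m k}" "\<And>k. G k = step_fun (m k) (c k) (B k)"
    by metis
  have G: "incseq G"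
    using F(2) unfolding incseq_def le_fun_def G_def
    by (auto intro!: mult_mono simp: indicator_def)
  have "(SUP k. G k x) = u x" for x
  proof (rule antisym)
    show "(SUP k. G k x) \<le> u x"
      unfolding F(3)[symmetric] by (intro SUP_mono) (auto simp: G_def indicator_def)
    obtain N where N: "norm x < real N" using reals_Archimedean2 by blast
    \<comment> \<open>From index \<open>N\<close> on the ball contains \<open>x\<close>, and
      \<open>F\<close> is increasing, so the later index \<open>max k N\<close> dominates.\<close>
    have "F k x \<le> G (max k N) x" for k
      using F(2) N by (auto simp: G_def incseq_def le_fun_def indicator_def)
    then show "u x \<le> (SUP k. G k x)"
      unfolding F(3)[symmetric] by (intro SUP_mono) auto
  qed
  then show thesis
    using *(1,2) G by (intro that[of m B c]) (auto simp: fun_eq_iff simp flip: *(3))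
qed

lemma psum_measurable:
  assumes [measurable]: "\<And>n. X n \<in> borel_measurable M"
    "\<And>n. {\<omega> \<in> space M. n \<in> S \<omega>} \<in> sets M" "u \<in> borel_measurable borel"
  shows "psum X S u \<in> borel_measurable M"
proof -
  have [measurable]: "(\<lambda>\<omega>. indicator (S \<omega>) n :: ennreal) \<in> borel_measurable M" for n
  proof -
    have "(\<lambda>\<omega>. indicator {\<omega> \<in> space M. n \<in> S \<omega>} \<omega> :: ennreal) \<in> borel_measurable M" by measurable
    then show ?thesis by (rule measurable_cong[THEN iffD1, rotated]) (auto simp: indicator_def)
  qed
  show ?thesis unfolding psum_def by measurable
qed

section \<open>Laplace functional of independent Poisson processes\<close>

context prob_space
begin

text \<open>This is the Poisson generating function at \<open>q = eexp c\<close>. The case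
  \<open>c = \<top>\<close> evaluates it at 0 and gives the void probability.\<close>

lemma PPP_laplace_indicator:
  assumes PPP: "homogeneous_PPP d X S" and d: "0 \<le> d" and B: "B \<in> bounded_borel"
  shows "expectation (\<lambda>\<omega>. eexp (c * num_points X S B \<omega>)) =
    eexp (ennreal (d * measure lborel B) * ennreal (1 - eexp c))"
proof -
  let ?N = "num_points X S B" and ?q = "eexp c"
  define \<mu> where "\<mu> = d * measure lborel B"
  have \<mu>: "0 \<le> \<mu>" using d by (simp add: \<mu>_def)
  have [measurable]: "?N \<in> borel_measurable M"
    using PPP B by (auto simp: homogeneous_PPP_def)
  have P: "prob {\<omega> \<in> space M. ?N \<omega> = of_nat k} = \<mu> ^ k / fact k * exp (- \<mu>)" for k
    using PPP B by (auto simp: homogeneous_PPP_def \<mu>_def)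
  have exp_sums: "(\<lambda>k. q ^ k * (\<mu> ^ k / fact k * exp (- \<mu>))) sums exp (\<mu> * (q - 1))" for q
    using sums_mult2[OF exp_converges[of "q * \<mu>"], of "exp (- \<mu>)"]
    by (simp add: scaleR_conv_of_real power_mult_distrib field_simps flip: exp_add)
  \<comment> \<open>The prescribed probabilities sum to one (\<open>q = 1\<close> in the series
    above), so almost surely the count is a natural number and not \<open>\<top>\<close>.\<close>
  let ?E = "\<lambda>k. {\<omega> \<in> space M. ?N \<omega> = of_nat k}"
  have "emeasure M (\<Union>k. ?E k) = (\<Sum>k. emeasure M (?E k))"
    by (intro suminf_emeasure[symmetric]) (auto simp: disjoint_family_on_def)
  also have "\<dots> = (\<Sum>k. ennreal (1 ^ k * (\<mu> ^ k / fact k * exp (- \<mu>))))"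
    by (simp add: emeasure_eq_measure P)
  also have "\<dots> = ennreal (exp (\<mu> * (1 - 1)))"
    using \<mu> exp_sums[of 1] by (intro suminf_ennreal_eq) auto
  finally have "prob (\<Union>k. ?E k) = 1" by (simp add: emeasure_eq_measure)
  then have AE: "AE \<omega> in M. \<omega> \<in> (\<Union>k. ?E k)"
    by (subst AE_in_set_eq_1) auto
  have "(\<integral>\<^sup>+\<omega>. ennreal (eexp (c * ?N \<omega>)) \<partial>M) =
    (\<integral>\<^sup>+\<omega>. (\<Sum>k. ennreal (?q ^ k) * indicator (?E k) \<omega>) \<partial>M)"
  proof (rule nn_integral_cong_AE, use AE in eventually_elim)
    case (elim \<omega>)
    then obtain k where k: "\<omega> \<in> ?E k" by auto
    have "(\<Sum>j. ennreal (?q ^ j) * indicator (?E j) \<omega>) =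
        (\<Sum>j\<in>{k}. ennreal (?q ^ j) * indicator (?E j) \<omega>)"
      using k by (intro suminf_finite) auto
    with k show ?case by (simp add: eexp_mult_of_nat)
  qed
  also have "\<dots> = (\<Sum>k. ennreal (?q ^ k) * emeasure M (?E k))"
    by (subst nn_integral_suminf) (auto simp: nn_integral_cmult_indicator)
  also have "\<dots> = (\<Sum>k. ennreal (?q ^ k * (\<mu> ^ k / fact k * exp (- \<mu>))))"
    unfolding emeasure_eq_measure P by (subst ennreal_mult') auto
  also have "\<dots> = ennreal (exp (\<mu> * (?q - 1)))"
    using \<mu> by (intro suminf_ennreal_eq exp_sums) auto
  finally have "expectation (\<lambda>\<omega>. eexp (c * ?N \<omega>)) = exp (\<mu> * (?q - 1))"
    by (subst integral_eq_nn_integral) auto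
  also have "\<dots> = eexp (ennreal (\<mu> * (1 - ?q)))"
    using \<mu> by (subst eexp_ennreal) (auto simp: algebra_simps intro: mult_left_le)
  finally show ?thesis using \<mu> by (simp add: ennreal_mult' \<mu>_def)
qed

text \<open>Counts of disjoint pieces are independent, so the expectation is a product of one-piece
  factors; their exponents add up to the integral of \<open>1 - eexp\<close>.\<close>

lemma PPP_laplace_step_fun:
  assumes PPP: "homogeneous_PPP d X S" and d: "0 \<le> d"
    and B: "\<And>l. l < m \<Longrightarrow> B l \<in> bounded_borel" and disj: "disjoint_family_on B {..<m}"
  shows "expectation (\<lambda>\<omega>. eexp (psum X S (step_fun m c B) \<omega>)) =
    eexp (ennreal d * (\<integral>\<^sup>+x. ennreal (1 - eexp (step_fun m c B x)) \<partial>lborel))"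
proof -
  have [measurable]: "num_points X S (B l) \<in> borel_measurable M" if "l < m" for l
    using PPP B[OF that] by (auto simp: homogeneous_PPP_def)
  have indep: "indep_vars (\<lambda>_. borel) (\<lambda>l. num_points X S (B l)) {..<m}"
    using PPP B disj by (auto simp: homogeneous_PPP_def)
  have "expectation (\<lambda>\<omega>. eexp (psum X S (step_fun m c B) \<omega>)) =
      expectation (\<lambda>\<omega>. \<Prod>l<m. eexp (c l * num_points X S (B l) \<omega>))"
    by (simp add: psum_step_fun eexp_sum)
  also have "\<dots> = (\<Prod>l<m. expectation (\<lambda>\<omega>. eexp (c l * num_points X S (B l) \<omega>)))"
  proof (rule indep_vars_lebesgue_integral)
    show "indep_vars (\<lambda>_. borel) (\<lambda>l \<omega>. eexp (c l * num_points X S (B l) \<omega>)) {..<m}"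
      by (rule indep_vars_compose2[OF indep]) auto
    show "integrable M (\<lambda>\<omega>. eexp (c l * num_points X S (B l) \<omega>))" if "l \<in> {..<m}" for l
      using that by (intro integrable_const_bound[of _ 1]) auto
  qed auto
  also have "\<dots> = eexp (\<Sum>l<m. ennreal (d * measure lborel (B l)) * ennreal (1 - eexp (c l)))"
    using B by (auto simp: eexp_sum PPP_laplace_indicator[OF PPP d] intro!: prod.cong)
  also have "(\<Sum>l<m. ennreal (d * measure lborel (B l)) * ennreal (1 - eexp (c l))) =
      (\<Sum>l<m. ennreal d * (\<integral>\<^sup>+x. ennreal (1 - eexp (c l)) * indicator (B l) x \<partial>lborel))"
  proof (rule sum.cong)
    fix l assume "l \<in> {..<m}"
    then have [measurable]: "B l \<in> sets borel" and b: "bounded (B l)"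
      using B by (auto simp: bounded_borel_def)
    have "emeasure lborel (B l) = ennreal (measure lborel (B l))"
      using emeasure_bounded_finite[OF b] by (intro emeasure_eq_ennreal_measure) auto
    then show "ennreal (d * measure lborel (B l)) * ennreal (1 - eexp (c l)) =
       ennreal d * (\<integral>\<^sup>+x. ennreal (1 - eexp (c l)) * indicator (B l) x \<partial>lborel)"
      using d by (subst nn_integral_cmult_indicator) (auto simp: ennreal_mult' ac_simps)
  qed simp
  also have "\<dots> = ennreal d * (\<integral>\<^sup>+x. step_fun m (\<lambda>l. ennreal (1 - eexp (c l))) B x \<partial>lborel)"
  proof -
    have [measurable]: "B l \<in> sets borel" if "l < m" for l
      using B[OF that] by (auto simp: bounded_borel_def)
    show ?thesis
      unfolding step_fun_def by (subst nn_integral_sum) (auto simp: sum_distrib_left)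
  qed
  finally show ?thesis by (simp add: step_fun_comp[OF disj])
qed

text \<open>Independence of the processes is stated for families of counts on bounded sets. A sum
  with a general weight is not visibly a measurable function of such a family, but a sum with a step
  function is one of finitely many counts. Hence the expectation is factored for step functions, and
  only then is the limit taken.\<close>

lemma PPP_joint_laplace:
  fixes Y :: "'j \<Rightarrow> nat \<Rightarrow> 'a \<Rightarrow> 'b::euclidean_space"
  assumes J: "finite J"
    and PPP: "\<And>j. j \<in> J \<Longrightarrow> homogeneous_PPP (d j) (Y j) (S j)"
    and d: "\<And>j. j \<in> J \<Longrightarrow> 0 \<le> d j"
    and Y: "\<And>j n. j \<in> J \<Longrightarrow> Y j n \<in> borel_measurable M"
    and S: "\<And>j n. j \<in> J \<Longrightarrow> {\<omega> \<in> space M. n \<in> S j \<omega>} \<in> events"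
    and indep: "indep_vars (\<lambda>_. count_space_PiM) (\<lambda>j. count_process (Y j) (S j)) J"
    and u: "\<And>j. j \<in> J \<Longrightarrow> u j \<in> borel_measurable borel"
  shows "expectation (\<lambda>\<omega>. \<Prod>j\<in>J. eexp (psum (Y j) (S j) (u j) \<omega>)) =
    (\<Prod>j\<in>J. eexp (ennreal (d j) * (\<integral>\<^sup>+x. ennreal (1 - eexp (u j x)) \<partial>lborel)))"
proof -
  define approx where "approx j = (\<lambda>(m, c, B). (\<forall>k l. l < m k \<longrightarrow> B k l \<in> bounded_borel) \<and>
      (\<forall>k. disjoint_family_on (B k) {..<m k}) \<and> incseq (\<lambda>k. step_fun (m k) (c k) (B k)) \<and>
      u j = (\<lambda>x. SUP k. step_fun (m k) (c k) (B k) x))" for j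
  have "\<exists>t. approx j t" if j: "j \<in> J" for j
  proof (rule step_fun_approx[OF u[OF j]])
    fix m c B
    assume "\<And>k l. l < m k \<Longrightarrow> B k l \<in> bounded_borel" "\<And>k. disjoint_family_on (B k) {..<m k}"
      "incseq (\<lambda>k. step_fun (m k) (c k) (B k))" "u j = (\<lambda>x. SUP k. step_fun (m k) (c k) (B k) x)"
    then have "approx j (m, c, B)" by (simp add: approx_def)
    then show ?thesis ..
  qed
  then have "\<forall>j\<in>J. \<exists>t. approx j t" by blast
  then obtain t where t: "\<forall>j\<in>J. approx j (t j)" using bchoice by metis
  define m c B where "m j = fst (t j)" and "c j = fst (snd (t j))" and "B j = snd (snd (t j))" for j
  have "approx j (m j, c j, B j)" if "j \<in> J" for j
    using t that by (simp add: m_def c_def B_def)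
  then have B: "\<And>j k l. j \<in> J \<Longrightarrow> l < m j k \<Longrightarrow> B j k l \<in> bounded_borel"
    and disj: "\<And>j k. j \<in> J \<Longrightarrow> disjoint_family_on (B j k) {..<m j k}"
    and inc: "\<And>j. j \<in> J \<Longrightarrow> incseq (\<lambda>k. step_fun (m j k) (c j k) (B j k))"
    and u_eq: "\<And>j. j \<in> J \<Longrightarrow> u j = (\<lambda>x. SUP k. step_fun (m j k) (c j k) (B j k) x)"
    by (auto simp: approx_def)
  define v where "v j k = step_fun (m j k) (c j k) (B j k)" for j k
  note inc = inc[folded v_def] and u_eq = u_eq[folded v_def]
  have v_meas: "v j k \<in> borel_measurable borel" if "j \<in> J" for j k
  proof -
    have [measurable]: "B j k l \<in> sets borel" if "l < m j k" for l
      using B[OF \<open>j \<in> J\<close> that] by (auto simp: bounded_borel_def)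
    show ?thesis unfolding v_def step_fun_def by measurable
  qed
  have psum_meas: "psum (Y j) (S j) (v j k) \<in> borel_measurable M" if "j \<in> J" for j k
    using that by (intro psum_measurable Y S v_meas)
  have "expectation (\<lambda>\<omega>. \<Prod>j\<in>J. eexp (psum (Y j) (S j) (v j k) \<omega>)) =
    (\<Prod>j\<in>J. expectation (\<lambda>\<omega>. eexp (psum (Y j) (S j) (v j k) \<omega>)))" for k
  proof (rule indep_vars_lebesgue_integral)
    \<comment> \<open>\<open>?\<phi> j\<close> reads finitely many coordinates of the count family,
      which makes it measurable on the product space.\<close>
    let ?\<phi> = "\<lambda>j f. eexp (\<Sum>l<m j k. c j k l * (f (B j k l) :: ennreal))"
    have "indep_vars (\<lambda>_. borel) (\<lambda>j \<omega>. ?\<phi> j (count_process (Y j) (S j) \<omega>)) J"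
    proof (rule indep_vars_compose2[OF indep])
      fix j assume j: "j \<in> J"
      have [measurable]: "(\<lambda>f. f (B j k l) :: ennreal) \<in> borel_measurable count_space_PiM"
        if "l < m j k" for l
        unfolding count_space_PiM_def using B[OF j that] by (intro measurable_component_singleton)
      show "?\<phi> j \<in> borel_measurable count_space_PiM" by measurable
    qed
    then show "indep_vars (\<lambda>_. borel) (\<lambda>j \<omega>. eexp (psum (Y j) (S j) (v j k) \<omega>)) J"
      by (rule indep_vars_cong[THEN iffD1, rotated -1])
         (auto simp: v_def psum_step_fun count_process_def B intro!: arg_cong[where f = eexp] sum.cong)
    show "integrable M (\<lambda>\<omega>. eexp (psum (Y j) (S j) (v j k) \<omega>))" if "j \<in> J" for j
      using psum_meas[OF that] by (intro integrable_const_bound[of _ 1]) auto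
  qed (fact J)
  then have step: "expectation (\<lambda>\<omega>. \<Prod>j\<in>J. eexp (psum (Y j) (S j) (v j k) \<omega>)) =
    (\<Prod>j\<in>J. eexp (ennreal (d j) * (\<integral>\<^sup>+x. ennreal (1 - eexp (v j k x)) \<partial>lborel)))" for k
    unfolding v_def using B disj PPP d
    by (auto intro!: prod.cong PPP_laplace_step_fun)
  have v_lim: "(\<lambda>k. v j k x) \<longlonglongrightarrow> u j x" if "j \<in> J" for j x
    unfolding u_eq[OF that] using inc[OF that]
    by (intro LIMSEQ_SUP) (auto simp: incseq_def le_fun_def)
  have psum_lim: "(\<lambda>k. psum (Y j) (S j) (v j k) \<omega>) \<longlonglongrightarrow> psum (Y j) (S j) (u j) \<omega>" if "j \<in> J" for j \<omega>
    unfolding u_eq[OF that] psum_SUP[OF inc[OF that]] using inc[OF that]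
    by (intro LIMSEQ_SUP) (auto simp: incseq_def le_fun_def intro!: psum_mono)
  have "(\<lambda>k. expectation (\<lambda>\<omega>. \<Prod>j\<in>J. eexp (psum (Y j) (S j) (v j k) \<omega>))) \<longlonglongrightarrow>
     expectation (\<lambda>\<omega>. \<Prod>j\<in>J. eexp (psum (Y j) (S j) (u j) \<omega>))"
  proof (rule integral_dominated_convergence[where w = "\<lambda>_. 1"])
    show "(\<lambda>\<omega>. \<Prod>j\<in>J. eexp (psum (Y j) (S j) (u j) \<omega>)) \<in> borel_measurable M"
      by (intro borel_measurable_prod measurable_compose[OF _ borel_measurable_eexp]
            psum_measurable Y S u) auto
    show "(\<lambda>\<omega>. \<Prod>j\<in>J. eexp (psum (Y j) (S j) (v j k) \<omega>)) \<in> borel_measurable M" for k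
      by (intro borel_measurable_prod measurable_compose[OF _ borel_measurable_eexp] psum_meas) auto
    show "AE \<omega> in M. (\<lambda>k. \<Prod>j\<in>J. eexp (psum (Y j) (S j) (v j k) \<omega>)) \<longlonglongrightarrow>
        (\<Prod>j\<in>J. eexp (psum (Y j) (S j) (u j) \<omega>))"
      by (intro always_eventually allI tendsto_prod tendsto_eexp psum_lim)
    show "AE \<omega> in M. norm (\<Prod>j\<in>J. eexp (psum (Y j) (S j) (v j k) \<omega>)) \<le> 1" for k
      by (auto intro!: prod_le_1 prod_nonneg simp: abs_prod)
  qed auto
  \<comment> \<open>On the intensity side \<open>1 - eexp\<close> increases with the weight, so
    monotone convergence applies even when the integrals are infinite.\<close>
  moreover have "(\<lambda>k. \<Prod>j\<in>J. eexp (ennreal (d j) * (\<integral>\<^sup>+x. ennreal (1 - eexp (v j k x)) \<partial>lborel)))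
      \<longlonglongrightarrow> (\<Prod>j\<in>J. eexp (ennreal (d j) * (\<integral>\<^sup>+x. ennreal (1 - eexp (u j x)) \<partial>lborel)))"
  proof (intro tendsto_prod tendsto_eexp ennreal_tendsto_cmult nn_integral_LIMSEQ)
    fix j assume j: "j \<in> J"
    show "(\<lambda>x. ennreal (1 - eexp (v j k x))) \<in> borel_measurable lborel" for k
      using v_meas[OF j, of k] by measurable
    show "incseq (\<lambda>k x. ennreal (1 - eexp (v j k x)))"
      using inc[OF j] by (auto simp: incseq_def le_fun_def intro!: ennreal_leI eexp_antimono)
    show "(\<lambda>k. ennreal (1 - eexp (v j k x))) \<longlonglongrightarrow> ennreal (1 - eexp (u j x))" for x
      by (intro tendsto_intros tendsto_eexp v_lim j)
  qed auto
  ultimately show ?thesis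
    unfolding step by (rule LIMSEQ_unique)
qed

end

section \<open>Independent exponential marks\<close>

text \<open>A right inverse of \<open>eexp\<close> on \<open>[0, 1]\<close>, sending 0 to
  \<open>\<top>\<close>. It presents a factor averaged over the fading as \<open>eexp\<close> of a
  weight again.\<close>

definition eneglog :: "real \<Rightarrow> ennreal" where
  "eneglog x = (if x \<le> 0 then \<top> else ennreal (- ln x))"

lemma eexp_eneglog: "0 \<le> x \<Longrightarrow> x \<le> 1 \<Longrightarrow> eexp (eneglog x) = x"
  by (auto simp: eneglog_def eexp_ennreal)

lemma borel_measurable_eneglog [measurable]: "eneglog \<in> borel_measurable borel"
  unfolding eneglog_def by measurable

abbreviation expo :: "real measure" where
  "expo \<equiv> density lborel (\<lambda>x. ennreal (exponential_density 1 x))"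

lemma prob_space_expo: "prob_space expo"
  by (rule prob_space_exponential_density) simp

lemma expo_mean_eexp:
  fixes v :: "real \<Rightarrow> ennreal"
  defines "m \<equiv> enn2real (\<integral>\<^sup>+t. ennreal (eexp (v t)) \<partial>expo)"
  shows "ennreal m = (\<integral>\<^sup>+t. ennreal (eexp (v t)) \<partial>expo)" "0 \<le> m" "m \<le> 1"
proof -
  interpret E: prob_space expo by (rule prob_space_expo)
  have *: "(\<integral>\<^sup>+t. ennreal (eexp (v t)) \<partial>expo) \<le> (\<integral>\<^sup>+t. 1 \<partial>expo)"
    by (intro nn_integral_mono) auto
  then show **: "ennreal m = (\<integral>\<^sup>+t. ennreal (eexp (v t)) \<partial>expo)"
    using E.emeasure_space_1 unfolding m_def
    by (subst ennreal_enn2real) (auto simp: le_less_trans)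
  show "0 \<le> m" by (simp add: m_def)
  have "ennreal m \<le> 1" using * ** E.emeasure_space_1 by simp
  then show "m \<le> 1" by simp
qed

context prob_space
begin

text \<open>Independence is given for generated sigma-algebras. On rectangles it says that the pair
  has the product law, so by Fubini the two components may be drawn at separate points
  \<open>\<omega>\<close> and \<open>\<omega>'\<close>.\<close>

lemma indep_nn_integral_pair:
  assumes X [measurable]: "random_variable S X" and Y [measurable]: "random_variable T Y"
    and indep: "indep_set (sets (vimage_algebra (space M) X S)) (sets (vimage_algebra (space M) Y T))"
    and \<phi>: "\<phi> \<in> borel_measurable (S \<Otimes>\<^sub>M T)"
  shows "(\<integral>\<^sup>+\<omega>. \<phi> (X \<omega>, Y \<omega>) \<partial>M) = (\<integral>\<^sup>+\<omega>'. (\<integral>\<^sup>+\<omega>. \<phi> (X \<omega>, Y \<omega>') \<partial>M) \<partial>M)"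
proof -
  interpret PX: prob_space "distr M S X" by (rule prob_space_distr) fact
  interpret PY: prob_space "distr M T Y" by (rule prob_space_distr) fact
  interpret pair_sigma_finite "distr M S X" "distr M T Y" ..
  have eq: "distr M S X \<Otimes>\<^sub>M distr M T Y = distr M (S \<Otimes>\<^sub>M T) (\<lambda>x. (X x, Y x))"
  proof (rule pair_measure_eqI)
    fix A B assume "A \<in> sets (distr M S X)" "B \<in> sets (distr M T Y)"
    then have A: "A \<in> sets S" and B: "B \<in> sets T" by auto
    have "prob ((X -` A \<inter> space M) \<inter> (Y -` B \<inter> space M)) =
        prob (X -` A \<inter> space M) * prob (Y -` B \<inter> space M)"
      by (rule indep_setD[OF indep]) (auto intro: in_vimage_algebra A B)
    moreover have "(\<lambda>x. (X x, Y x)) -` (A \<times> B) \<inter> space M = (X -` A \<inter> space M) \<inter> (Y -` B \<inter> space M)"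
      by auto
    ultimately show "emeasure (distr M S X) A * emeasure (distr M T Y) B =
        emeasure (distr M (S \<Otimes>\<^sub>M T) (\<lambda>x. (X x, Y x))) (A \<times> B)"
      using A B by (simp add: emeasure_distr emeasure_eq_measure ennreal_mult')
  qed (auto intro: PX.sigma_finite_measure_axioms PY.sigma_finite_measure_axioms)
  have "(\<integral>\<^sup>+\<omega>. \<phi> (X \<omega>, Y \<omega>) \<partial>M) = (\<integral>\<^sup>+z. \<phi> z \<partial>distr M (S \<Otimes>\<^sub>M T) (\<lambda>x. (X x, Y x)))"
    using \<phi> by (subst nn_integral_distr) auto
  also have "\<dots> = (\<integral>\<^sup>+y. (\<integral>\<^sup>+x. \<phi> (x, y) \<partial>distr M S X) \<partial>distr M T Y)"
    unfolding eq[symmetric] using \<phi> by (intro nn_integral_snd[symmetric]) simp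
  also have "\<dots> = (\<integral>\<^sup>+\<omega>'. (\<integral>\<^sup>+x. \<phi> (x, Y \<omega>') \<partial>distr M S X) \<partial>M)"
    using \<phi> by (subst nn_integral_distr) (auto intro!: PX.borel_measurable_nn_integral)
  also have "\<dots> = (\<integral>\<^sup>+\<omega>'. (\<integral>\<^sup>+\<omega>. \<phi> (X \<omega>, Y \<omega>') \<partial>M) \<partial>M)"
    using \<phi> measurable_space[OF Y] by (intro nn_integral_cong nn_integral_distr) auto
  finally show ?thesis .
qed

end

section \<open>Integrating out the fading of the stations\<close>

context multi_tier_network
begin

abbreviation stations :: "(nat \<times> nat) set" where
  "stations \<equiv> {1..K} \<times> UNIV"

abbreviation fading_array :: "'w \<Rightarrow> nat \<times> nat \<Rightarrow> real" where
  "fading_array \<equiv> (\<lambda>\<omega>. \<lambda>(i, n)\<in>stations. h i n \<omega>)"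

abbreviation station_array :: "'w \<Rightarrow> nat \<times> nat \<Rightarrow> (real ^ 2) \<times> bool" where
  "station_array \<equiv> (\<lambda>\<omega>. \<lambda>(i, n)\<in>stations. (X i n \<omega>, act i n \<omega>))"

lemma fading_measurable: "i \<in> {1..K} \<Longrightarrow> h i n \<in> borel_measurable M"
  using distributed_measurable[OF fading_exponential] by simp

lemma fading_array_measurable: "fading_array \<in> measurable M (PiM stations (\<lambda>_. borel))"
  by (intro measurable_restrict) (auto intro: fading_measurable)

lemma station_array_measurable:
  "station_array \<in> measurable M (PiM stations (\<lambda>_. borel \<Otimes>\<^sub>M count_space UNIV))"
  using location_measurable active_measurable by (intro measurable_restrict) auto

lemma fading_nn_integral:
  assumes "i \<in> {1..K}" "f \<in> borel_measurable borel"
  shows "(\<integral>\<^sup>+\<omega>. f (h i n \<omega>) \<partial>M) = (\<integral>\<^sup>+x. f x \<partial>expo)"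
proof -
  have "(\<integral>\<^sup>+x. f x \<partial>expo) = (\<integral>\<^sup>+x. f x \<partial>distr M lborel (h i n))"
    using fading_exponential[OF assms(1), of n] by (simp add: distributed_def)
  also have "\<dots> = (\<integral>\<^sup>+\<omega>. f (h i n \<omega>) \<partial>M)"
    using assms fading_measurable[OF assms(1)] by (intro nn_integral_distr) auto
  finally show ?thesis ..
qed

lemma mark_measurable:
  fixes u :: "nat \<Rightarrow> bool \<Rightarrow> (real ^ 2) \<times> real \<Rightarrow> ennreal"
  assumes "\<And>i b. i \<in> {1..K} \<Longrightarrow> u i b \<in> borel_measurable (borel \<Otimes>\<^sub>M borel)" "i \<in> {1..K}"
  shows "(\<lambda>\<omega>. u i (act i n \<omega>) (X i n \<omega>, h i n \<omega>)) \<in> borel_measurable M"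
proof -
  note [measurable] = assms(1)[OF assms(2)] location_measurable[OF assms(2)]
    active_measurable[OF assms(2)] fading_measurable[OF assms(2)]
  have "(\<lambda>\<omega>. if act i n \<omega> then u i True (X i n \<omega>, h i n \<omega>) else u i False (X i n \<omega>, h i n \<omega>))
      \<in> borel_measurable M"
    by measurable
  then show ?thesis
    by (rule measurable_cong[THEN iffD1, rotated]) auto
qed

text \<open>The fading is independent of all locations and activity flags. Once these are frozen,
  the fading variables of finitely many distinct stations are independent and each factor is
  averaged separately. The cut-off \<open>N\<close> is there because the product rule for
  expectations concerns finite families.\<close>

lemma marked_partial_product:
  fixes u :: "nat \<Rightarrow> bool \<Rightarrow> (real ^ 2) \<times> real \<Rightarrow> ennreal"
  assumes u: "\<And>i b. i \<in> {1..K} \<Longrightarrow> u i b \<in> borel_measurable (borel \<Otimes>\<^sub>M borel)"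
  defines "g \<equiv> \<lambda>i b x. enn2real (\<integral>\<^sup>+t. ennreal (eexp (u i b (x, t))) \<partial>expo)"
  shows "expectation (\<lambda>\<omega>. \<Prod>(i, n)\<in>{1..K} \<times> {..<N}. eexp (u i (act i n \<omega>) (X i n \<omega>, h i n \<omega>))) =
    expectation (\<lambda>\<omega>. \<Prod>(i, n)\<in>{1..K} \<times> {..<N}. g i (act i n \<omega>) (X i n \<omega>))"
    (is "expectation ?L = expectation ?R")
proof -
  let ?I = "{1..K} \<times> {..<N}"
  let ?\<phi> = "\<lambda>(H, Y). \<Prod>k\<in>?I. ennreal (eexp (u (fst k) (snd (Y k)) (fst (Y k), H k)))"
  interpret E: prob_space expo by (rule prob_space_expo)
  have u_meas [measurable]: "(\<lambda>t. u i b (x, t)) \<in> borel_measurable borel" if "i \<in> {1..K}" for i b x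
    using u[OF that, of b] by measurable
  have g: "ennreal (g i b x) = (\<integral>\<^sup>+t. ennreal (eexp (u i b (x, t))) \<partial>expo)" for i b x
    unfolding g_def by (rule expo_mean_eexp)
  have g01: "0 \<le> g i b x" for i b x
    by (simp add: g_def)
  have \<phi>_meas: "?\<phi> \<in> borel_measurable
      (PiM stations (\<lambda>_. borel) \<Otimes>\<^sub>M PiM stations (\<lambda>_. borel \<Otimes>\<^sub>M count_space UNIV))"
  proof -
    have "(\<lambda>z. u (fst k) (snd (snd z k)) (fst (snd z k), fst z k)) \<in> borel_measurable
      (PiM stations (\<lambda>_. borel) \<Otimes>\<^sub>M PiM stations (\<lambda>_. borel \<Otimes>\<^sub>M count_space UNIV))"
      (is "_ \<in> borel_measurable ?P") if k: "k \<in> ?I" for k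
    proof -
      have [measurable]: "(\<lambda>z. fst z k) \<in> borel_measurable ?P"
        "(\<lambda>z. snd z k) \<in> measurable ?P (borel \<Otimes>\<^sub>M count_space UNIV)"
        using k by (auto intro!: measurable_compose[OF measurable_fst] measurable_compose[OF measurable_snd]
          measurable_component_singleton)
      have "fst k \<in> {1..K}" using k by auto
      note [measurable] = u[OF this]
      \<comment> \<open>Measurability of \<open>u\<close> is known for each fixed activity flag, so
        the random flag is resolved by cases.\<close>
      have "(\<lambda>z. if snd (snd z k) then u (fst k) True (fst (snd z k), fst z k)
          else u (fst k) False (fst (snd z k), fst z k)) \<in> borel_measurable ?P"
        by measurable
      then show ?thesis
        by (rule measurable_cong[THEN iffD1, rotated]) auto
    qed
    then show ?thesis
      unfolding case_prod_beta
      by (intro borel_measurable_prod_ennreal)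
         (rule measurable_compose[OF measurable_compose[OF _ borel_measurable_eexp] measurable_ennreal])
  qed
  have "(\<integral>\<^sup>+\<omega>. ennreal (?L \<omega>) \<partial>M) = (\<integral>\<^sup>+\<omega>. ?\<phi> (fading_array \<omega>, station_array \<omega>) \<partial>M)"
    by (auto simp: prod_ennreal case_prod_beta intro!: nn_integral_cong arg_cong[where f = ennreal] prod.cong)
  also have "\<dots> = (\<integral>\<^sup>+\<omega>'. (\<integral>\<^sup>+\<omega>. ?\<phi> (fading_array \<omega>, station_array \<omega>') \<partial>M) \<partial>M)"
    by (rule indep_nn_integral_pair[OF fading_array_measurable station_array_measurable
          fading_indep_stations \<phi>_meas])
  also have "\<dots> = (\<integral>\<^sup>+\<omega>'. ennreal (?R \<omega>') \<partial>M)"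
  proof (rule nn_integral_cong)
    fix \<omega>'
    \<comment> \<open>The stations are now frozen at \<open>\<omega>'\<close>, and only the fading
      is still random.\<close>
    let ?f = "\<lambda>k t. ennreal (eexp (u (fst k) (act (fst k) (snd k) \<omega>') (X (fst k) (snd k) \<omega>', t)))"
    have "(\<integral>\<^sup>+\<omega>. ?\<phi> (fading_array \<omega>, station_array \<omega>') \<partial>M) =
        (\<integral>\<^sup>+\<omega>. (\<Prod>k\<in>?I. ?f k (h (fst k) (snd k) \<omega>)) \<partial>M)"
      by (intro nn_integral_cong) (auto intro!: prod.cong)
    also have "\<dots> = (\<Prod>k\<in>?I. \<integral>\<^sup>+\<omega>. ?f k (h (fst k) (snd k) \<omega>) \<partial>M)"
    proof (rule indep_vars_nn_integral)
      have "indep_vars (\<lambda>_. borel) (\<lambda>(i, n). h i n) ?I"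
        by (rule indep_vars_subset[OF fading_indep]) auto
      then show "indep_vars (\<lambda>_. borel) (\<lambda>k \<omega>. ?f k (h (fst k) (snd k) \<omega>)) ?I"
        unfolding case_prod_beta by (rule indep_vars_compose2) auto
    qed auto
    also have "\<dots> = (\<Prod>k\<in>?I. ennreal (g (fst k) (act (fst k) (snd k) \<omega>') (X (fst k) (snd k) \<omega>')))"
    proof (rule prod.cong)
      fix k assume "k \<in> ?I"
      then have k: "fst k \<in> {1..K}" by auto
      show "(\<integral>\<^sup>+\<omega>. ?f k (h (fst k) (snd k) \<omega>) \<partial>M) =
          ennreal (g (fst k) (act (fst k) (snd k) \<omega>') (X (fst k) (snd k) \<omega>'))"
        unfolding g using k by (intro fading_nn_integral) auto
    qed simp
    also have "\<dots> = ennreal (?R \<omega>')"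
      by (subst prod_ennreal) (auto simp: g01 case_prod_beta)
    finally show "(\<integral>\<^sup>+\<omega>. ?\<phi> (fading_array \<omega>, station_array \<omega>') \<partial>M) = ennreal (?R \<omega>')" .
  qed
  finally have eq: "(\<integral>\<^sup>+\<omega>. ennreal (?L \<omega>) \<partial>M) = (\<integral>\<^sup>+\<omega>. ennreal (?R \<omega>) \<partial>M)" .
  have L_meas: "?L \<in> borel_measurable M"
    unfolding case_prod_beta
    by (intro borel_measurable_prod)
       (auto intro!: measurable_compose[OF _ borel_measurable_eexp] mark_measurable[OF u])
  have R_meas: "?R \<in> borel_measurable M"
  proof -
    have "(\<lambda>\<omega>. g i (act i n \<omega>) (X i n \<omega>)) \<in> borel_measurable M" if i: "i \<in> {1..K}" for i n
    proof -
      note [measurable] = u[OF i] location_measurable[OF i] active_measurable[OF i]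
      have [measurable]: "g i b \<in> borel_measurable borel" for b
        unfolding g_def by measurable
      have "(\<lambda>\<omega>. if act i n \<omega> then g i True (X i n \<omega>) else g i False (X i n \<omega>)) \<in> borel_measurable M"
        by measurable
      then show ?thesis
        by (rule measurable_cong[THEN iffD1, rotated]) auto
    qed
    then show ?thesis
      unfolding case_prod_beta by (intro borel_measurable_prod) auto
  qed
  show ?thesis
    using eq L_meas R_meas by (subst (1 2) integral_eq_nn_integral) (auto intro!: AE_I2 prod_nonneg simp: g01)
qed

lemma sum_split_active:
  "(\<Sum>n. v (act i n \<omega>) (X i n \<omega>) :: ennreal) = (\<Sum>b\<in>UNIV. psum (X i) (\<lambda>\<omega>. {n. act i n \<omega> = b}) (v b) \<omega>)"
proof -
  have "(\<Sum>n. v (act i n \<omega>) (X i n \<omega>)) =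
      (\<Sum>n. \<Sum>b\<in>UNIV. v b (X i n \<omega>) * indicator {n. act i n \<omega> = b} n)"
    by (intro suminf_cong) (simp add: UNIV_bool)
  also have "\<dots> = (\<Sum>b\<in>UNIV. \<Sum>n. v b (X i n \<omega>) * indicator {n. act i n \<omega> = b} n)"
    by (intro suminf_sum) auto
  finally show ?thesis by (simp add: psum_def)
qed

text \<open>Bounded convergence: all partial products lie in \<open>[0, 1]\<close>, and continuity
  of \<open>eexp\<close> identifies their limit even when a series diverges.\<close>

lemma expectation_prod_LIMSEQ:
  fixes f :: "nat \<Rightarrow> nat \<Rightarrow> 'w \<Rightarrow> ennreal"
  assumes f: "\<And>i n. i \<in> {1..K} \<Longrightarrow> f i n \<in> borel_measurable M"
  shows "(\<lambda>N. expectation (\<lambda>\<omega>. \<Prod>(i, n)\<in>{1..K} \<times> {..<N}. eexp (f i n \<omega>))) \<longlonglongrightarrow>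
    expectation (\<lambda>\<omega>. eexp (\<Sum>i=1..K. \<Sum>n. f i n \<omega>))"
proof (rule integral_dominated_convergence[where w = "\<lambda>_. 1"])
  show "(\<lambda>\<omega>. eexp (\<Sum>i=1..K. \<Sum>n. f i n \<omega>)) \<in> borel_measurable M"
    using f by (intro measurable_compose[OF _ borel_measurable_eexp] borel_measurable_sum
        borel_measurable_suminf_order) auto
  show "(\<lambda>\<omega>. \<Prod>(i, n)\<in>{1..K} \<times> {..<N}. eexp (f i n \<omega>)) \<in> borel_measurable M" for N
    unfolding case_prod_beta using f
    by (intro borel_measurable_prod) (auto intro: measurable_compose[OF _ borel_measurable_eexp])
  show "AE \<omega> in M. (\<lambda>N. \<Prod>(i, n)\<in>{1..K} \<times> {..<N}. eexp (f i n \<omega>)) \<longlonglongrightarrow>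
      eexp (\<Sum>i=1..K. \<Sum>n. f i n \<omega>)"
  proof (rule AE_I2)
    fix \<omega>
    have "(\<lambda>N. eexp (\<Sum>i=1..K. \<Sum>n<N. f i n \<omega>)) \<longlonglongrightarrow> eexp (\<Sum>i=1..K. \<Sum>n. f i n \<omega>)"
      by (intro tendsto_eexp tendsto_sum summable_LIMSEQ) auto
    then show "(\<lambda>N. \<Prod>(i, n)\<in>{1..K} \<times> {..<N}. eexp (f i n \<omega>)) \<longlonglongrightarrow> eexp (\<Sum>i=1..K. \<Sum>n. f i n \<omega>)"
      by (simp add: eexp_sum prod.cartesian_product)
  qed
  show "AE \<omega> in M. norm (\<Prod>(i, n)\<in>{1..K} \<times> {..<N}. eexp (f i n \<omega>)) \<le> 1" for N
    by (auto intro!: prod_le_1 prod_nonneg simp: abs_prod split_beta)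
qed auto

text \<open>This is the marking theorem in Laplace form. The averaged factor \<open>g\<close> lies
  in \<open>[0, 1]\<close>, hence equals \<open>eexp v\<close> for a weight \<open>v\<close>
  depending on location and activity only, and the functional of the unmarked processes applies to
  \<open>v\<close>.\<close>

theorem marked_laplace:
  fixes u :: "nat \<Rightarrow> bool \<Rightarrow> (real ^ 2) \<times> real \<Rightarrow> ennreal"
  assumes u: "\<And>i b. i \<in> {1..K} \<Longrightarrow> u i b \<in> borel_measurable (borel \<Otimes>\<^sub>M borel)"
    and dens: "\<And>i. i \<in> {1..K} \<Longrightarrow> 0 \<le> dens i"
    and p: "\<And>i. i \<in> {1..K} \<Longrightarrow> 0 \<le> p i \<and> p i \<le> 1"
  shows "expectation (\<lambda>\<omega>. eexp (\<Sum>i=1..K. \<Sum>n. u i (act i n \<omega>) (X i n \<omega>, h i n \<omega>))) =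
    eexp (\<Sum>i=1..K. \<Sum>b\<in>UNIV. ennreal ((if b then p i else 1 - p i) * dens i) *
      (\<integral>\<^sup>+x. (\<integral>\<^sup>+t. ennreal (1 - eexp (u i b (x, t))) \<partial>expo) \<partial>lborel))"
proof -
  interpret E: prob_space expo by (rule prob_space_expo)
  define g where "g i b x = enn2real (\<integral>\<^sup>+t. ennreal (eexp (u i b (x, t))) \<partial>expo)" for i b x
  have u_meas [measurable]: "(\<lambda>t. u i b (x, t)) \<in> borel_measurable borel" if "i \<in> {1..K}" for i b x
    using u[OF that, of b] by measurable
  have g: "ennreal (g i b x) = (\<integral>\<^sup>+t. ennreal (eexp (u i b (x, t))) \<partial>expo)"
    and g01: "0 \<le> g i b x" "g i b x \<le> 1" for i b x
    unfolding g_def by (rule expo_mean_eexp)+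
  have g_meas [measurable]: "g i b \<in> borel_measurable borel" if "i \<in> {1..K}" for i b
  proof -
    note [measurable] = u[OF that]
    show ?thesis unfolding g_def by measurable
  qed
  define v where "v i b x = eneglog (g i b x)" for i b x
  have v_meas [measurable]: "v i b \<in> borel_measurable borel" if "i \<in> {1..K}" for i b
    unfolding v_def using that by measurable
  have eexp_v: "eexp (v i b x) = g i b x" for i b x
    by (simp add: v_def eexp_eneglog g01)
  have v_mark: "(\<lambda>\<omega>. v i (act i n \<omega>) (X i n \<omega>)) \<in> borel_measurable M" if "i \<in> {1..K}" for i n
    using mark_measurable[of "\<lambda>i b z. v i b (fst z)" i n] that by simp
  have "expectation (\<lambda>\<omega>. \<Prod>(i, n)\<in>{1..K} \<times> {..<N}. eexp (u i (act i n \<omega>) (X i n \<omega>, h i n \<omega>))) =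
      expectation (\<lambda>\<omega>. \<Prod>(i, n)\<in>{1..K} \<times> {..<N}. eexp (v i (act i n \<omega>) (X i n \<omega>)))" for N
    unfolding eexp_v unfolding g_def by (rule marked_partial_product[OF u])
  moreover have "(\<lambda>N. expectation (\<lambda>\<omega>. \<Prod>(i, n)\<in>{1..K} \<times> {..<N}. eexp (u i (act i n \<omega>) (X i n \<omega>, h i n \<omega>))))
      \<longlonglongrightarrow> expectation (\<lambda>\<omega>. eexp (\<Sum>i=1..K. \<Sum>n. u i (act i n \<omega>) (X i n \<omega>, h i n \<omega>)))"
    by (rule expectation_prod_LIMSEQ) (rule mark_measurable[OF u])
  moreover have "(\<lambda>N. expectation (\<lambda>\<omega>. \<Prod>(i, n)\<in>{1..K} \<times> {..<N}. eexp (v i (act i n \<omega>) (X i n \<omega>))))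
      \<longlonglongrightarrow> expectation (\<lambda>\<omega>. eexp (\<Sum>i=1..K. \<Sum>n. v i (act i n \<omega>) (X i n \<omega>)))"
    by (rule expectation_prod_LIMSEQ) (rule v_mark)
  ultimately have "expectation (\<lambda>\<omega>. eexp (\<Sum>i=1..K. \<Sum>n. u i (act i n \<omega>) (X i n \<omega>, h i n \<omega>))) =
      expectation (\<lambda>\<omega>. eexp (\<Sum>i=1..K. \<Sum>n. v i (act i n \<omega>) (X i n \<omega>)))"
    by (simp add: LIMSEQ_unique)
  also have "\<dots> = expectation (\<lambda>\<omega>. \<Prod>(i, b)\<in>{1..K} \<times> UNIV.
      eexp (psum (X i) (\<lambda>\<omega>. {n. act i n \<omega> = b}) (v i b) \<omega>))"
    by (simp add: sum_split_active eexp_sum prod.cartesian_product)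
  also have "\<dots> = (\<Prod>j\<in>{1..K} \<times> UNIV. eexp (ennreal ((if snd j then p (fst j) else 1 - p (fst j)) * dens (fst j)) *
      (\<integral>\<^sup>+x. ennreal (1 - eexp (v (fst j) (snd j) x)) \<partial>lborel)))"
    unfolding case_prod_beta
  proof (rule PPP_joint_laplace)
    fix j :: "nat \<times> bool" assume "j \<in> {1..K} \<times> UNIV"
    then have j: "fst j \<in> {1..K}" by auto
    show "homogeneous_PPP ((if snd j then p (fst j) else 1 - p (fst j)) * dens (fst j)) (X (fst j))
        (\<lambda>\<omega>. {n. act (fst j) n \<omega> = snd j})"
      using PPP_active[OF j] PPP_idle[OF j] by (cases "snd j") auto
    show "0 \<le> (if snd j then p (fst j) else 1 - p (fst j)) * dens (fst j)"
      using dens[OF j] p[OF j] by auto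
    show "X (fst j) n \<in> borel_measurable M" for n
      by (rule location_measurable[OF j])
    show "v (fst j) (snd j) \<in> borel_measurable borel" using j by simp
    note [measurable] = active_measurable[OF j]
    show "{\<omega> \<in> space M. n \<in> {n. act (fst j) n \<omega> = snd j}} \<in> events" for n
      by simp
  next
    show "indep_vars (\<lambda>_. count_space_PiM)
        (\<lambda>j. count_process (X (fst j)) (\<lambda>\<omega>. {n. act (fst j) n \<omega> = snd j})) ({1..K} \<times> UNIV)"
      using indep_processes by (simp only: case_prod_unfold)
  qed simp
  also have "\<dots> = eexp (\<Sum>i=1..K. \<Sum>b\<in>UNIV. ennreal ((if b then p i else 1 - p i) * dens i) *
      (\<integral>\<^sup>+x. ennreal (1 - eexp (v i b x)) \<partial>lborel))"
    by (simp add: eexp_sum prod.cartesian_product case_prod_beta)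
  also have "\<dots> = eexp (\<Sum>i=1..K. \<Sum>b\<in>UNIV. ennreal ((if b then p i else 1 - p i) * dens i) *
      (\<integral>\<^sup>+x. (\<integral>\<^sup>+t. ennreal (1 - eexp (u i b (x, t))) \<partial>expo) \<partial>lborel))"
  proof (intro arg_cong[where f = eexp] sum.cong arg_cong2[where f = "(*)"] nn_integral_cong refl)
    fix i b x assume i: "i \<in> {1..K}"
    \<comment> \<open>Since \<open>expo\<close> has total mass one, \<open>1 - g\<close> is the
      fading average of \<open>1 - eexp u\<close>.\<close>
    have "(\<integral>\<^sup>+t. ennreal (1 - eexp (u i b (x, t))) \<partial>expo) =
        (\<integral>\<^sup>+t. 1 - ennreal (eexp (u i b (x, t))) \<partial>expo)"
      by (intro nn_integral_cong) (simp add: ennreal_minus flip: ennreal_1)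
    also have "\<dots> = (\<integral>\<^sup>+t. 1 \<partial>expo) - (\<integral>\<^sup>+t. ennreal (eexp (u i b (x, t))) \<partial>expo)"
      using i by (intro nn_integral_diff) (auto simp flip: g)
    also have "\<dots> = ennreal (1 - g i b x)"
      using E.emeasure_space_1 g01 ennreal_minus[of "g i b x" 1] by (simp flip: g)
    finally show "ennreal (1 - eexp (v i b x)) = (\<integral>\<^sup>+t. ennreal (1 - eexp (u i b (x, t))) \<partial>expo)"
      by (simp add: eexp_v)
  qed
  finally show ?thesis .
qed

end

section \<open>Intensity of the received powers\<close>

text \<open>Both measures may have infinite mass near 0. Beyond each \<open>c > 0\<close> they are
  finite, and the open half-lines generate the Borel sets and are closed under intersection; then
  \<open>c = 1 / (n + 1)\<close> is sent to 0 by monotone convergence.\<close>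

lemma nn_integral_eq_of_tails:
  fixes N1 N2 :: "real measure"
  assumes [measurable_cong]: "sets N1 = sets borel" "sets N2 = sets borel"
    and tail: "\<And>y. 0 < y \<Longrightarrow> emeasure N1 {y<..} = emeasure N2 {y<..}"
    and fin: "\<And>y. 0 < y \<Longrightarrow> emeasure N1 {y<..} < \<infinity>"
    and f [measurable]: "f \<in> borel_measurable borel" and f0: "\<And>s. s \<le> 0 \<Longrightarrow> f s = 0"
  shows "(\<integral>\<^sup>+s. f s \<partial>N1) = (\<integral>\<^sup>+s. f s \<partial>N2)"
proof -
  define D where "D N c = density N (indicator {c<..})" for N and c :: real
  have D: "emeasure (D N c) A = emeasure N ({c<..} \<inter> A)"
    if "sets N = sets borel" "A \<in> sets borel" for N c A
    using that by (simp add: D_def emeasure_restricted Int_commute cong: sets_eq_imp_space_eq)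
  have eq: "D N1 c = D N2 c" if c: "0 < c" for c
  proof (rule measure_eqI_generator_eq[where \<Omega> = UNIV and E = "range greaterThan" and A = "\<lambda>n. {- real n<..}"])
    show "Int_stable (range greaterThan :: real set set)"
    proof (rule Int_stableI)
      fix A B :: "real set" assume "A \<in> range greaterThan" "B \<in> range greaterThan"
      then obtain a b where "A = {a<..}" "B = {b<..}" by auto
      then have "A \<inter> B = {max a b<..}" by auto
      then show "A \<inter> B \<in> range greaterThan" by blast
    qed
    show "emeasure (D N1 c) A = emeasure (D N2 c) A" if "A \<in> range greaterThan" for A
    proof -
      from that obtain y where A: "A = {y<..}" by auto
      then have "{c<..} \<inter> A = {max c y<..}" by auto
      then show ?thesis using c tail[of "max c y"] assms(1,2) A by (simp add: D)
    qed
    show "sets (D N1 c) = sigma_sets UNIV (range greaterThan)"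
      "sets (D N2 c) = sigma_sets UNIV (range greaterThan)"
      using assms(1,2) by (auto simp: D_def borel_Ioi)
    show "(\<Union>n. {- real n<..}) = UNIV"
    proof safe
      fix x :: real
      obtain n where "- x < real n" using reals_Archimedean2 by blast
      then show "x \<in> (\<Union>n. {- real n<..})" by (auto intro!: exI[of _ n])
    qed auto
    show "emeasure (D N1 c) {- real n<..} \<noteq> \<infinity>" for n
    proof -
      have "{c<..} \<inter> {- real n<..} = {c<..}" using c by auto
      then show ?thesis using fin[of c] c assms(1) by (simp add: D)
    qed
  qed auto
  let ?g = "\<lambda>n s. indicator {1 / real (Suc n)<..} s * f s"
  have g: "(\<integral>\<^sup>+s. ?g n s \<partial>N1) = (\<integral>\<^sup>+s. ?g n s \<partial>N2)" for n
  proof -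
    have "(\<integral>\<^sup>+s. ?g n s \<partial>N) = (\<integral>\<^sup>+s. f s \<partial>D N (1 / real (Suc n)))" if [measurable_cong]: "sets N = sets borel" for N
      unfolding D_def by (subst nn_integral_density) auto
    then show ?thesis using assms(1,2) eq[of "1 / real (Suc n)"] by simp
  qed
  have f_eq: "f s = (SUP n. ?g n s)" for s
  proof (cases "0 < s")
    case True
    then obtain n where n: "1 / real (Suc n) < s"
      using nat_approx_posE by (metis of_nat_Suc)
    show ?thesis
    proof (rule antisym)
      show "f s \<le> (SUP n. ?g n s)" using n by (intro SUP_upper2[of n]) auto
      show "(SUP n. ?g n s) \<le> f s" by (intro SUP_least) (auto simp: indicator_def)
    qed
  next
    case False
    then show ?thesis using f0[of s] by simp
  qed
  have inc: "incseq ?g"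
  proof (intro incseq_SucI le_funI)
    fix n s
    have "1 / real (Suc (Suc n)) \<le> 1 / real (Suc n)" by (simp add: divide_simps)
    then show "?g n s \<le> ?g (Suc n) s" by (auto simp: indicator_def simp del: of_nat_Suc)
  qed
  have "(\<integral>\<^sup>+s. f s \<partial>N) = (SUP n. \<integral>\<^sup>+s. ?g n s \<partial>N)" if [measurable_cong]: "sets N = sets borel" for N
  proof -
    have "(\<integral>\<^sup>+s. f s \<partial>N) = (\<integral>\<^sup>+s. (SUP n. ?g n s) \<partial>N)"
      by (rule nn_integral_cong) (rule f_eq)
    also have "\<dots> = (SUP n. \<integral>\<^sup>+s. ?g n s \<partial>N)"
      by (intro nn_integral_monotone_convergence_SUP inc) measurable
    finally show ?thesis .
  qed
  then show ?thesis using g assms(1,2) by simp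
qed

text \<open>Normalised so that its tail beyond \<open>y > 0\<close> is exactly
  \<open>y powr - \<delta>\<close>; all tier-dependent constants are kept outside.\<close>

definition power_intensity :: "real \<Rightarrow> real measure" where
  "power_intensity \<delta> = density lborel (\<lambda>s. ennreal (\<delta> * s powr (- \<delta> - 1)) * indicator {0<..} s)"

lemma sets_power_intensity [simp, measurable_cong]: "sets (power_intensity \<delta>) = sets borel"
  by (simp add: power_intensity_def)

lemma space_power_intensity [simp]: "space (power_intensity \<delta>) = UNIV"
  by (simp add: power_intensity_def)

lemma emeasure_power_intensity:
  assumes "0 < \<delta>" "0 < y"
  shows "emeasure (power_intensity \<delta>) {y<..} = ennreal (y powr - \<delta>)"
    "emeasure (power_intensity \<delta>) {y..} = ennreal (y powr - \<delta>)"
proof -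
  have "(\<integral>\<^sup>+s. ennreal (\<delta> * s powr (- \<delta> - 1) * indicator {0<..} s) * indicator {y..} s \<partial>lborel) =
      ennreal (0 - (- (y powr - \<delta>)))"
  proof (rule nn_integral_FTC_atLeast[where F = "\<lambda>s. - (s powr - \<delta>)"])
    fix x assume "y \<le> x"
    with assms show "((\<lambda>s. - (s powr - \<delta>)) has_real_derivative \<delta> * x powr (- \<delta> - 1) * indicator {0<..} x) (at x)"
      by (auto intro!: derivative_eq_intros)
    show "0 \<le> \<delta> * x powr (- \<delta> - 1) * indicator {0<..} x" using assms by simp
  next
    have "((\<lambda>s. - (s powr - \<delta>)) \<longlongrightarrow> - 0) at_top"
      using assms by (intro tendsto_minus tendsto_neg_powr filterlim_ident) auto
    then show "((\<lambda>s. - (s powr - \<delta>)) \<longlongrightarrow> 0) at_top" by simp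
  qed auto
  then show 2: "emeasure (power_intensity \<delta>) {y..} = ennreal (y powr - \<delta>)"
    by (simp add: power_intensity_def emeasure_density ennreal_mult'' ennreal_indicator)
  have "emeasure (power_intensity \<delta>) {y<..} = emeasure (power_intensity \<delta>) {y..}"
  proof (rule emeasure_eq_AE)
    have "AE s in lborel. s \<noteq> y" by (rule AE_lborel_singleton)
    then have "AE s in power_intensity \<delta>. s \<noteq> y"
      unfolding power_intensity_def by (subst AE_density) auto
    then show "AE s in power_intensity \<delta>. (s \<in> {y<..}) = (s \<in> {y..})" by eventually_elim auto
  qed auto
  with 2 show "emeasure (power_intensity \<delta>) {y<..} = ennreal (y powr - \<delta>)" by simp
qed

lemma AE_power_intensity_pos: "AE s in power_intensity \<delta>. 0 < s"
  unfolding power_intensity_def by (subst AE_density) (auto simp: indicator_def)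

lemma sigma_finite_power_intensity: "sigma_finite_measure (power_intensity \<delta>)"
proof -
  have "power_intensity \<delta> = density lborel (\<lambda>s. ennreal (\<delta> * s powr (- \<delta> - 1) * indicator {0<..} s))"
    by (auto simp: power_intensity_def ennreal_mult'' ennreal_indicator intro!: density_cong)
  then show ?thesis
    by (simp add: sigma_finite_measure.sigma_finite_iff_density_finite[OF lborel.sigma_finite_measure_axioms])
qed

lemma nn_integral_exponential_powr:
  assumes "0 < \<delta>" "0 \<le> c"
  shows "(\<integral>\<^sup>+t. ennreal ((c * t) powr \<delta>) * indicator {0<..} t \<partial>expo) =
    ennreal (c powr \<delta> * Gamma (1 + \<delta>))"
proof -
  have "(\<integral>\<^sup>+t. ennreal ((c * t) powr \<delta>) * indicator {0<..} t \<partial>expo) =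
      (\<integral>\<^sup>+t. ennreal (c powr \<delta>) * ennreal (indicator {0..} t * t powr (1 + \<delta> - 1) / exp t) \<partial>lborel)"
    using assms by (subst nn_integral_density)
      (auto simp: exponential_density_def powr_mult exp_minus divide_inverse ac_simps
         simp flip: ennreal_mult' intro!: nn_integral_cong split: split_indicator)
  also have "\<dots> = ennreal (c powr \<delta>) * ennreal (Gamma (1 + \<delta>))"
    using assms by (subst nn_integral_cmult) (auto simp: Gamma_conv_nn_integral_real)
  finally show ?thesis by (simp add: ennreal_mult')
qed

text \<open>For fixed fading \<open>t\<close> the points received above level \<open>y\<close> form
  a disc of area \<open>pi * (P * t / y) powr \<delta>\<close>. Averaging
  \<open>t powr \<delta>\<close> over the exponential law gives \<open>Gamma (1 + \<delta>)\<close>,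
  so the image measure has the tails of a multiple of \<open>power_intensity\<close>.\<close>

lemma nn_integral_received_power:
  fixes f :: "real \<Rightarrow> ennreal"
  assumes \<alpha>: "0 < \<alpha>" and P: "0 < P" and f [measurable]: "f \<in> borel_measurable borel"
    and f0: "\<And>s. s \<le> 0 \<Longrightarrow> f s = 0"
  defines "\<delta> \<equiv> 2 / \<alpha>"
  shows "(\<integral>\<^sup>+x. (\<integral>\<^sup>+t. f (P * t * norm (x :: real ^ 2) powr - \<alpha>)
      \<partial>expo) \<partial>lborel) =
    ennreal (pi * P powr \<delta> * Gamma (1 + \<delta>)) * (\<integral>\<^sup>+s. f s \<partial>power_intensity \<delta>)"
proof -
  define ex where "ex = expo"
  have sets_ex [simp, measurable_cong]: "sets ex = sets borel" by (simp add: ex_def)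
  interpret ex: prob_space ex unfolding ex_def by (rule prob_space_exponential_density) simp
  interpret pair_sigma_finite "lborel :: (real ^ 2) measure" ex ..
  let ?s = "\<lambda>(x :: real ^ 2, t). P * t * norm x powr - \<alpha>"
  let ?k = "pi * P powr \<delta> * Gamma (1 + \<delta>)"
  have \<delta>: "0 < \<delta>" using \<alpha> by (simp add: \<delta>_def)
  have s_meas [measurable]: "?s \<in> borel_measurable (lborel \<Otimes>\<^sub>M ex)" by measurable
  have ball: "emeasure lborel {x :: real ^ 2. y < P * t * norm x powr - \<alpha>} =
      ennreal (pi * (P / y * t) powr \<delta>) * indicator {0<..} t" if y: "0 < y" for y t
  proof (cases "0 < t")
    case t: True
    let ?r = "(P / y * t) powr (1 / \<alpha>)"
    have r: "0 < ?r" using P y t by simp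
    \<comment> \<open>At the origin \<open>0 powr - \<alpha>\<close> is 0, so no power is received
      there and the disc is punctured; the missing point is a null set.\<close>
    have "y < P * t * norm x powr - \<alpha> \<longleftrightarrow> x \<in> ball 0 ?r - {0}" for x :: "real ^ 2"
    proof (cases "x = 0")
      case False
      then have x: "0 < norm x" by simp
      have "y < P * t * norm x powr - \<alpha> \<longleftrightarrow> norm x powr \<alpha> < P / y * t"
        using x y P t by (simp add: powr_minus field_simps)
      also have "\<dots> \<longleftrightarrow> norm x powr \<alpha> < ?r powr \<alpha>"
        using P y t \<alpha> by (simp add: powr_powr)
      also have "\<dots> \<longleftrightarrow> norm x < ?r"
        using x r \<alpha> by (auto intro: powr_less_mono2 simp: powr_less_cancel2)
      finally show ?thesis using x by simp
    qed (use y in auto)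
    then have "{x :: real ^ 2. y < P * t * norm x powr - \<alpha>} = ball 0 ?r - {0}" by blast
    then have "emeasure lborel {x :: real ^ 2. y < P * t * norm x powr - \<alpha>} = emeasure lborel (ball (0 :: real ^ 2) ?r)"
      by (simp, intro emeasure_Diff_null_set) (auto intro: finite_imp_null_set_lborel)
    also have "\<dots> = ennreal (pi * ?r ^ 2)"
      using r by (subst emeasure_ball) (auto simp: unit_ball_vol_2)
    also have "?r ^ 2 = (P / y * t) powr \<delta>"
      using P y t by (simp add: powr_powr \<delta>_def flip: powr_numeral)
    finally show ?thesis using t by simp
  next
    case False
    have "P * t * norm x powr - \<alpha> \<le> 0" for x :: "real ^ 2"
    proof (rule mult_nonpos_nonneg)
      show "P * t \<le> 0" using False P by (intro mult_nonneg_nonpos) auto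
    qed simp
    then have "{x :: real ^ 2. y < P * t * norm x powr - \<alpha>} = {}"
      using y by (auto simp: not_less intro: order_trans[OF _ less_imp_le])
    then show ?thesis using False by simp
  qed
  have tail: "emeasure (distr (lborel \<Otimes>\<^sub>M ex) borel ?s) {y<..} = ennreal (?k * y powr - \<delta>)" if y: "0 < y" for y
  proof -
    have "emeasure (distr (lborel \<Otimes>\<^sub>M ex) borel ?s) {y<..} =
        (\<integral>\<^sup>+z. indicator {y<..} z \<partial>distr (lborel \<Otimes>\<^sub>M ex) borel ?s)"
      by (rule nn_integral_indicator[symmetric]) simp
    also have "\<dots> = (\<integral>\<^sup>+z. indicator {y<..} (?s z) \<partial>(lborel \<Otimes>\<^sub>M ex))"
      by (rule nn_integral_distr) (rule s_meas, simp)
    also have "\<dots> = (\<integral>\<^sup>+t. (\<integral>\<^sup>+x. indicator {y<..} (?s (x, t)) \<partial>lborel) \<partial>ex)"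
      by (rule nn_integral_snd[symmetric]) measurable
    also have "\<dots> = (\<integral>\<^sup>+t. emeasure lborel {x :: real ^ 2. y < P * t * norm x powr - \<alpha>} \<partial>ex)"
    proof (rule nn_integral_cong)
      fix t
      have "(\<integral>\<^sup>+x. indicator {y<..} (?s (x, t)) \<partial>lborel) =
          (\<integral>\<^sup>+x. indicator {x :: real ^ 2. y < P * t * norm x powr - \<alpha>} x \<partial>lborel)"
        by (intro nn_integral_cong) (simp add: indicator_def)
      also have "\<dots> = emeasure lborel {x :: real ^ 2. y < P * t * norm x powr - \<alpha>}"
        by (rule nn_integral_indicator) simp
      finally show "(\<integral>\<^sup>+x. indicator {y<..} (?s (x, t)) \<partial>lborel) = \<dots>" .
    qed
    also have "\<dots> = (\<integral>\<^sup>+t. ennreal pi * (ennreal ((P / y * t) powr \<delta>) * indicator {0<..} t) \<partial>ex)"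
      unfolding ball[OF y] by (simp add: ennreal_mult' mult.assoc)
    also have "\<dots> = ennreal pi * ennreal ((P / y) powr \<delta> * Gamma (1 + \<delta>))"
      using \<delta> P y nn_integral_exponential_powr[of \<delta> "P / y"]
      by (subst nn_integral_cmult) (simp_all add: ex_def)
    also have "\<dots> = ennreal (?k * y powr - \<delta>)"
    proof -
      have "(P / y) powr \<delta> = P powr \<delta> * y powr - \<delta>"
        using P y by (simp add: powr_divide powr_minus_divide)
      then have "pi * ((P / y) powr \<delta> * Gamma (1 + \<delta>)) = ?k * y powr - \<delta>" by (simp only: ac_simps)
      moreover have "ennreal pi * ennreal ((P / y) powr \<delta> * Gamma (1 + \<delta>)) =
          ennreal (pi * ((P / y) powr \<delta> * Gamma (1 + \<delta>)))"
        by (rule ennreal_mult'[symmetric]) simp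
      ultimately show ?thesis by (simp only:)
    qed
    finally show ?thesis .
  qed
  have k: "0 \<le> ?k" using \<delta> by (simp add: Gamma_real_pos less_imp_le)
  have "(\<integral>\<^sup>+x. (\<integral>\<^sup>+t. f (P * t * norm (x :: real ^ 2) powr - \<alpha>) \<partial>ex) \<partial>lborel) =
      (\<integral>\<^sup>+z. f (?s z) \<partial>(lborel \<Otimes>\<^sub>M ex))"
    using ex.nn_integral_fst[of "\<lambda>z. f (?s z)" lborel] by simp
  also have "\<dots> = (\<integral>\<^sup>+s. f s \<partial>distr (lborel \<Otimes>\<^sub>M ex) borel ?s)"
    by (rule nn_integral_distr[symmetric]) auto
  also have "\<dots> = (\<integral>\<^sup>+s. f s \<partial>scale_measure (ennreal ?k) (power_intensity \<delta>))"
    by (rule nn_integral_eq_of_tails)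
       (auto simp: tail emeasure_power_intensity[OF \<delta>] ennreal_mult'[OF k] f0 ennreal_mult_less_top)
  also have "\<dots> = ennreal ?k * (\<integral>\<^sup>+s. f s \<partial>power_intensity \<delta>)"
    by (rule nn_integral_scale_measure) simp
  finally show ?thesis by (simp add: ex_def)
qed

section \<open>Measures determined by their Laplace transform\<close>

text \<open>Under \<open>z = exp (- x)\<close> the Laplace transform at the integers becomes the moment sequence of a
  measure on \<open>[0, 1]\<close>, which determines it by Weierstrass approximation.\<close>

lemma integral_eq_of_laplace:
  fixes N1 N2 :: "real measure" and \<phi> :: "real \<Rightarrow> real"
  assumes "finite_measure N1" "finite_measure N2"
    and sets [measurable_cong]: "sets N1 = sets borel" "sets N2 = sets borel"
    and pos: "AE x in N1. 0 \<le> x" "AE x in N2. 0 \<le> x"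
    and eq: "\<And>t :: nat. (\<integral>x. exp (- real t * x) \<partial>N1) = (\<integral>x. exp (- real t * x) \<partial>N2)"
    and \<phi>: "continuous_on UNIV \<phi>"
  shows "(\<integral>x. \<phi> (exp (- x)) \<partial>N1) = (\<integral>x. \<phi> (exp (- x)) \<partial>N2)"
proof -
  interpret N1: finite_measure N1 by fact
  interpret N2: finite_measure N2 by fact
  have \<phi>01: "continuous_on {0..1} \<phi>" using \<phi> continuous_on_subset by blast
  have [measurable]: "\<phi> \<in> borel_measurable borel"
    using \<phi> by (rule borel_measurable_continuous_onI)
  have "bounded (\<phi> ` {0..1})"
    using \<phi>01 compact_continuous_image compact_imp_bounded by blast
  then obtain b where b: "\<And>x. x \<in> {0..1} \<Longrightarrow> \<bar>\<phi> x\<bar> \<le> b"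
    unfolding bounded_iff by (metis imageI real_norm_def)
  let ?m = "measure N1 UNIV + measure N2 UNIV"
  have "\<bar>(\<integral>x. \<phi> (exp (- x)) \<partial>N1) - (\<integral>x. \<phi> (exp (- x)) \<partial>N2)\<bar> \<le> e * ?m" if e: "0 < e" for e
  proof -
    obtain g where g: "real_polynomial_function g" "\<And>x. x \<in> {0..1} \<Longrightarrow> \<bar>\<phi> x - g x\<bar> < e"
      using Stone_Weierstrass_real_polynomial_function[OF _ \<phi>01 e] by auto
    obtain a n where a: "g = (\<lambda>x. \<Sum>i\<le>n. a i * x ^ i)"
      using g(1) real_polynomial_function_iff_sum by metis
    have g_exp: "g (exp (- x)) = (\<Sum>i\<le>n. a i * exp (- real i * x))" for x
      by (simp add: a exp_of_nat_mult[symmetric])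
    have *: "\<bar>(\<integral>x. \<phi> (exp (- x)) \<partial>N) - (\<Sum>i\<le>n. a i * (\<integral>x. exp (- real i * x) \<partial>N))\<bar> \<le> e * measure N UNIV"
      if "finite_measure N" and [measurable_cong]: "sets N = sets borel" and pos: "AE x in N. 0 \<le> x" for N
    proof -
      interpret finite_measure N by fact
      have space: "space N = UNIV" using that(2) by (metis sets_eq_imp_space_eq space_borel)
      have ie: "integrable N (\<lambda>x. exp (- real i * x))" for i
        by (rule integrable_const_bound[of _ 1]) (use pos in auto)
      have ip: "integrable N (\<lambda>x. \<phi> (exp (- x)))"
        by (rule integrable_const_bound[of _ b]) (use pos b in auto)
      have "(\<Sum>i\<le>n. a i * (\<integral>x. exp (- real i * x) \<partial>N)) = (\<integral>x. g (exp (- x)) \<partial>N)"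
        unfolding g_exp using ie by (subst Bochner_Integration.integral_sum) auto
      moreover have ig: "integrable N (\<lambda>x. g (exp (- x)))"
        unfolding g_exp using ie by (intro Bochner_Integration.integrable_sum) auto
      moreover have "\<bar>\<integral>x. \<phi> (exp (- x)) - g (exp (- x)) \<partial>N\<bar> \<le> (\<integral>x. e \<partial>N)"
      proof -
        have "AE x in N. \<bar>\<phi> (exp (- x)) - g (exp (- x))\<bar> \<le> e"
          using pos by eventually_elim (auto intro!: less_imp_le[OF g(2)])
        then have "(\<integral>x. \<bar>\<phi> (exp (- x)) - g (exp (- x))\<bar> \<partial>N) \<le> (\<integral>x. e \<partial>N)"
          using ip ig by (intro integral_mono_AE) auto
        then show ?thesis by (rule order_trans[OF integral_abs_bound])
      qed
      moreover have "(\<integral>x. \<phi> (exp (- x)) - g (exp (- x)) \<partial>N) = (\<integral>x. \<phi> (exp (- x)) \<partial>N) - (\<integral>x. g (exp (- x)) \<partial>N)"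
        using ip ig by (rule Bochner_Integration.integral_diff)
      moreover have "(\<integral>x. e \<partial>N) = e * measure N UNIV" by (simp add: space)
      ultimately show ?thesis by (simp only:)
    qed
    show ?thesis
      using *[OF assms(1) sets(1) pos(1)] *[OF assms(2) sets(2) pos(2)]
      unfolding eq distrib_left by linarith
  qed
  note bound = this
  have "\<bar>(\<integral>x. \<phi> (exp (- x)) \<partial>N1) - (\<integral>x. \<phi> (exp (- x)) \<partial>N2)\<bar> \<le> 0 + e" if "0 < e" for e
  proof -
    have m: "0 \<le> ?m" "?m + 1 \<noteq> 0"
      using measure_nonneg[of N1 UNIV] measure_nonneg[of N2 UNIV] by linarith+
    \<comment> \<open>The approximation error is multiplied by the total mass \<open>?m\<close>,
      hence the accuracy \<open>e / (?m + 1)\<close>; the \<open>+ 1\<close> covers the case of zero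
      mass.\<close>
    have "\<bar>(\<integral>x. \<phi> (exp (- x)) \<partial>N1) - (\<integral>x. \<phi> (exp (- x)) \<partial>N2)\<bar> \<le> (e / (?m + 1)) * ?m"
      using that m by (intro bound divide_pos_pos) linarith+
    also have "\<dots> \<le> (e / (?m + 1)) * (?m + 1)"
      using that m by (intro mult_left_mono) auto
    also have "\<dots> = e" using m(2) by (subst times_divide_eq_left) (rule nonzero_mult_div_cancel_right)
    finally show ?thesis by simp
  qed
  then have "\<bar>(\<integral>x. \<phi> (exp (- x)) \<partial>N1) - (\<integral>x. \<phi> (exp (- x)) \<partial>N2)\<bar> \<le> 0"
    by (rule field_le_epsilon)
  then show ?thesis by simp
qed

lemma measure_atMost_eq_of_laplace:
  fixes N1 N2 :: "real measure"
  assumes "finite_measure N1" "finite_measure N2"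
    and sets [measurable_cong]: "sets N1 = sets borel" "sets N2 = sets borel"
    and pos: "AE x in N1. 0 \<le> x" "AE x in N2. 0 \<le> x"
    and eq: "\<And>t :: nat. (\<integral>x. exp (- real t * x) \<partial>N1) = (\<integral>x. exp (- real t * x) \<partial>N2)"
  shows "emeasure N1 {..b} = emeasure N2 {..b}"
proof -
  \<comment> \<open>In the variable \<open>z = exp (- x)\<close> this is 1 for
    \<open>z \<ge> exp (- b)\<close>, that is for \<open>x \<le> b\<close>, and falls linearly to 0
    with slope \<open>k\<close>: a continuous approximation of the indicator of \<open>{..b}\<close>
    from above.\<close>
  define \<phi> where "\<phi> k z = min 1 (max 0 (1 + real k * (z - exp (- b))))" for k :: nat and z
  have lim: "(\<lambda>k. \<phi> k (exp (- x))) \<longlonglongrightarrow> indicator {..b} x" for x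
  proof (cases "x \<le> b")
    case True
    then have "\<phi> k (exp (- x)) = 1" for k by (simp add: \<phi>_def)
    with True show ?thesis by simp
  next
    case False
    then have "0 < exp (- b) - exp (- x)" by simp
    then obtain n where n: "1 < real n * (exp (- b) - exp (- x))"
      using reals_Archimedean3 by blast
    have "\<phi> k (exp (- x)) = 0" if "n \<le> k" for k
    proof -
      have "real n * (exp (- b) - exp (- x)) \<le> real k * (exp (- b) - exp (- x))"
        using that False by (intro mult_right_mono) auto
      with n have "1 + real k * (exp (- x) - exp (- b)) \<le> 0" by (simp add: algebra_simps)
      then show ?thesis by (simp add: \<phi>_def)
    qed
    then have "\<forall>\<^sub>F k in sequentially. \<phi> k (exp (- x)) = indicator {..b} x"
      using False by (auto simp: eventually_sequentially)
    then show ?thesis by (rule tendsto_eventually)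
  qed
  have *: "(\<lambda>k. \<integral>x. \<phi> k (exp (- x)) \<partial>N) \<longlonglongrightarrow> measure N {..b}"
    if "finite_measure N" and [measurable_cong]: "sets N = sets borel" for N
  proof -
    interpret finite_measure N by fact
    have "(\<lambda>k. \<integral>x. \<phi> k (exp (- x)) \<partial>N) \<longlonglongrightarrow> (\<integral>x. indicator {..b} x \<partial>N)"
    proof (rule integral_dominated_convergence[where w = "\<lambda>_. 1"])
      show "AE x in N. (\<lambda>k. \<phi> k (exp (- x))) \<longlonglongrightarrow> indicator {..b} x" using lim by simp
    qed (auto simp: \<phi>_def)
    then show ?thesis by simp
  qed
  have "(\<integral>x. \<phi> k (exp (- x)) \<partial>N1) = (\<integral>x. \<phi> k (exp (- x)) \<partial>N2)" for k
    by (rule integral_eq_of_laplace[OF assms]) (auto simp: \<phi>_def intro!: continuous_intros)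
  then have "measure N1 {..b} = measure N2 {..b}"
    using *[OF assms(1) sets(1)] *[OF assms(2) sets(2)] LIMSEQ_unique by auto
  then show ?thesis
    using assms(1,2) by (simp add: finite_measure.emeasure_eq_measure)
qed

lemma measure_atMost_eq_of_nn_laplace:
  fixes N1 N2 :: "real measure"
  assumes sets [measurable_cong]: "sets N1 = sets borel" "sets N2 = sets borel"
    and pos: "AE x in N1. 0 \<le> x" "AE x in N2. 0 \<le> x"
    and eq: "\<And>t :: nat. (\<integral>\<^sup>+x. ennreal (exp (- real t * x)) \<partial>N1) = (\<integral>\<^sup>+x. ennreal (exp (- real t * x)) \<partial>N2)"
    and fin: "emeasure N2 UNIV < \<infinity>"
  shows "emeasure N1 {..b} = emeasure N2 {..b}"
proof (rule measure_atMost_eq_of_laplace)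
  have space: "space N1 = UNIV" "space N2 = UNIV"
    using sets by (auto dest: sets_eq_imp_space_eq)
  show "finite_measure N2" using fin space by (intro finite_measureI) auto
  \<comment> \<open>The transform at \<open>t = 0\<close> is the total mass.\<close>
  have "emeasure N1 UNIV = emeasure N2 UNIV" using eq[of 0] space by simp
  then show "finite_measure N1" using fin space by (intro finite_measureI) auto
  show "(\<integral>x. exp (- real t * x) \<partial>N1) = (\<integral>x. exp (- real t * x) \<partial>N2)" for t :: nat
    by (subst (1 2) integral_eq_nn_integral) (auto simp: eq[simplified])
qed fact+

lemma atMost_triple: "{..(a, b, y)} = {..a :: real} \<times> {..b :: real} \<times> {..y :: real}"
  by (auto simp: less_eq_prod_def)

text \<open>Tailored to the idle maximum, whose distribution function is computed at positive
  levels. Boxes with \<open>y = 0\<close> are decreasing limits of boxes with positive level and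
  those with \<open>y < 0\<close> are null, so all lower orthants are covered, and these generate
  the Borel sets.\<close>

lemma measure_eqI_boxes:
  fixes N1 N2 :: "(real \<times> real \<times> real) measure"
  assumes "finite_measure N2"
    and sets [measurable_cong, simp]: "sets N1 = sets borel" "sets N2 = sets borel"
    and box: "\<And>a b y. 0 < y \<Longrightarrow> emeasure N1 ({..a} \<times> {..b} \<times> {..y}) = emeasure N2 ({..a} \<times> {..b} \<times> {..y})"
    and neg: "emeasure N1 (UNIV \<times> UNIV \<times> {..<0}) = 0" "emeasure N2 (UNIV \<times> UNIV \<times> {..<0}) = 0"
  shows "N1 = N2"
proof -
  interpret N2: finite_measure N2 by fact
  have fin: "emeasure N1 ({..a} \<times> {..b} \<times> {..y}) \<noteq> \<infinity>" if "0 < y" for a b y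
    unfolding box[OF that] by simp
  have cl: "closed ({..a} \<times> {..b} \<times> {..y :: real})" for a b :: real and y
    by (intro closed_Times closed_atMost)
  have box_sets [measurable, simp]: "{..a} \<times> {..b} \<times> {..y :: real} \<in> sets borel" for a b :: real and y
    using cl by (rule borel_closed)
  have box0: "emeasure N1 ({..a} \<times> {..b} \<times> {..y}) = emeasure N2 ({..a} \<times> {..b} \<times> {..y})" for a b y
  proof (cases y "0 :: real" rule: linorder_cases)
    case less
    have op: "open (UNIV \<times> UNIV \<times> {..<0::real} :: (real \<times> real \<times> real) set)"
      by (intro open_Times) auto
    have "emeasure N ({..a} \<times> {..b} \<times> {..y}) = 0"
      if "emeasure N (UNIV \<times> UNIV \<times> {..<0}) = 0" "sets N = sets borel" for N :: "(real \<times> real \<times> real) measure"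
      by (rule emeasure_eq_0[OF _ that(1)]) (use that(2) op less in auto)
    then show ?thesis using neg by simp
  next
    case equal
    let ?B = "\<lambda>k. {..a} \<times> {..b} \<times> {..1 / real (Suc k)}"
    have B: "{..a} \<times> {..b} \<times> {..y} = (\<Inter>k. ?B k)"
    proof (intro equalityI subsetI)
      fix z assume z: "z \<in> (\<Inter>k. ?B k)"
      have "snd (snd z) \<le> 0"
      proof (rule ccontr)
        assume "\<not> snd (snd z) \<le> 0"
        then obtain k where "1 / real (Suc k) < snd (snd z)"
          using nat_approx_posE[of "snd (snd z)"] by auto
        moreover have "z \<in> ?B k" using z by blast
        ultimately show False by auto
      qed
      moreover have "z \<in> ?B 0" using z by blast
      ultimately show "z \<in> {..a} \<times> {..b} \<times> {..y}" using equal by auto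
    qed (use equal in \<open>auto intro: order_trans\<close>)
    have dec: "decseq ?B"
      by (auto simp: decseq_def intro: order_trans[OF _ divide_left_mono])
    have "(INF k. emeasure N (?B k)) = emeasure N (\<Inter>k. ?B k)"
      if "\<And>k. emeasure N (?B k) \<noteq> \<infinity>" "sets N = sets borel" for N
      by (rule INF_emeasure_decseq[OF _ dec]) (use that in auto)
    then have "emeasure N1 (\<Inter>k. ?B k) = (INF k. emeasure N1 (?B k))"
      "emeasure N2 (\<Inter>k. ?B k) = (INF k. emeasure N2 (?B k))"
      using sets fin by simp_all
    moreover have "emeasure N1 (?B k) = emeasure N2 (?B k)" for k
      by (rule box) simp
    ultimately show ?thesis unfolding B by (simp only:)
  qed (rule box)
  show ?thesis
  proof (rule measure_eqI_generator_eq[where \<Omega> = UNIV and E = "range atMost" and A = "\<lambda>n. {..(real n, real n, real n)}"])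
    show "Int_stable (range atMost :: (real \<times> real \<times> real) set set)"
    proof (rule Int_stableI)
      fix A B :: "(real \<times> real \<times> real) set" assume "A \<in> range atMost" "B \<in> range atMost"
      then obtain a b where "A = {..a}" "B = {..b}" by auto
      then have "A \<inter> B = {..inf a b}" by auto
      then show "A \<inter> B \<in> range atMost" by blast
    qed
    show "emeasure N1 A = emeasure N2 A" if "A \<in> range atMost" for A
      using that by (auto simp: atMost_triple box0)
    show "sets N1 = sigma_sets UNIV (range atMost)" "sets N2 = sigma_sets UNIV (range atMost)"
      by (simp_all add: borel_eq_atMost)
    show "(\<Union>n. {..(real n, real n, real n)}) = UNIV"
    proof (intro equalityI subsetI UNIV_I)
      fix z :: "real \<times> real \<times> real"
      obtain a b c where z: "z = (a, b, c)" by (cases z) auto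
      obtain n where "max a (max b c) < real n" using reals_Archimedean2 by blast
      then show "z \<in> (\<Union>n. {..(real n, real n, real n)})"
        by (auto simp: z atMost_triple intro!: exI[of _ n])
    qed
    show "emeasure N1 {..(real n, real n, real n)} \<noteq> \<infinity>" for n
      by (simp add: atMost_triple box0)
  qed auto
qed

section \<open>The hypergeometric integral\<close>

text \<open>The differential equation says that \<open>z powr a * (1 - z) powr (b - a) * F z / a\<close> is a primitive of
  the incomplete beta integrand \<open>z powr (a - 1) * (1 - z) powr (b - a - 1)\<close>.\<close>

lemma incomplete_beta_series:
  fixes a b :: real
  assumes b: "0 \<le> b" and ab: "b \<le> a" and a: "0 < a"
  defines "f \<equiv> \<lambda>n. pochhammer b n / pochhammer (a + 1) n"
  defines "F \<equiv> \<lambda>z. \<Sum>n. f n * z ^ n"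
  shows "\<And>z. \<bar>z\<bar> < 1 \<Longrightarrow> summable (\<lambda>n. f n * z ^ n)"
    and "\<And>z. \<bar>z\<bar> < 1 \<Longrightarrow> \<exists>F'. (F has_real_derivative F') (at z) \<and> (a - b * z) * F z + z * (1 - z) * F' = a"
    and "F 0 = 1"
proof -
  have pos: "0 < pochhammer (a + 1) n" for n
    using a by (intro pochhammer_pos) simp
  \<comment> \<open>Factor by factor \<open>b + k \<le> a + 1 + k\<close>, so the coefficients stay
    in \<open>[0, 1]\<close> and the series converges in the unit disc.\<close>
  have f_bound: "\<bar>f n\<bar> \<le> 1" for n
  proof -
    have "pochhammer b n \<le> pochhammer (a + 1) n"
      unfolding pochhammer_prod using b ab by (intro prod_mono) auto
    moreover have "0 \<le> pochhammer b n"
      unfolding pochhammer_prod using b by (intro prod_nonneg) auto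
    ultimately show ?thesis using pos[of n] by (simp add: f_def)
  qed
  \<comment> \<open>This recurrence is the differential equation read off coefficient by
    coefficient.\<close>
  have rec: "(a + 1 + real n) * f (Suc n) = (b + real n) * f n" for n
    using pos[of n] a by (simp add: f_def pochhammer_Suc divide_simps)
  show sm: "summable (\<lambda>n. f n * z ^ n)" if "\<bar>z\<bar> < 1" for z
  proof (rule summable_comparison_test)
    show "\<exists>N. \<forall>n\<ge>N. norm (f n * z ^ n) \<le> \<bar>z\<bar> ^ n"
      using f_bound by (auto simp: abs_mult power_abs intro!: exI[of _ 0] mult_left_le_one_le)
    show "summable (\<lambda>n. \<bar>z\<bar> ^ n)" using that by simp
  qed
  show "F 0 = 1" unfolding F_def powser_zero by (simp add: f_def)
  show "\<exists>F'. (F has_real_derivative F') (at z) \<and> (a - b * z) * F z + z * (1 - z) * F' = a"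
    if z: "\<bar>z\<bar> < 1" for z
  proof (intro exI conjI)
    let ?F' = "\<Sum>n. diffs f n * z ^ n"
    show "(F has_real_derivative ?F') (at z)"
      unfolding F_def using z sm by (intro termdiffs_strong'[of 1]) auto
    have F: "(\<lambda>n. f n * z ^ n) sums F z"
      unfolding F_def using sm[OF z] by (rule summable_sums)
    have "(\<lambda>n. z * (real n * f n * z ^ (n - Suc 0))) sums (z * ?F')"
      using z sm by (intro sums_mult diffs_equiv termdiff_converges[of _ 1]) auto
    moreover have "z * (real n * f n * z ^ (n - Suc 0)) = real n * f n * z ^ n" for n
      by (cases n) auto
    ultimately have G: "(\<lambda>n. real n * f n * z ^ n) sums (z * ?F')" by simp
    have "(\<lambda>n. a * (f n * z ^ n) + real n * f n * z ^ n) sums (a * F z + z * ?F')"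
      by (intro sums_add sums_mult F G)
    then have "(\<lambda>n. (a + real n) * f n * z ^ n) sums (a * F z + z * ?F')"
      by (simp add: algebra_simps)
    \<comment> \<open>Splitting off the term \<open>n = 0\<close>, which is \<open>a\<close> because
      \<open>f 0 = 1\<close>, brings the series into the shifted form that \<open>rec\<close>
      rewrites.\<close>
    then have 1: "(\<lambda>n. (a + 1 + real n) * f (Suc n) * z ^ Suc n) sums (a * F z + z * ?F' - a)"
      using sums_Suc_iff[of "\<lambda>n. (a + real n) * f n * z ^ n" "a * F z + z * ?F' - a"]
      by (simp add: f_def add_ac)
    have "(\<lambda>n. z * (b * (f n * z ^ n) + real n * f n * z ^ n)) sums (z * (b * F z + z * ?F'))"
      by (intro sums_mult sums_add F G)
    moreover have "z * (b * (f n * z ^ n) + real n * f n * z ^ n) = (a + 1 + real n) * f (Suc n) * z ^ Suc n" for n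
      unfolding rec by (simp add: algebra_simps)
    ultimately have "(\<lambda>n. (a + 1 + real n) * f (Suc n) * z ^ Suc n) sums (z * (b * F z + z * ?F'))"
      by simp
    with 1 have "a * F z + z * ?F' - a = z * (b * F z + z * ?F')" by (rule sums_unique2)
    then show "(a - b * z) * F z + z * (1 - z) * ?F' = a" by (simp add: algebra_simps)
  qed
qed

text \<open>The factor \<open>1 / (1 - t * z)\<close> in Euler's integral is expanded as a geometric
  series and integrated termwise; each term is a Beta integral, whose quotient of Gamma values is a
  quotient of Pochhammer symbols. The strict bound \<open>0 < b\<close> makes the Euler integrand
  integrable at 0.\<close>

lemma hyp2F1_series:
  assumes b: "0 < b" and ab: "b < a" and z: "0 < z" "z < 1"
  shows "hyp2F1 1 b (a + 1) z = (\<Sum>n. pochhammer b n / pochhammer (a + 1) n * z ^ n)"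
proof -
  define d where "d = a - b"
  have d: "0 < d" using ab by (simp add: d_def)
  let ?e = "\<lambda>n t. indicator {0..1} t *\<^sub>R (t powr (b + real n - 1) * (1 - t) powr (d + 1 - 1))"
  have beta: "(\<integral>t. ?e n t \<partial>lborel) = Beta (b + real n) (d + 1)" and int: "integrable lborel (?e n)" for n
  proof -
    have si: "set_integrable lborel {0..1} (\<lambda>t. t powr (b + real n - 1) * (1 - t) powr (d + 1 - 1))"
      using b d by (intro integrable_Beta) auto
    then show "integrable lborel (?e n)" by (simp add: set_integrable_def)
    have "(LINT t:{0..1}|lborel. t powr (b + real n - 1) * (1 - t) powr (d + 1 - 1)) =
        integral {0..1} (\<lambda>t. t powr (b + real n - 1) * (1 - t) powr (d + 1 - 1))"
      using si by (rule set_borel_integral_eq_integral)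
    also have "\<dots> = Beta (b + real n) (d + 1)"
      using has_integral_Beta_real[of "b + real n" "d + 1"] b d by (intro integral_unique) auto
    finally show "(\<integral>t. ?e n t \<partial>lborel) = Beta (b + real n) (d + 1)"
      by (simp add: set_lebesgue_integral_def)
  qed
  have e_nonneg: "0 \<le> ?e n t" for n t by (auto simp: indicator_def)
  have ze: "norm (z ^ n * ?e n t) = z ^ n * ?e n t" for n t
    using mult_nonneg_nonneg[OF zero_le_power[OF less_imp_le[OF z(1)]] e_nonneg]
    by (simp only: real_norm_def abs_of_nonneg)
  have Beta_poch: "Beta (b + real n) (d + 1) = Gamma b * Gamma (d + 1) / Gamma (a + 1) * (pochhammer b n / pochhammer (a + 1) n)" for n
  proof -
    have "pochhammer b n = Gamma (b + real n) / Gamma b"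
      using b by (intro pochhammer_Gamma) (auto dest: nonpos_Ints_nonpos)
    moreover have "pochhammer (a + 1) n = Gamma (a + 1 + real n) / Gamma (a + 1)"
      using b ab by (intro pochhammer_Gamma) (auto dest!: nonpos_Ints_nonpos)
    moreover have "0 < Gamma b" "0 < Gamma (a + 1)"
      using b ab by (auto intro!: Gamma_real_pos)
    ultimately show ?thesis by (simp add: Beta_def d_def algebra_simps)
  qed
  have sm: "summable (\<lambda>n. pochhammer b n / pochhammer (a + 1) n * z ^ n)"
    using b ab z by (intro incomplete_beta_series(1)) auto
  have "(\<lambda>n. \<integral>t. z ^ n * ?e n t \<partial>lborel) sums (\<integral>t. (\<Sum>n. z ^ n * ?e n t) \<partial>lborel)"
  proof (rule sums_integral)
    show "integrable lborel (\<lambda>t. z ^ n * ?e n t)" for n using int by simp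
    show "AE t in lborel. summable (\<lambda>n. norm (z ^ n * ?e n t))"
    proof (rule AE_I2)
      fix t :: real
      show "summable (\<lambda>n. norm (z ^ n * ?e n t))"
      proof (rule summable_comparison_test)
        show "summable (\<lambda>n. z ^ n * ?e 0 t)" using z by (intro summable_mult2) auto
        \<comment> \<open>Further powers of \<open>t \<in> [0, 1]\<close> only shrink the integrand,
          so a geometric series in \<open>z\<close> dominates.\<close>
        have "?e n t \<le> ?e 0 t" for n
          by (auto simp: indicator_def intro!: mult_right_mono powr_mono')
        then show "\<exists>N. \<forall>n\<ge>N. norm (norm (z ^ n * ?e n t)) \<le> z ^ n * ?e 0 t"
          unfolding ze using z by (intro exI[of _ 0] allI impI mult_left_mono) simp_all
      qed
    qed
    have "(\<integral>t. norm (z ^ n * ?e n t) \<partial>lborel) = Gamma b * Gamma (d + 1) / Gamma (a + 1) * (pochhammer b n / pochhammer (a + 1) n * z ^ n)" for n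
    proof -
      have "(\<integral>t. norm (z ^ n * ?e n t) \<partial>lborel) = (\<integral>t. z ^ n * ?e n t \<partial>lborel)"
        by (simp only: ze)
      then show ?thesis using beta[of n] by (simp add: Beta_poch)
    qed
    then show "summable (\<lambda>n. \<integral>t. norm (z ^ n * ?e n t) \<partial>lborel)"
      using sm by (simp only: summable_mult)
  qed
  moreover have "(\<integral>t. (\<Sum>n. z ^ n * ?e n t) \<partial>lborel) =
      (LBINT t:{0..1}. t powr (b - 1) * (1 - t) powr (a + 1 - b - 1) / (1 - t * z) powr 1)"
    unfolding set_lebesgue_integral_def
  proof (rule Bochner_Integration.integral_cong)
    fix t :: real
    show "(\<Sum>n. z ^ n * ?e n t) = indicator {0..1} t *\<^sub>R (t powr (b - 1) * (1 - t) powr (a + 1 - b - 1) / (1 - t * z) powr 1)"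
    proof (cases "0 < t \<and> t \<le> 1")
      case True
      have "t * z \<le> z" using True z by (intro mult_left_le_one_le) auto
      then have tz: "t * z < 1" using z(2) by linarith
      have tz0: "0 \<le> t * z" using True z by simp
      have "z ^ n * ?e n t = (t powr (b - 1) * (1 - t) powr d) * (t * z) ^ n" for n
        using True by (simp add: powr_add powr_diff powr_realpow power_mult_distrib)
      then have "(\<Sum>n. z ^ n * ?e n t) = (t powr (b - 1) * (1 - t) powr d) * (\<Sum>n. (t * z) ^ n)"
        using tz tz0 by (simp only:, intro suminf_mult) auto
      also have "(\<Sum>n. (t * z) ^ n) = 1 / (1 - t * z)" using tz tz0 by (intro suminf_geometric) auto
      finally show ?thesis using True tz tz0 by (simp add: d_def)
    next
      case False
      then show ?thesis by (auto simp: indicator_def)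
    qed
  qed simp
  ultimately have "(\<lambda>n. Gamma b * Gamma (d + 1) / Gamma (a + 1) * (pochhammer b n / pochhammer (a + 1) n * z ^ n)) sums
      (LBINT t:{0..1}. t powr (b - 1) * (1 - t) powr (a + 1 - b - 1) / (1 - t * z) powr 1)"
  proof -
    have *: "(\<integral>t. z ^ n * ?e n t \<partial>lborel) =
        Gamma b * Gamma (d + 1) / Gamma (a + 1) * (pochhammer b n / pochhammer (a + 1) n * z ^ n)" for n
      by (subst Bochner_Integration.integral_mult_right_zero, subst beta, subst Beta_poch) simp
    show ?thesis if "(\<lambda>n. \<integral>t. z ^ n * ?e n t \<partial>lborel) sums l" "l = (LBINT t:{0..1}. t powr (b - 1) * (1 - t) powr (a + 1 - b - 1) / (1 - t * z) powr 1)" for l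
      using that by (simp only: *)
  qed
  moreover have "(\<lambda>n. Gamma b * Gamma (d + 1) / Gamma (a + 1) * (pochhammer b n / pochhammer (a + 1) n * z ^ n)) sums
      (Gamma b * Gamma (d + 1) / Gamma (a + 1) * (\<Sum>n. pochhammer b n / pochhammer (a + 1) n * z ^ n))"
    using sm by (intro sums_mult summable_sums)
  ultimately have "(LBINT t:{0..1}. t powr (b - 1) * (1 - t) powr (a + 1 - b - 1) / (1 - t * z) powr 1) =
      Gamma b * Gamma (d + 1) / Gamma (a + 1) * (\<Sum>n. pochhammer b n / pochhammer (a + 1) n * z ^ n)"
    by (rule sums_unique2)
  moreover have "0 < Gamma b" "0 < Gamma (a + 1)" "0 < Gamma (d + 1)"
    using b ab d by (auto intro!: Gamma_real_pos)
  moreover have d_eq: "a + 1 - b = d + 1" by (simp add: d_def)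
  ultimately show ?thesis unfolding hyp2F1_def d_eq by simp
qed

text \<open>The substitution \<open>z = 1 / (1 + u)\<close> turns the integral into an incomplete
  beta integral over \<open>(0, 1 / (1 + \<beta>)]\<close>, with primitive \<open>H\<close>. The
  integral is taken by the fundamental theorem directly in \<open>u\<close>.\<close>

lemma nn_integral_shifted_power:
  fixes a b \<beta> :: real
  assumes b: "0 \<le> b" and ab: "b < a" and \<beta>: "0 < \<beta>"
  defines "\<delta> \<equiv> a - b"
  shows "(\<integral>\<^sup>+u. ennreal (u powr (- \<delta> - 1) * (1 + u) powr - b) * indicator {\<beta>..} u \<partial>lborel) =
    ennreal (\<beta> powr - \<delta> * (1 + \<beta>) powr - b / a *
      (\<Sum>n. pochhammer b n / pochhammer (a + 1) n * (1 / (1 + \<beta>)) ^ n))"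
proof -
  define F where "F z = (\<Sum>n. pochhammer b n / pochhammer (a + 1) n * z ^ n)" for z
  define H where "H z = z powr a * (1 - z) powr - \<delta> * F z / a" for z
  have a: "0 < a" and \<delta>: "0 < \<delta>" using b ab by (auto simp: \<delta>_def)
  note series = incomplete_beta_series[OF b less_imp_le[OF ab] a, folded F_def]
  have H_eq: "H (1 / (1 + u)) = u powr - \<delta> * (1 + u) powr - b / a * F (1 / (1 + u))" if "0 < u" for u
  proof -
    have "1 - 1 / (1 + u) = u / (1 + u)" using that by (simp add: field_simps)
    moreover have "(1 + u) powr - b = (1 + u) powr - a * (1 + u) powr \<delta>"
      using that by (simp add: \<delta>_def flip: powr_add)
    ultimately show ?thesis
      using that by (simp add: H_def powr_divide powr_minus_divide)
  qed
  have dH: "(H has_real_derivative z powr (a - 1) * (1 - z) powr (- \<delta> - 1)) (at z)" if z: "0 < z" "z < 1" for z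
  proof -
    from z obtain F' where F': "(F has_real_derivative F') (at z)" "(a - b * z) * F z + z * (1 - z) * F' = a"
      using series(2)[of z] by auto
    have "((\<lambda>z. z powr a * (1 - z) powr - \<delta> * F z) has_real_derivative
        (a * z powr (a - 1)) * (1 - z) powr - \<delta> * F z + z powr a * (\<delta> * (1 - z) powr (- \<delta> - 1)) * F z
          + z powr a * (1 - z) powr - \<delta> * F') (at z)"
      using z by (auto intro!: derivative_eq_intros F'(1) simp: algebra_simps)
    then have "(H has_real_derivative
        ((a * z powr (a - 1)) * (1 - z) powr - \<delta> * F z + z powr a * (\<delta> * (1 - z) powr (- \<delta> - 1)) * F z
          + z powr a * (1 - z) powr - \<delta> * F') / a) (at z)"
      unfolding H_def by (rule DERIV_cdivide)
    also have "((a * z powr (a - 1)) * (1 - z) powr - \<delta> * F z + z powr a * (\<delta> * (1 - z) powr (- \<delta> - 1)) * F z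
          + z powr a * (1 - z) powr - \<delta> * F') / a =
        z powr (a - 1) * (1 - z) powr (- \<delta> - 1) * ((a * (1 - z) + \<delta> * z) * F z + z * (1 - z) * F') / a"
    proof -
      have "z powr a = z powr (a - 1) * z" "(1 - z) powr - \<delta> = (1 - z) powr (- \<delta> - 1) * (1 - z)"
        using z by (simp_all add: powr_diff)
      then show ?thesis by (simp only:) (simp add: algebra_simps)
    qed
    \<comment> \<open>With this the bracket becomes the left side of the differential equation for
      \<open>F\<close>, so it equals \<open>a\<close> and cancels the division by \<open>a\<close>
      in \<open>H\<close>.\<close>
    also have "a * (1 - z) + \<delta> * z = a - b * z" by (simp add: \<delta>_def algebra_simps)
    finally show ?thesis using a by (simp add: F'(2))
  qed
  have "(\<integral>\<^sup>+u. ennreal (u powr (- \<delta> - 1) * (1 + u) powr - b) * indicator {\<beta>..} u \<partial>lborel) =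
      ennreal (0 - (- H (1 / (1 + \<beta>))))"
  proof (rule nn_integral_FTC_atLeast)
    fix u assume "\<beta> \<le> u"
    then have u: "0 < u" using \<beta> by simp
    have w: "0 < 1 / (1 + u)" "1 / (1 + u) < 1" using u by auto
    have "((\<lambda>u. - H (1 / (1 + u))) has_real_derivative
        - (((1 / (1 + u)) powr (a - 1) * (1 - 1 / (1 + u)) powr (- \<delta> - 1)) * (- (1 / (1 + u)\<^sup>2)))) (at u)"
      using u by (intro DERIV_minus DERIV_chain2[where f = H and g = "\<lambda>u. 1 / (1 + u)", OF dH[OF w]])
         (auto intro!: derivative_eq_intros simp: power2_eq_square)
    also have "- (((1 / (1 + u)) powr (a - 1) * (1 - 1 / (1 + u)) powr (- \<delta> - 1)) * (- (1 / (1 + u)\<^sup>2))) =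
        u powr (- \<delta> - 1) * (1 + u) powr - b"
    proof -
      have "1 - 1 / (1 + u) = u / (1 + u)" using u by (simp add: field_simps)
      moreover have "(1 + u) powr - b = (1 + u) powr (1 - a) * (1 + u) powr (\<delta> + 1) * (1 + u) powr - 2"
        by (simp add: \<delta>_def flip: powr_add)
      moreover have "(1 + u) powr - 2 = 1 / (1 + u)\<^sup>2" using u by (simp add: powr_minus_divide)
      moreover have "(1 / (1 + u)) powr (a - 1) = (1 + u) powr (1 - a)"
        using u powr_minus_divide[of "1 + u" "a - 1"] by (simp add: powr_divide)
      moreover have "(u / (1 + u)) powr (- \<delta> - 1) = u powr (- \<delta> - 1) * (1 + u) powr (\<delta> + 1)"
      proof -
        have "(1 + u) powr (- \<delta> - 1) * (1 + u) powr (\<delta> + 1) = 1"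
          using u by (simp flip: powr_add)
        then show ?thesis using u by (simp add: powr_divide divide_eq_eq ac_simps)
      qed
      ultimately show ?thesis by simp
    qed
    finally show "((\<lambda>u. - H (1 / (1 + u))) has_real_derivative u powr (- \<delta> - 1) * (1 + u) powr - b) (at u)" .
  next
    have "isCont F 0"
      using series(2)[of 0] DERIV_isCont by auto
    then have F0: "(F \<longlongrightarrow> 1) (at_right 0)"
      using series(3) by (auto simp: isCont_def intro: tendsto_mono[OF at_le])
    have nonneg: "\<forall>\<^sub>F x in at_right (0 :: real). 0 \<le> x"
      using eventually_at_right_less[of 0] by eventually_elim simp
    \<comment> \<open>The factor \<open>z powr a\<close> with \<open>a > 0\<close> makes the
      boundary term at \<open>u = \<infinity>\<close> vanish.\<close>
    have "(H \<longlongrightarrow> 0 * (1 - 0) powr - \<delta> * 1 / a) (at_right 0)"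
      unfolding H_def using a F0
      by (intro tendsto_intros tendsto_zero_powrI[where b = a] nonneg) (auto intro: tendsto_intros)
    then have "(H \<longlongrightarrow> 0) (at_right 0)" by simp
    moreover have "filterlim (\<lambda>u::real. 1 / (1 + u)) (at_right 0) at_top"
      by real_asymp
    ultimately have "((\<lambda>u. H (1 / (1 + u))) \<longlongrightarrow> 0) at_top"
      by (rule filterlim_compose)
    then show "((\<lambda>u. - H (1 / (1 + u))) \<longlongrightarrow> 0) at_top"
      using tendsto_minus by fastforce
  qed auto
  then show ?thesis using H_eq[OF \<beta>] by (simp add: F_def)
qed

section \<open>Stable Laplace transforms\<close>

text \<open>Euler's integral rescaled by \<open>x\<close>. Read backwards, it writes a negative
  power of \<open>x\<close> as a mixture of exponentials, into which a Laplace transform can be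
  inserted.\<close>

lemma nn_integral_Gamma_scaled:
  assumes r: "0 < r" and x: "0 < x"
  shows "(\<integral>\<^sup>+t. ennreal (t powr (r - 1) * exp (- t * x)) * indicator {0<..} t \<partial>lborel) =
    ennreal (Gamma r * x powr - r)"
proof -
  let ?I = "\<integral>\<^sup>+t. ennreal (t powr (r - 1) * exp (- t * x)) * indicator {0<..} t \<partial>lborel"
  have "ennreal (Gamma r) = (\<integral>\<^sup>+t. ennreal (indicator {0..} t * t powr (r - 1) / exp t) \<partial>lborel)"
    using r by (simp add: Gamma_conv_nn_integral_real)
  also have "\<dots> = ennreal \<bar>x\<bar> * (\<integral>\<^sup>+t. ennreal (indicator {0..} (0 + x * t) * (0 + x * t) powr (r - 1) / exp (0 + x * t)) \<partial>lborel)"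
    using x by (intro nn_integral_real_affine) auto
  also have "(\<integral>\<^sup>+t. ennreal (indicator {0..} (0 + x * t) * (0 + x * t) powr (r - 1) / exp (0 + x * t)) \<partial>lborel) =
      (\<integral>\<^sup>+t. ennreal (x powr (r - 1)) * (ennreal (t powr (r - 1) * exp (- t * x)) * indicator {0<..} t) \<partial>lborel)"
  proof (rule nn_integral_cong)
    fix t :: real
    show "ennreal (indicator {0..} (0 + x * t) * (0 + x * t) powr (r - 1) / exp (0 + x * t)) =
        ennreal (x powr (r - 1)) * (ennreal (t powr (r - 1) * exp (- t * x)) * indicator {0<..} t)"
    proof (cases "0 < t")
      case True
      then show ?thesis
        using x by (simp add: powr_mult exp_minus divide_inverse mult.commute[of t x] mult.assoc flip: ennreal_mult')
    next
      case False
      then have "t = 0 \<or> x * t < 0" using x by (metis linorder_neqE_linordered_idom mult_pos_neg)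
      then show ?thesis using False by auto
    qed
  qed
  also have "\<dots> = ennreal (x powr (r - 1)) * ?I"
    by (rule nn_integral_cmult) measurable
  finally have "ennreal (Gamma r) = ennreal (x powr r) * ?I"
    using x by (simp add: mult.assoc[symmetric] powr_diff flip: ennreal_mult')
  then have "ennreal (x powr - r) * ennreal (Gamma r) = ennreal (x powr - r * x powr r) * ?I"
    by (simp add: mult.assoc ennreal_mult')
  also have "x powr - r * x powr r = 1" using x by (simp flip: powr_add)
  finally have "?I = ennreal (x powr - r) * ennreal (Gamma r)" by simp
  also have "\<dots> = ennreal (x powr - r * Gamma r)" by (rule ennreal_mult'[symmetric]) simp
  finally show ?thesis by (simp only: mult.commute)
qed

lemma ennreal_inverse_cancel: "0 < c \<Longrightarrow> ennreal (inverse c) * (ennreal c * z) = z"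
  by (simp add: mult.assoc[symmetric] flip: ennreal_mult')

text \<open>\<open>N1\<close> is the law of \<open>(u / \<eta>) powr (1 / \<delta>)\<close> for an
  exponential \<open>u\<close>, and \<open>N2\<close> is the Weibull density. Both have tail
  \<open>exp (- \<eta> * y powr \<delta>)\<close>. Integrating \<open>t powr (\<delta> * n)\<close>
  gives the \<open>n\<close>-th moment of the exponential law on one side and the wanted integral on
  the other, so equality of tails replaces a change of variables.\<close>

lemma nn_integral_stretched_exponential:
  assumes \<delta>: "0 < \<delta>" and \<eta>: "0 < \<eta>"
  shows "(\<integral>\<^sup>+t. ennreal (t powr (\<delta> * real (Suc n) - 1) * exp (- \<eta> * t powr \<delta>)) * indicator {0<..} t \<partial>lborel) =
    ennreal (fact n / (\<delta> * \<eta> ^ Suc n))"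
proof -
  let ?ex = "expo"
  interpret ex: prob_space ?ex by (rule prob_space_exponential_density) simp
  define N1 where "N1 = distr ?ex borel (\<lambda>u. if 0 \<le> u then (u / \<eta>) powr (1 / \<delta>) else 0)"
  define N2 where "N2 = density lborel (\<lambda>t. ennreal (\<eta> * \<delta> * t powr (\<delta> - 1) * exp (- \<eta> * t powr \<delta>)) * indicator {0<..} t)"
  define f where "f t = ennreal (t powr (\<delta> * real n)) * indicator {0<..} t" for t :: real
  have f_meas [measurable]: "f \<in> borel_measurable borel" unfolding f_def by measurable
  have AE_ex: "AE u in ?ex. 0 < u"
  proof -
    have "AE u in lborel. u \<noteq> (0::real)" by (rule AE_lborel_singleton)
    then show ?thesis by (subst AE_density) (auto simp: exponential_density_def elim!: eventually_mono)
  qed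
  have tail1: "emeasure N1 {y<..} = ennreal (exp (- \<eta> * y powr \<delta>))" if y: "0 < y" for y
  proof -
    have "emeasure N1 {y<..} = emeasure ?ex {u. \<eta> * y powr \<delta> < u}"
    proof -
      have "y < (u / \<eta>) powr (1 / \<delta>) \<longleftrightarrow> \<eta> * y powr \<delta> < u" if "0 \<le> u" for u
      proof -
        have "y < (u / \<eta>) powr (1 / \<delta>) \<longleftrightarrow> y powr \<delta> < ((u / \<eta>) powr (1 / \<delta>)) powr \<delta>"
        proof
          show "y powr \<delta> < ((u / \<eta>) powr (1 / \<delta>)) powr \<delta>" if "y < (u / \<eta>) powr (1 / \<delta>)"
            using that y \<delta> by (intro powr_less_mono2) auto
          show "y < (u / \<eta>) powr (1 / \<delta>)" if "y powr \<delta> < ((u / \<eta>) powr (1 / \<delta>)) powr \<delta>"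
          proof (rule ccontr)
            assume "\<not> y < (u / \<eta>) powr (1 / \<delta>)"
            then have "((u / \<eta>) powr (1 / \<delta>)) powr \<delta> \<le> y powr \<delta>"
              using \<delta> by (intro powr_mono2) auto
            with that show False by simp
          qed
        qed
        also have "((u / \<eta>) powr (1 / \<delta>)) powr \<delta> = u / \<eta>"
          using that \<eta> \<delta> by (simp add: powr_powr)
        finally show ?thesis using \<eta> by (simp add: field_simps)
      qed
      moreover have "0 \<le> \<eta> * y powr \<delta>" using \<eta> by simp
      ultimately have "(\<lambda>u. if 0 \<le> u then (u / \<eta>) powr (1 / \<delta>) else 0) -` {y<..} = {u. \<eta> * y powr \<delta> < u}"
        using y by (auto split: if_splits)
      then show ?thesis by (simp add: N1_def emeasure_distr)
    qed
    also have "\<dots> = ennreal (exp (- \<eta> * y powr \<delta>))"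
      using ex.exponential_distributedD_gt[of "\<lambda>x. x" 1 "\<eta> * y powr \<delta>"] \<eta>
      by (simp add: distributed_def ex.emeasure_eq_measure distr_id2)
    finally show ?thesis .
  qed
  have tail2: "emeasure N2 {y<..} = ennreal (exp (- \<eta> * y powr \<delta>))" if y: "0 < y" for y
  proof -
    have "emeasure N2 {y<..} = (\<integral>\<^sup>+t. ennreal (\<eta> * \<delta> * t powr (\<delta> - 1) * exp (- \<eta> * t powr \<delta>)) * indicator {y..} t \<partial>lborel)"
      unfolding N2_def
    proof (subst emeasure_density, simp, simp, rule nn_integral_cong_AE)
      have "AE t in lborel. t \<noteq> y" by (rule AE_lborel_singleton)
      then show "AE t in lborel. ennreal (\<eta> * \<delta> * t powr (\<delta> - 1) * exp (- \<eta> * t powr \<delta>)) * indicator {0<..} t * indicator {y<..} t =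
          ennreal (\<eta> * \<delta> * t powr (\<delta> - 1) * exp (- \<eta> * t powr \<delta>)) * indicator {y..} t"
        by eventually_elim (use y in \<open>auto simp: indicator_def\<close>)
    qed
    also have "\<dots> = ennreal (0 - (- exp (- \<eta> * y powr \<delta>)))"
    proof (rule nn_integral_FTC_atLeast)
      fix t assume "y \<le> t"
      then have t: "0 < t" using y by simp
      show "((\<lambda>t. - exp (- \<eta> * t powr \<delta>)) has_real_derivative \<eta> * \<delta> * t powr (\<delta> - 1) * exp (- \<eta> * t powr \<delta>)) (at t)"
        using t by (auto intro!: derivative_eq_intros)
      show "0 \<le> \<eta> * \<delta> * t powr (\<delta> - 1) * exp (- \<eta> * t powr \<delta>)" using \<eta> \<delta> by simp
    next
      show "((\<lambda>t. - exp (- \<eta> * t powr \<delta>)) \<longlongrightarrow> 0) at_top"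
        using \<eta> \<delta> by real_asymp
    qed simp
    finally show ?thesis by simp
  qed
  have "(\<integral>\<^sup>+t. f t \<partial>N1) = (\<integral>\<^sup>+t. f t \<partial>N2)"
    by (rule nn_integral_eq_of_tails) (auto simp: tail1 tail2, auto simp: N1_def N2_def f_def)
  moreover have "(\<integral>\<^sup>+t. f t \<partial>N1) = ennreal (fact n / \<eta> ^ n)"
  proof -
    have "(\<integral>\<^sup>+t. f t \<partial>N1) = (\<integral>\<^sup>+u. ennreal (inverse \<eta> ^ n) * (ennreal (u ^ n)) \<partial>?ex)"
      unfolding N1_def
    proof (subst nn_integral_distr, simp, simp, rule nn_integral_cong_AE, use AE_ex in eventually_elim)
      case (elim u)
      have "((u / \<eta>) powr (1 / \<delta>)) powr (\<delta> * real n) = (u / \<eta>) ^ n"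
        using elim \<eta> \<delta> by (simp add: powr_powr powr_realpow)
      then show ?case
        using elim \<eta> by (simp add: f_def power_divide power_mult_distrib divide_inverse power_inverse mult.commute flip: ennreal_mult')
    qed
    also have "\<dots> = ennreal (inverse \<eta> ^ n) * (\<integral>\<^sup>+u. ennreal (u ^ n) \<partial>?ex)"
      by (rule nn_integral_cmult) simp
    also have "(\<integral>\<^sup>+u. ennreal (u ^ n) \<partial>?ex) = ennreal (fact n)"
    proof -
      have "(\<integral>\<^sup>+u. ennreal (u ^ n) \<partial>?ex) = (\<integral>\<^sup>+t. ennreal (t powr (real (Suc n) - 1) * exp (- t * 1)) * indicator {0<..} t \<partial>lborel)"
      proof (subst nn_integral_density, simp, simp, rule nn_integral_cong_AE)
        have "AE u in lborel. u \<noteq> (0::real)" by (rule AE_lborel_singleton)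
        then show "AE u in lborel. ennreal (exponential_density 1 u) * ennreal (u ^ n) =
            ennreal (u powr (real (Suc n) - 1) * exp (- u * 1)) * indicator {0<..} u"
          by eventually_elim (auto simp: exponential_density_def powr_realpow mult.commute indicator_def simp flip: ennreal_mult')
      qed
      also have "\<dots> = ennreal (Gamma (real (Suc n)))"
        by (subst nn_integral_Gamma_scaled) auto
      also have "Gamma (real (Suc n)) = fact n" using Gamma_fact[of n, where 'a = real] by (simp add: add.commute)
      finally show ?thesis .
    qed
    finally show ?thesis
      using \<eta> by (simp add: divide_inverse power_inverse mult.commute flip: ennreal_mult')
  qed
  moreover have "(\<integral>\<^sup>+t. f t \<partial>N2) = ennreal (\<eta> * \<delta>) * 
      (\<integral>\<^sup>+t. ennreal (t powr (\<delta> * real (Suc n) - 1) * exp (- \<eta> * t powr \<delta>)) * indicator {0<..} t \<partial>lborel)"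
    (is "_ = _ * ?J")
  proof -
    have "(\<integral>\<^sup>+t. f t \<partial>N2) = (\<integral>\<^sup>+t. ennreal (\<eta> * \<delta>) *
        (ennreal (t powr (\<delta> * real (Suc n) - 1) * exp (- \<eta> * t powr \<delta>)) * indicator {0<..} t) \<partial>lborel)"
      unfolding N2_def
    proof (subst nn_integral_density, simp, simp, rule nn_integral_cong)
      fix t :: real
      have *: "t powr (\<delta> * real (Suc n) - 1) = t powr (\<delta> - 1) * t powr (\<delta> * real n)"
        by (simp add: algebra_simps flip: powr_add)
      show "ennreal (\<eta> * \<delta> * t powr (\<delta> - 1) * exp (- \<eta> * t powr \<delta>)) * indicator {0<..} t * f t =
          ennreal (\<eta> * \<delta>) * (ennreal (t powr (\<delta> * real (Suc n) - 1) * exp (- \<eta> * t powr \<delta>)) * indicator {0<..} t)"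
        unfolding * using \<eta> \<delta>
        by (cases "0 < t") (simp_all add: f_def ac_simps flip: ennreal_mult')
    qed
    also have "\<dots> = ennreal (\<eta> * \<delta>) * ?J" by (rule nn_integral_cmult) measurable
    finally show ?thesis .
  qed
  ultimately have "ennreal (\<eta> * \<delta>) * ?J = ennreal (fact n / \<eta> ^ n)" by simp
  then have "ennreal (inverse (\<eta> * \<delta>)) * (ennreal (\<eta> * \<delta>) * ?J) = ennreal (inverse (\<eta> * \<delta>)) * ennreal (fact n / \<eta> ^ n)"
    by simp
  moreover have "ennreal (inverse (\<eta> * \<delta>)) * (ennreal (\<eta> * \<delta>) * ?J) = ?J"
    using \<eta> \<delta> by (intro ennreal_inverse_cancel) simp
  ultimately show ?thesis
    using \<eta> \<delta> by (simp add: divide_inverse ac_simps flip: ennreal_mult')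
qed

text \<open>Write \<open>1 - exp (- (t * s))\<close> as the integral of
  \<open>t * exp (- r * t)\<close> over \<open>r\<close> between 0 and \<open>s\<close> and
  exchange: the inner integral is the tail \<open>r powr - \<delta>\<close>, and a Gamma integral
  with parameter \<open>1 - \<delta> > 0\<close> remains.\<close>

lemma nn_integral_one_minus_exp:
  assumes \<delta>: "0 < \<delta>" "\<delta> < 1" and t: "0 \<le> t"
  shows "(\<integral>\<^sup>+s. ennreal (1 - exp (- (t * s))) \<partial>power_intensity \<delta>) = ennreal (Gamma (1 - \<delta>) * t powr \<delta>)"
proof (cases "t = 0")
  case False
  with t have t: "0 < t" by simp
  interpret L: sigma_finite_measure "power_intensity \<delta>" by (rule sigma_finite_power_intensity)
  interpret pair_sigma_finite "power_intensity \<delta>" lborel ..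
  let ?g = "\<lambda>s r. ennreal (t * exp (- r * t)) * (indicator {0<..} r * (if r < s then 1 else 0))"
  have "(\<integral>\<^sup>+s. ennreal (1 - exp (- (t * s))) \<partial>power_intensity \<delta>) =
      (\<integral>\<^sup>+s. (\<integral>\<^sup>+r. ?g s r \<partial>lborel) \<partial>power_intensity \<delta>)"
  proof (rule nn_integral_cong_AE, use AE_power_intensity_pos[of \<delta>] in eventually_elim)
    case (elim s)
    have "(\<integral>\<^sup>+r. ?g s r \<partial>lborel) = (\<integral>\<^sup>+r. ennreal (t * exp (- r * t)) * indicator {0..s} r \<partial>lborel)"
    proof (rule nn_integral_cong_AE)
      have "AE r in lborel. r \<noteq> 0" "AE r in lborel. r \<noteq> s" by (rule AE_lborel_singleton)+
      then show "AE r in lborel. ?g s r = ennreal (t * exp (- r * t)) * indicator {0..s} r"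
        by eventually_elim (auto simp: indicator_def)
    qed
    also have "\<dots> = ennreal (- exp (- s * t) - (- exp (- 0 * t)))"
      using t elim by (intro nn_integral_FTC_Icc) (auto intro!: derivative_eq_intros)
    finally show ?case by (simp add: mult.commute)
  qed
  also have "\<dots> = (\<integral>\<^sup>+r. (\<integral>\<^sup>+s. ?g s r \<partial>power_intensity \<delta>) \<partial>lborel)"
    by (rule Fubini'[symmetric]) measurable
  also have "\<dots> = (\<integral>\<^sup>+r. ennreal t * (ennreal (r powr (1 - \<delta> - 1) * exp (- r * t)) * indicator {0<..} r) \<partial>lborel)"
  proof (rule nn_integral_cong)
    fix r :: real
    have "(\<integral>\<^sup>+s. ?g s r \<partial>power_intensity \<delta>) = ennreal (t * exp (- r * t)) * (indicator {0<..} r * emeasure (power_intensity \<delta>) {r<..})"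
    proof -
      have "(\<lambda>s. if r < s then 1 else (0 :: ennreal)) = indicator {r<..}" by (auto simp: fun_eq_iff indicator_def)
      then have "(\<integral>\<^sup>+s. (if r < s then 1 else 0) \<partial>power_intensity \<delta>) = emeasure (power_intensity \<delta>) {r<..}"
        by simp
      then show ?thesis by (simp add: nn_integral_cmult mult.assoc[symmetric])
    qed
    then show "(\<integral>\<^sup>+s. ?g s r \<partial>power_intensity \<delta>) =
        ennreal t * (ennreal (r powr (1 - \<delta> - 1) * exp (- r * t)) * indicator {0<..} r)"
      using emeasure_power_intensity(1)[OF \<delta>(1), of r] t
      by (cases "0 < r") (simp_all add: ac_simps flip: ennreal_mult')
  qed
  also have "\<dots> = ennreal t * ennreal (Gamma (1 - \<delta>) * t powr - (1 - \<delta>))"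
    using t \<delta> by (subst nn_integral_cmult, measurable, subst nn_integral_Gamma_scaled) auto
  also have "\<dots> = ennreal (Gamma (1 - \<delta>) * t powr \<delta>)"
    using t by (simp add: powr_diff powr_minus_divide ac_simps flip: ennreal_mult')
  finally show ?thesis .
qed (use \<delta> in simp)

text \<open>Multiplying by \<open>Gamma r\<close> with \<open>r = \<delta> * m\<close> turns
  \<open>x powr - r\<close> into a mixture of exponentials. Fubini inserts the Laplace transform and
  leaves a stretched exponential integral. The case \<open>m = 0\<close> is separate because Euler's
  integral needs \<open>r > 0\<close>.\<close>

lemma negative_moment_of_stable_laplace:
  assumes "prob_space N" and [measurable_cong]: "sets N = sets borel" and \<delta>: "0 < \<delta>" and \<eta>: "0 < \<eta>"
    and pos: "AE x in N. 0 < x"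
    and laplace: "\<And>t. 0 < t \<Longrightarrow> (\<integral>x. exp (- (t * x)) \<partial>N) = exp (- \<eta> * t powr \<delta>)"
  shows "(\<integral>\<^sup>+x. ennreal (x powr - (\<delta> * real m)) \<partial>N) = ennreal (fact m / (Gamma (1 + \<delta> * real m) * \<eta> ^ m))"
proof (cases m)
  case 0
  interpret prob_space N by fact
  have "(\<integral>\<^sup>+x. ennreal (x powr - (\<delta> * real m)) \<partial>N) = (\<integral>\<^sup>+x. 1 \<partial>N)"
    using pos 0 by (intro nn_integral_cong_AE) (auto elim!: eventually_mono)
  then show ?thesis using 0 by (simp add: emeasure_space_1)
next
  case (Suc n)
  interpret prob_space N by fact
  interpret pair_sigma_finite N lborel ..
  define r where "r = \<delta> * real m"
  have r: "0 < r" using \<delta> Suc by (simp add: r_def)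
  have Gr: "0 < Gamma r" using r by (rule Gamma_real_pos)
  let ?J = "\<integral>\<^sup>+x. ennreal (x powr - r) \<partial>N"
  have "ennreal (Gamma r) * ?J = (\<integral>\<^sup>+x. ennreal (Gamma r) * ennreal (x powr - r) \<partial>N)"
    by (rule nn_integral_cmult[symmetric]) measurable
  also have "\<dots> = (\<integral>\<^sup>+x. (\<integral>\<^sup>+t. ennreal (t powr (r - 1) * exp (- t * x)) * indicator {0<..} t \<partial>lborel) \<partial>N)"
  proof (rule nn_integral_cong_AE, use pos in eventually_elim)
    case (elim x)
    show ?case
      unfolding nn_integral_Gamma_scaled[OF r elim] using Gr by (intro ennreal_mult'[symmetric]) simp
  qed
  also have "\<dots> = (\<integral>\<^sup>+t. (\<integral>\<^sup>+x. ennreal (t powr (r - 1) * exp (- t * x)) * indicator {0<..} t \<partial>N) \<partial>lborel)"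
    by (rule Fubini'[symmetric]) measurable
  also have "\<dots> = (\<integral>\<^sup>+t. ennreal (t powr (\<delta> * real (Suc n) - 1) * exp (- \<eta> * t powr \<delta>)) * indicator {0<..} t \<partial>lborel)"
  proof (rule nn_integral_cong)
    fix t :: real
    show "(\<integral>\<^sup>+x. ennreal (t powr (r - 1) * exp (- t * x)) * indicator {0<..} t \<partial>N) =
        ennreal (t powr (\<delta> * real (Suc n) - 1) * exp (- \<eta> * t powr \<delta>)) * indicator {0<..} t"
    proof (cases "0 < t")
      case True
      have "(\<integral>\<^sup>+x. ennreal (exp (- (t * x))) \<partial>N) = ennreal (\<integral>x. exp (- (t * x)) \<partial>N)"
        using pos True by (intro nn_integral_eq_integral integrable_const_bound[of _ 1])
          (auto elim!: eventually_mono)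
      then have "(\<integral>\<^sup>+x. ennreal (t powr (r - 1)) * ennreal (exp (- (t * x))) \<partial>N) =
          ennreal (t powr (r - 1)) * ennreal (exp (- \<eta> * t powr \<delta>))"
        by (subst nn_integral_cmult) (simp_all add: laplace[OF True])
      then show ?thesis using True by (simp add: r_def Suc flip: ennreal_mult')
    qed simp
  qed
  also have "\<dots> = ennreal (fact n / (\<delta> * \<eta> ^ Suc n))"
    by (rule nn_integral_stretched_exponential) fact+
  finally have "ennreal (Gamma r) * ?J = ennreal (fact n / (\<delta> * \<eta> ^ m))" by (simp add: Suc)
  then have "ennreal (inverse (Gamma r)) * (ennreal (Gamma r) * ?J) =
      ennreal (inverse (Gamma r)) * ennreal (fact n / (\<delta> * \<eta> ^ m))" by simp
  moreover have "ennreal (inverse (Gamma r)) * (ennreal (Gamma r) * ?J) = ?J"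
    using Gr by (rule ennreal_inverse_cancel)
  moreover have "ennreal (inverse (Gamma r)) * ennreal (fact n / (\<delta> * \<eta> ^ m)) =
      ennreal (fact m / (Gamma (1 + r) * \<eta> ^ m))"
  proof -
    \<comment> \<open>With \<open>r = \<delta> * m\<close> this absorbs the denominator
      \<open>\<delta>\<close> and completes \<open>fact n\<close> to \<open>fact m\<close>.\<close>
    have "Gamma (1 + r) = r * Gamma r"
      using r nonpos_Ints_nonpos[of r] Gamma_plus1[of r] by (auto simp: add.commute)
    moreover have "fact m = real m * fact n" by (simp add: Suc)
    moreover have "0 < real m" by (simp add: Suc)
    ultimately have "inverse (Gamma r) * (fact n / (\<delta> * \<eta> ^ m)) = fact m / (Gamma (1 + r) * \<eta> ^ m)"
      using Gr \<open>0 < real m\<close> \<delta> \<eta> by (simp add: r_def divide_inverse)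
    then show ?thesis using Gr by (simp flip: ennreal_mult')
  qed
  ultimately show ?thesis by (simp add: r_def)
qed

section \<open>The joint law of the active and idle powers\<close>

locale coverage_network = multi_tier_network M K dens p X act h
  for M :: "'w measure" and K dens p X act h +
  fixes \<alpha> :: real and P \<beta> :: "nat \<Rightarrow> real"
  assumes \<alpha>: "2 < \<alpha>"
    and dens_pos: "\<And>i. i \<in> {1..K} \<Longrightarrow> 0 < dens i"
    and P_pos: "\<And>i. i \<in> {1..K} \<Longrightarrow> 0 < P i"
    and p01: "\<And>i. i \<in> {1..K} \<Longrightarrow> 0 \<le> p i \<and> p i \<le> 1"
    and p_nonzero: "\<exists>i\<in>{1..K}. p i \<noteq> 0"
    and \<beta>_gt_1: "\<And>i. i \<in> {1..K} \<Longrightarrow> 1 < \<beta> i"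
begin

definition \<delta> :: real where "\<delta> = 2 / \<alpha>"

definition rx_power :: "nat \<Rightarrow> nat \<Rightarrow> 'w \<Rightarrow> real" where
  "rx_power i n \<omega> = P i * h i n \<omega> * norm (X i n \<omega>) powr - \<alpha>"

text \<open>Density of the active or idle part times the constant of
  \<open>nn_integral_received_power\<close>: the received powers of that part have intensity measure
  \<open>intensity i b\<close> times \<open>power_intensity \<delta>\<close>.\<close>

definition intensity :: "nat \<Rightarrow> bool \<Rightarrow> real" where
  "intensity i b = (if b then p i else 1 - p i) * dens i * (pi * P i powr \<delta> * Gamma (1 + \<delta>))"

definition interference :: "'w \<Rightarrow> ennreal" where
  "interference \<omega> = (\<Sum>i=1..K. \<Sum>n. if act i n \<omega> then ennreal (rx_power i n \<omega>) else 0)"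

text \<open>Dividing by the threshold of the tier reduces the idle conditions of all tiers to one
  comparison with the total active power.\<close>

definition scaled_idle_max :: "'w \<Rightarrow> ennreal" where
  "scaled_idle_max \<omega> = (SUP i\<in>{1..K}. SUP n. if act i n \<omega> then 0 else ennreal (rx_power i n \<omega> / \<beta> i))"

text \<open>For \<open>c > 0\<close> the window \<open>{c<..a}\<close> carries finite intensity,
  whereas weak stations accumulate at power 0.\<close>

definition active_count :: "nat \<Rightarrow> real \<Rightarrow> real \<Rightarrow> 'w \<Rightarrow> ennreal" where
  "active_count j c a \<omega> = (\<Sum>n. if act j n \<omega> then indicator {c<..a} (rx_power j n \<omega>) else 0)"

text \<open>This is \<open>eta_const\<close>, and \<open>idle_rate\<close> is
  \<open>A_const\<close>, each in the form in which the Laplace functional produces it.\<close>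

definition stable_rate :: real where
  "stable_rate = (\<Sum>i=1..K. intensity i True) * Gamma (1 - \<delta>)"

definition idle_rate :: real where
  "idle_rate = (\<Sum>i=1..K. intensity i False * \<beta> i powr - \<delta>)"

lemma \<delta>: "0 < \<delta>" "\<delta> < 1"
  using \<alpha> by (auto simp: \<delta>_def field_simps)

lemma intensity_nonneg: "i \<in> {1..K} \<Longrightarrow> 0 \<le> intensity i b"
  using p01[of i] dens_pos[of i] \<delta> Gamma_real_pos[of "1 + \<delta>"]
  by (auto simp: intensity_def intro!: mult_nonneg_nonneg)

lemma stable_rate_pos: "0 < stable_rate"
proof -
  obtain i where i: "i \<in> {1..K}" "p i \<noteq> 0" using p_nonzero by auto
  have "0 < intensity i True"
    using i p01[of i] dens_pos[of i] P_pos[of i] \<delta> Gamma_real_pos[of "1 + \<delta>"]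
    by (auto simp: intensity_def intro!: mult_pos_pos)
  also have "\<dots> \<le> (\<Sum>i=1..K. intensity i True)"
    using i intensity_nonneg by (intro member_le_sum) auto
  finally show ?thesis
    using \<delta> Gamma_real_pos[of "1 - \<delta>"] by (simp add: stable_rate_def)
qed

lemma idle_rate_nonneg: "0 \<le> idle_rate"
  unfolding idle_rate_def by (intro sum_nonneg mult_nonneg_nonneg intensity_nonneg) auto

lemma rx_power_measurable [measurable]: "i \<in> {1..K} \<Longrightarrow> rx_power i n \<in> borel_measurable M"
proof -
  assume i: "i \<in> {1..K}"
  note [measurable] = location_measurable[OF i] fading_measurable[OF i]
  show ?thesis unfolding rx_power_def by measurable
qed

lemma act_pred [measurable]: "i \<in> {1..K} \<Longrightarrow> Measurable.pred M (act i n)"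
  using active_measurable by simp

lemma interference_measurable [measurable]: "interference \<in> borel_measurable M"
proof -
  have "(\<lambda>\<omega>. \<Sum>n. if act i n \<omega> then ennreal (rx_power i n \<omega>) else 0) \<in> borel_measurable M" if i: "i \<in> {1..K}" for i
  proof -
    note [measurable] = rx_power_measurable[OF i] act_pred[OF i]
    show ?thesis by measurable
  qed
  then show ?thesis unfolding interference_def by measurable
qed

lemma scaled_idle_max_measurable [measurable]: "scaled_idle_max \<in> borel_measurable M"
proof -
  have "(\<lambda>\<omega>. SUP n. if act i n \<omega> then 0 else ennreal (rx_power i n \<omega> / \<beta> i)) \<in> borel_measurable M" if i: "i \<in> {1..K}" for i
  proof -
    note [measurable] = rx_power_measurable[OF i] act_pred[OF i]
    show ?thesis by measurable
  qed
  then show ?thesis unfolding scaled_idle_max_def by measurable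
qed

lemma active_count_measurable [measurable]:
  assumes "j \<in> {1..K}"
  shows "active_count j c a \<in> borel_measurable M"
proof -
  note [measurable] = rx_power_measurable[OF assms] act_pred[OF assms]
  show ?thesis unfolding active_count_def by measurable
qed

text \<open>The marked functional is pushed forward to the half-line of received powers. Weights
  vanish at nonpositive powers because the intensity lives on positive ones.\<close>

lemma power_laplace:
  assumes w [measurable]: "\<And>i b. i \<in> {1..K} \<Longrightarrow> w i b \<in> borel_measurable borel"
    and w0: "\<And>i b s. s \<le> 0 \<Longrightarrow> w i b s = 0"
  shows "expectation (\<lambda>\<omega>. eexp (\<Sum>i=1..K. \<Sum>n. w i (act i n \<omega>) (rx_power i n \<omega>))) =
    eexp (\<Sum>i=1..K. \<Sum>b\<in>UNIV. ennreal (intensity i b) * (\<integral>\<^sup>+s. ennreal (1 - eexp (w i b s)) \<partial>power_intensity \<delta>))"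
proof -
  have "expectation (\<lambda>\<omega>. eexp (\<Sum>i=1..K. \<Sum>n. w i (act i n \<omega>) (rx_power i n \<omega>))) =
    expectation (\<lambda>\<omega>. eexp (\<Sum>i=1..K. \<Sum>n. (\<lambda>z. w i (act i n \<omega>) (P i * snd z * norm (fst z) powr - \<alpha>)) (X i n \<omega>, h i n \<omega>)))"
    by (simp add: rx_power_def)
  also have "\<dots> = eexp (\<Sum>i=1..K. \<Sum>b\<in>UNIV. ennreal ((if b then p i else 1 - p i) * dens i) *
      (\<integral>\<^sup>+x. (\<integral>\<^sup>+t. ennreal (1 - eexp (w i b (P i * t * norm (x :: real ^ 2) powr - \<alpha>))) \<partial>expo) \<partial>lborel))"
    using dens_pos p01 by (subst marked_laplace) (auto intro: less_imp_le)
  also have "\<dots> = eexp (\<Sum>i=1..K. \<Sum>b\<in>UNIV. ennreal (intensity i b) * (\<integral>\<^sup>+s. ennreal (1 - eexp (w i b s)) \<partial>power_intensity \<delta>))"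
  proof (intro arg_cong[where f = eexp] sum.cong refl)
    fix i b assume i: "i \<in> {1..K}"
    have "(\<integral>\<^sup>+x. (\<integral>\<^sup>+t. ennreal (1 - eexp (w i b (P i * t * norm (x :: real ^ 2) powr - \<alpha>))) \<partial>expo) \<partial>lborel) =
        ennreal (pi * P i powr \<delta> * Gamma (1 + \<delta>)) * (\<integral>\<^sup>+s. ennreal (1 - eexp (w i b s)) \<partial>power_intensity \<delta>)"
      unfolding \<delta>_def using \<alpha> P_pos[OF i] i by (intro nn_integral_received_power) (auto simp: w0)
    moreover have "0 \<le> (if b then p i else 1 - p i) * dens i"
      using p01[OF i] dens_pos[OF i] by auto
    then have "ennreal (intensity i b) = ennreal ((if b then p i else 1 - p i) * dens i) *
        ennreal (pi * P i powr \<delta> * Gamma (1 + \<delta>))"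
      unfolding intensity_def by (rule ennreal_mult')
    ultimately show "ennreal ((if b then p i else 1 - p i) * dens i) *
        (\<integral>\<^sup>+x. (\<integral>\<^sup>+t. ennreal (1 - eexp (w i b (P i * t * norm (x :: real ^ 2) powr - \<alpha>))) \<partial>expo) \<partial>lborel) =
        ennreal (intensity i b) * (\<integral>\<^sup>+s. ennreal (1 - eexp (w i b s)) \<partial>power_intensity \<delta>)"
      by (simp only: mult.assoc)
  qed
  finally show ?thesis .
qed

definition window_mass :: "real \<Rightarrow> real \<Rightarrow> real \<Rightarrow> ennreal" where
  "window_mass c a t = (\<integral>\<^sup>+s. ennreal (exp (- (t * s))) * indicator {c<..a} s \<partial>power_intensity \<delta>)"

lemma window_mass_finite:
  assumes "0 < c" "0 \<le> t"
  shows "window_mass c a t < \<top>"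
proof -
  have "window_mass c a t \<le> (\<integral>\<^sup>+s. indicator {c<..} s \<partial>power_intensity \<delta>)"
    unfolding window_mass_def using assms
    by (intro nn_integral_mono) (auto simp: indicator_def)
  also have "\<dots> = ennreal (c powr - \<delta>)"
    using emeasure_power_intensity(1)[OF \<delta>(1) assms(1)] by simp
  finally show ?thesis by (rule le_less_trans) simp
qed

lemma scaled_idle_max_le_iff:
  assumes y: "0 \<le> y"
  shows "scaled_idle_max \<omega> \<le> ennreal y \<longleftrightarrow> (\<forall>i\<in>{1..K}. \<forall>n. \<not> act i n \<omega> \<longrightarrow> rx_power i n \<omega> \<le> \<beta> i * y)"
proof -
  have "ennreal (rx_power i n \<omega> / \<beta> i) \<le> ennreal y \<longleftrightarrow> rx_power i n \<omega> \<le> \<beta> i * y" if "i \<in> {1..K}" for i n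
    using y \<beta>_gt_1[OF that] by (auto simp: ennreal_le_iff2 field_simps)
  then show ?thesis
    unfolding scaled_idle_max_def by (simp only: SUP_le_iff) auto
qed

text \<open>One weight serves all three quantities: linear in the power for the interference, a step
  of height \<open>\<theta>\<close> on the window for the count, and \<open>\<top>\<close> above the
  idle level. Active and idle parts contribute additively to the exponent, which is why the result
  factors.\<close>

lemma joint_laplace:
  assumes t: "0 \<le> t" and \<theta>: "0 \<le> \<theta>" and j: "j \<in> {1..K}" and c: "0 < c" and y: "0 < y"
  shows "expectation (\<lambda>\<omega>. eexp (ennreal t * interference \<omega> + ennreal \<theta> * active_count j c a \<omega>) *
      of_bool (scaled_idle_max \<omega> \<le> ennreal y)) =
    eexp (ennreal (stable_rate * t powr \<delta>) +
      ennreal (intensity j True) * (ennreal (1 - exp (- \<theta>)) * window_mass c a t) +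
      ennreal (idle_rate * y powr - \<delta>))"
proof -
  \<comment> \<open>The idle weight is \<open>\<top>\<close> beyond \<open>\<beta> i * y\<close>, so
    \<open>eexp\<close> of the idle sum is the indicator that no idle station exceeds its
    level.\<close>
  define w where "w i b s = (if b then ennreal t * ennreal s + ennreal \<theta> * (of_bool (i = j) * indicator {c<..a} s)
    else \<top> * indicator {\<beta> i * y<..} s)" for i b s
  have w0: "w i b s = 0" if "s \<le> 0" "i \<in> {1..K}" for i b s
  proof -
    have "0 < \<beta> i * y" using y \<beta>_gt_1[OF that(2)] by simp
    then show ?thesis using that c by (auto simp: w_def indicator_def ennreal_neg)
  qed
  \<comment> \<open>Extended by 0 outside \<open>{1..K}\<close>, where the sign of
    \<open>\<beta> i\<close> is unknown, so that the weight vanishes at nonpositive powers for every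
    index.\<close>
  define w' where "w' i b s = (if i \<in> {1..K} then w i b s else 0)" for i b s
  have w'_meas: "w' i b \<in> borel_measurable borel" if "i \<in> {1..K}" for i b
    using that unfolding w'_def w_def by (cases b) simp_all
  have w'0: "w' i b s = 0" if "s \<le> 0" for i b s
    using w0 that by (simp add: w'_def)
  have pointwise: "eexp (ennreal t * interference \<omega> + ennreal \<theta> * active_count j c a \<omega>) *
      of_bool (scaled_idle_max \<omega> \<le> ennreal y) = eexp (\<Sum>i=1..K. \<Sum>n. w' i (act i n \<omega>) (rx_power i n \<omega>))" for \<omega>
  proof -
    define Z where "Z = (\<Sum>i=1..K. \<Sum>n. if act i n \<omega> then 0 else \<top> * indicator {\<beta> i * y<..} (rx_power i n \<omega>) :: ennreal)"
    have "(\<Sum>i=1..K. \<Sum>n. w' i (act i n \<omega>) (rx_power i n \<omega>)) =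
      (\<Sum>i=1..K. \<Sum>n. (ennreal t * (if act i n \<omega> then ennreal (rx_power i n \<omega>) else 0) +
          ennreal \<theta> * (of_bool (i = j) * (if act i n \<omega> then indicator {c<..a} (rx_power i n \<omega>) else 0))) +
          (if act i n \<omega> then 0 else \<top> * indicator {\<beta> i * y<..} (rx_power i n \<omega>)))"
      by (intro sum.cong suminf_cong) (auto simp: w'_def w_def)
    also have "\<dots> = (\<Sum>i=1..K. (ennreal t * (\<Sum>n. if act i n \<omega> then ennreal (rx_power i n \<omega>) else 0) +
          ennreal \<theta> * (of_bool (i = j) * active_count i c a \<omega>)) +
          (\<Sum>n. if act i n \<omega> then 0 else \<top> * indicator {\<beta> i * y<..} (rx_power i n \<omega>)))"
      by (simp add: suminf_add[symmetric] active_count_def)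
    also have "\<dots> = ennreal t * interference \<omega> +
          ennreal \<theta> * (\<Sum>i=1..K. of_bool (i = j) * active_count i c a \<omega>) + Z"
      by (simp only: sum.distrib sum_distrib_left[symmetric] interference_def Z_def)
    also have "(\<Sum>i=1..K. of_bool (i = j) * active_count i c a \<omega>) = active_count j c a \<omega>"
      using j by (simp add: of_bool_def if_distrib[of "\<lambda>x. x * _"] cong: if_cong)
    finally have sum: "(\<Sum>i=1..K. \<Sum>n. w' i (act i n \<omega>) (rx_power i n \<omega>)) =
        ennreal t * interference \<omega> + ennreal \<theta> * active_count j c a \<omega> + Z" .
    have "eexp Z = of_bool (scaled_idle_max \<omega> \<le> ennreal y)"
    proof (cases "scaled_idle_max \<omega> \<le> ennreal y")
      case True
      then have "(if act i n \<omega> then 0 else \<top> * indicator {\<beta> i * y<..} (rx_power i n \<omega>) :: ennreal) = 0"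
        if "i \<in> {1..K}" for i n
      proof -
        have "\<not> act i n \<omega> \<longrightarrow> rx_power i n \<omega> \<le> \<beta> i * y"
          using that True y scaled_idle_max_le_iff[of y \<omega>] by simp
        then show ?thesis by (auto simp: indicator_def)
      qed
      then have "Z = (\<Sum>i=1..K. \<Sum>n. 0)"
        unfolding Z_def by (intro sum.cong suminf_cong) auto
      then show ?thesis using True by simp
    next
      case False
      then obtain i n where i: "i \<in> {1..K}" "\<not> act i n \<omega>" "\<beta> i * y < rx_power i n \<omega>"
        using y by (subst (asm) scaled_idle_max_le_iff) (auto simp: not_le)
      let ?f = "\<lambda>i n. if act i n \<omega> then 0 else \<top> * indicator {\<beta> i * y<..} (rx_power i n \<omega>) :: ennreal"
      have "\<top> = ?f i n" using i by simp
      also have "\<dots> \<le> (\<Sum>n. ?f i n)"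
        using sum_le_suminf[of "?f i" "{n}"] by simp
      also have "\<dots> \<le> Z"
        unfolding Z_def using i by (intro member_le_sum) auto
      finally show ?thesis using False by (simp add: top_unique)
    qed
    then show ?thesis unfolding sum by (simp add: eexp_add)
  qed
  have active: "(\<integral>\<^sup>+s. ennreal (1 - eexp (w' i True s)) \<partial>power_intensity \<delta>) =
      ennreal (Gamma (1 - \<delta>) * t powr \<delta>) + of_bool (i = j) * (ennreal (1 - exp (- \<theta>)) * window_mass c a t)"
    if i: "i \<in> {1..K}" for i
  proof -
    have "(\<integral>\<^sup>+s. ennreal (1 - eexp (w' i True s)) \<partial>power_intensity \<delta>) =
      (\<integral>\<^sup>+s. ennreal (1 - exp (- (t * s))) +
        of_bool (i = j) * (ennreal (1 - exp (- \<theta>)) * (ennreal (exp (- (t * s))) * indicator {c<..a} s)) \<partial>power_intensity \<delta>)"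
    proof (rule nn_integral_cong_AE, use AE_power_intensity_pos[of \<delta>] in eventually_elim)
      case (elim s)
      have ts: "exp (- (t * s)) \<le> 1" using t elim by simp
      have e\<theta>: "exp (- \<theta>) \<le> 1" using \<theta> by simp
      have et: "eexp (ennreal t * ennreal s) = exp (- (t * s))"
        using t elim by (simp add: eexp_ennreal flip: ennreal_mult)
      show ?case
      proof (cases "i = j \<and> c < s \<and> s \<le> a")
        case True
        then have "eexp (w' i True s) = exp (- (t * s)) * exp (- \<theta>)"
          using i \<theta> by (simp add: w'_def w_def eexp_add et eexp_ennreal)
        \<comment> \<open>This splitting separates the stable exponent from the window term, which
          becomes a multiple of \<open>1 - exp (- \<theta>)\<close>.\<close>
        moreover have "1 - exp (- (t * s)) * exp (- \<theta>) =
            (1 - exp (- (t * s))) + (1 - exp (- \<theta>)) * exp (- (t * s))"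
          by (simp add: algebra_simps)
        ultimately show ?thesis
          using True ts e\<theta> by (simp only:) (simp add: ennreal_plus ennreal_mult)
      next
        case False
        then have "eexp (w' i True s) = exp (- (t * s))"
          using i by (auto simp: w'_def w_def eexp_add et)
        then show ?thesis using False by auto
      qed
    qed
    also have "\<dots> = (\<integral>\<^sup>+s. ennreal (1 - exp (- (t * s))) \<partial>power_intensity \<delta>) +
        of_bool (i = j) * (ennreal (1 - exp (- \<theta>)) * window_mass c a t)"
      unfolding window_mass_def by (simp add: nn_integral_add nn_integral_cmult)
    finally show ?thesis by (simp add: nn_integral_one_minus_exp[OF \<delta> t])
  qed
  have idle: "(\<integral>\<^sup>+s. ennreal (1 - eexp (w' i False s)) \<partial>power_intensity \<delta>) = ennreal (\<beta> i powr - \<delta> * y powr - \<delta>)"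
    if i: "i \<in> {1..K}" for i
  proof -
    have "0 < \<beta> i * y" using y \<beta>_gt_1[OF i] by simp
    have "(\<integral>\<^sup>+s. ennreal (1 - eexp (w' i False s)) \<partial>power_intensity \<delta>) =
        (\<integral>\<^sup>+s. indicator {\<beta> i * y<..} s \<partial>power_intensity \<delta>)"
      using i by (intro nn_integral_cong) (auto simp: w'_def w_def indicator_def)
    also have "\<dots> = ennreal ((\<beta> i * y) powr - \<delta>)"
      using emeasure_power_intensity(1)[OF \<delta>(1) \<open>0 < \<beta> i * y\<close>] by simp
    finally show ?thesis using y \<beta>_gt_1[OF i] by (simp add: powr_mult)
  qed
  have "(\<Sum>i=1..K. \<Sum>b\<in>UNIV. ennreal (intensity i b) * (\<integral>\<^sup>+s. ennreal (1 - eexp (w' i b s)) \<partial>power_intensity \<delta>)) =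
      (\<Sum>i=1..K. ennreal (intensity i True * (Gamma (1 - \<delta>) * t powr \<delta>)) +
        of_bool (i = j) * (ennreal (intensity i True) * (ennreal (1 - exp (- \<theta>)) * window_mass c a t)) +
        ennreal (intensity i False * (\<beta> i powr - \<delta> * y powr - \<delta>)))"
  proof (rule sum.cong)
    fix i assume i: "i \<in> {1..K}"
    show "(\<Sum>b\<in>UNIV. ennreal (intensity i b) * (\<integral>\<^sup>+s. ennreal (1 - eexp (w' i b s)) \<partial>power_intensity \<delta>)) =
        ennreal (intensity i True * (Gamma (1 - \<delta>) * t powr \<delta>)) +
        of_bool (i = j) * (ennreal (intensity i True) * (ennreal (1 - exp (- \<theta>)) * window_mass c a t)) +
        ennreal (intensity i False * (\<beta> i powr - \<delta> * y powr - \<delta>))"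
      unfolding ennreal_mult'[OF intensity_nonneg[OF i]]
      using active[OF i] idle[OF i] by (cases "i = j") (simp_all add: UNIV_bool distrib_left add_ac)
  qed simp
  also have "\<dots> = (\<Sum>i=1..K. ennreal (intensity i True * (Gamma (1 - \<delta>) * t powr \<delta>))) +
      (\<Sum>i=1..K. of_bool (i = j) * (ennreal (intensity i True) * (ennreal (1 - exp (- \<theta>)) * window_mass c a t))) +
      (\<Sum>i=1..K. ennreal (intensity i False * (\<beta> i powr - \<delta> * y powr - \<delta>)))"
    by (simp only: sum.distrib)
  also have "(\<Sum>i=1..K. ennreal (intensity i True * (Gamma (1 - \<delta>) * t powr \<delta>))) = ennreal (stable_rate * t powr \<delta>)"
    using intensity_nonneg Gamma_real_pos[of "1 - \<delta>"] \<delta>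
    by (subst sum_ennreal) (auto simp: stable_rate_def sum_distrib_right mult.assoc)
  also have "(\<Sum>i=1..K. ennreal (intensity i False * (\<beta> i powr - \<delta> * y powr - \<delta>))) = ennreal (idle_rate * y powr - \<delta>)"
    using intensity_nonneg by (subst sum_ennreal) (auto simp: idle_rate_def sum_distrib_right mult.assoc)
  also have "(\<Sum>i=1..K. of_bool (i = j) * (ennreal (intensity i True) * (ennreal (1 - exp (- \<theta>)) * window_mass c a t))) =
      ennreal (intensity j True) * (ennreal (1 - exp (- \<theta>)) * window_mass c a t)"
    using j by (simp add: of_bool_def if_distrib[of "\<lambda>x. x * _"] cong: if_cong)
  finally have "(\<Sum>i=1..K. \<Sum>b\<in>UNIV. ennreal (intensity i b) * (\<integral>\<^sup>+s. ennreal (1 - eexp (w' i b s)) \<partial>power_intensity \<delta>)) =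
    ennreal (stable_rate * t powr \<delta>) +
      ennreal (intensity j True) * (ennreal (1 - exp (- \<theta>)) * window_mass c a t) +
      ennreal (idle_rate * y powr - \<delta>)" .
  then show ?thesis
    unfolding pointwise by (simp only: power_laplace[of w', OF w'_meas w'0])
qed

end

lemma tendsto_exp_powr_zero:
  fixes r d :: real
  assumes "0 < r" "0 < d"
  shows "(\<lambda>k. exp (- (r * real (Suc k) powr d))) \<longlonglongrightarrow> 0"
  using assms by real_asymp

lemma (in prob_space) expectation_of_bool:
  assumes [measurable]: "Measurable.pred M Q"
  shows "expectation (\<lambda>\<omega>. of_bool (Q \<omega>) :: real) = prob {\<omega> \<in> space M. Q \<omega>}"
proof -
  have "expectation (\<lambda>\<omega>. of_bool (Q \<omega>) :: real) = expectation (indicator {\<omega> \<in> space M. Q \<omega>})"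
    by (intro Bochner_Integration.integral_cong) (auto simp: indicator_def)
  then show ?thesis by simp
qed

section \<open>Interference and idle maximum as finite random variables, and the Palm formula in
  Laplace form\<close>

context coverage_network
begin

definition interference_real :: "'w \<Rightarrow> real" where
  "interference_real \<omega> = enn2real (interference \<omega>)"

definition scaled_idle_max_real :: "'w \<Rightarrow> real" where
  "scaled_idle_max_real \<omega> = enn2real (scaled_idle_max \<omega>)"

lemma interference_real_measurable [measurable]: "interference_real \<in> borel_measurable M"
  unfolding interference_real_def by measurable

lemma scaled_idle_max_real_measurable [measurable]: "scaled_idle_max_real \<in> borel_measurable M"
  unfolding scaled_idle_max_real_def by measurable

lemma interference_real_nonneg [simp]: "0 \<le> interference_real \<omega>"
  and scaled_idle_max_real_nonneg [simp]: "0 \<le> scaled_idle_max_real \<omega>"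
  by (simp_all add: interference_real_def scaled_idle_max_real_def)

lemma interference_idle_laplace:
  assumes t: "0 \<le> t" and y: "0 < y"
  shows "expectation (\<lambda>\<omega>. eexp (ennreal t * interference \<omega>) * of_bool (scaled_idle_max \<omega> \<le> ennreal y)) =
    exp (- (stable_rate * t powr \<delta>)) * exp (- (idle_rate * y powr - \<delta>))"
proof -
  obtain j where j: "j \<in> {1..K}" using p_nonzero by auto
  have "0 \<le> stable_rate * t powr \<delta>" "0 \<le> idle_rate * y powr - \<delta>"
    using stable_rate_pos idle_rate_nonneg by auto
  \<comment> \<open>At \<open>\<theta> = 0\<close> the count carries weight
    \<open>1 - exp 0 = 0\<close>, so its term leaves the exponent.\<close>
  then show ?thesis
    using joint_laplace[OF t order_refl j zero_less_one y, of 1] by (simp add: eexp_add eexp_ennreal)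
qed

lemma tendsto_scaled_powr:
  "(\<lambda>k. r * real (Suc k) powr - \<delta>) \<longlonglongrightarrow> 0"
proof -
  have "(\<lambda>k. real (Suc k) powr - \<delta>) \<longlonglongrightarrow> 0"
    using \<delta>(1) by real_asymp
  then show ?thesis by (rule tendsto_mult_right_zero)
qed

text \<open>The void probability of the idle region above level \<open>k + 1\<close> tends to
  1.\<close>

lemma AE_scaled_idle_max_finite: "AE \<omega> in M. scaled_idle_max \<omega> < \<top>"
proof -
  have lim: "(\<lambda>k. exp (- (idle_rate * real (Suc k) powr - \<delta>))) \<longlonglongrightarrow> exp (- 0)"
    by (intro tendsto_intros tendsto_scaled_powr)
  have "exp (- (idle_rate * real (Suc k) powr - \<delta>)) \<le> prob {\<omega> \<in> space M. scaled_idle_max \<omega> < \<top>}" for k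
  proof -
    have "expectation (\<lambda>\<omega>. of_bool (scaled_idle_max \<omega> \<le> ennreal (real (Suc k))) :: real) \<le>
        expectation (\<lambda>\<omega>. indicator {\<omega> \<in> space M. scaled_idle_max \<omega> < \<top>} \<omega>)"
      by (intro integral_mono integrable_const_bound[of _ 1]) (auto simp: indicator_def le_less_trans)
    then show ?thesis
      using interference_idle_laplace[of 0 "real (Suc k)"] \<delta> by simp
  qed
  then have "exp (- 0) \<le> prob {\<omega> \<in> space M. scaled_idle_max \<omega> < \<top>}"
    by (intro LIMSEQ_le_const2[OF lim]) auto
  then have "prob {\<omega> \<in> space M. scaled_idle_max \<omega> < \<top>} = 1"
    using prob_le_1 by (simp add: antisym)
  then show ?thesis by (subst (asm) prob_Collect_eq_1) auto
qed

lemma AE_scaled_idle_max_le_iff: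
  "AE \<omega> in M. \<forall>y\<ge>0. scaled_idle_max \<omega> \<le> ennreal y \<longleftrightarrow> scaled_idle_max_real \<omega> \<le> y"
  using AE_scaled_idle_max_finite
proof eventually_elim
  case (elim \<omega>)
  then obtain r where "scaled_idle_max \<omega> = ennreal r" "0 \<le> r" by (cases "scaled_idle_max \<omega>") auto
  then show ?case by (simp add: scaled_idle_max_real_def)
qed

text \<open>The idle constraint in the joint transform is removed by letting its level run through
  the integers; this uses that the idle maximum is almost surely finite.\<close>

lemma interference_laplace:
  assumes t: "0 \<le> t"
  shows "expectation (\<lambda>\<omega>. eexp (ennreal t * interference \<omega>)) = exp (- (stable_rate * t powr \<delta>))"
proof -
  have "(\<lambda>k. expectation (\<lambda>\<omega>. eexp (ennreal t * interference \<omega>) * of_bool (scaled_idle_max \<omega> \<le> ennreal (real (Suc k)))))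
      \<longlonglongrightarrow> expectation (\<lambda>\<omega>. eexp (ennreal t * interference \<omega>))"
  proof (rule integral_dominated_convergence[where w = "\<lambda>_. 1"])
    show "AE \<omega> in M. (\<lambda>k. eexp (ennreal t * interference \<omega>) * of_bool (scaled_idle_max \<omega> \<le> ennreal (real (Suc k))))
        \<longlonglongrightarrow> eexp (ennreal t * interference \<omega>)"
      using AE_scaled_idle_max_le_iff
    proof eventually_elim
      case (elim \<omega>)
      obtain n where "scaled_idle_max_real \<omega> < real n" using reals_Archimedean2 by blast
      then have "scaled_idle_max \<omega> \<le> ennreal (real (Suc k))" if "n \<le> k" for k
      proof -
        have "0 \<le> real (Suc k)" "scaled_idle_max_real \<omega> \<le> real (Suc k)"
          using \<open>scaled_idle_max_real \<omega> < real n\<close> that by auto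
        then show ?thesis using elim by blast
      qed
      then have "\<forall>\<^sub>F k in sequentially. eexp (ennreal t * interference \<omega>) *
          of_bool (scaled_idle_max \<omega> \<le> ennreal (real (Suc k))) = eexp (ennreal t * interference \<omega>)"
        by (auto simp: eventually_sequentially intro!: exI[of _ n] simp del: of_nat_Suc)
      then show ?case by (rule tendsto_eventually)
    qed
  qed (auto simp: abs_mult)
  moreover have "(\<lambda>k. expectation (\<lambda>\<omega>. eexp (ennreal t * interference \<omega>) * of_bool (scaled_idle_max \<omega> \<le> ennreal (real (Suc k)))))
      \<longlonglongrightarrow> exp (- (stable_rate * t powr \<delta>)) * exp (- 0)"
    unfolding interference_idle_laplace[OF t of_nat_0_less_iff[THEN iffD2, OF zero_less_Suc]]
    by (intro tendsto_intros tendsto_scaled_powr)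
  ultimately show ?thesis by (simp add: LIMSEQ_unique)
qed

text \<open>The Laplace transform tends to the probability of finiteness as \<open>t\<close>
  decreases to 0 and to the probability of the value 0 as \<open>t\<close> grows. Its explicit form,
  with positive rate, gives the limits 1 and 0.\<close>

lemma AE_interference: "AE \<omega> in M. 0 < interference \<omega> \<and> interference \<omega> < \<top>"
proof -
  have "(\<lambda>k. expectation (\<lambda>\<omega>. eexp (ennreal (1 / real (Suc k)) * interference \<omega>)))
      \<longlonglongrightarrow> expectation (\<lambda>\<omega>. of_bool (interference \<omega> < \<top>) :: real)"
  proof (rule integral_dominated_convergence[where w = "\<lambda>_. 1"])
    show "AE \<omega> in M. (\<lambda>k. eexp (ennreal (1 / real (Suc k)) * interference \<omega>)) \<longlonglongrightarrow> of_bool (interference \<omega> < \<top>)"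
    proof (rule AE_I2)
      fix \<omega>
      show "(\<lambda>k. eexp (ennreal (1 / real (Suc k)) * interference \<omega>)) \<longlonglongrightarrow> of_bool (interference \<omega> < \<top>)"
      proof (cases "interference \<omega>")
        case (real r)
        have "(\<lambda>k. exp (- (1 / real (Suc k) * r))) \<longlonglongrightarrow> 1" by real_asymp
        moreover have "eexp (ennreal (1 / real (Suc k)) * interference \<omega>) = exp (- (1 / real (Suc k) * r))" for k
          using real by (subst eexp_ennreal[symmetric]) (simp_all flip: ennreal_mult)
        ultimately show ?thesis using real by simp
      next
        case top
        then have "ennreal (1 / real (Suc k)) * interference \<omega> = \<top>" for k
          by (simp add: ennreal_mult_top)
        then show ?thesis using top by simp
      qed
    qed
  qed auto
  moreover have "(\<lambda>k. expectation (\<lambda>\<omega>. eexp (ennreal (1 / real (Suc k)) * interference \<omega>))) \<longlonglongrightarrow> 1"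
  proof -
    have "(\<lambda>k. exp (- (stable_rate * real (Suc k) powr - \<delta>))) \<longlonglongrightarrow> exp (- 0)"
      by (intro tendsto_intros tendsto_scaled_powr)
    then show ?thesis by (simp add: interference_laplace powr_divide powr_minus_divide)
  qed
  ultimately have 1: "expectation (\<lambda>\<omega>. of_bool (interference \<omega> < \<top>) :: real) = 1" by (rule LIMSEQ_unique)
  have "(\<lambda>k. expectation (\<lambda>\<omega>. eexp (ennreal (real (Suc k)) * interference \<omega>)))
      \<longlonglongrightarrow> expectation (\<lambda>\<omega>. of_bool (interference \<omega> = 0) :: real)"
  proof (rule integral_dominated_convergence[where w = "\<lambda>_. 1"])
    show "AE \<omega> in M. (\<lambda>k. eexp (ennreal (real (Suc k)) * interference \<omega>)) \<longlonglongrightarrow> of_bool (interference \<omega> = 0)"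
    proof (rule AE_I2)
      fix \<omega>
      show "(\<lambda>k. eexp (ennreal (real (Suc k)) * interference \<omega>)) \<longlonglongrightarrow> of_bool (interference \<omega> = 0)"
      proof (cases "interference \<omega>")
        case (real r)
        have eq: "eexp (ennreal (real (Suc k)) * interference \<omega>) = exp (- (real (Suc k) * r))" for k
          using real by (subst eexp_ennreal[symmetric]) (simp_all del: of_nat_Suc flip: ennreal_mult)
        show ?thesis
        proof (cases "r = 0")
          case False
          then have "0 < r" using real by simp
          then have "(\<lambda>k. exp (- (real (Suc k) * r))) \<longlonglongrightarrow> 0" by real_asymp
          then show ?thesis using real False unfolding eq by simp
        qed (use real in simp)
      next
        case top
        then have "ennreal (real (Suc k)) * interference \<omega> = \<top>" for k
          by (simp add: ennreal_mult_top del: of_nat_Suc)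
        then show ?thesis using top by simp
      qed
    qed
  qed auto
  moreover have "(\<lambda>k. expectation (\<lambda>\<omega>. eexp (ennreal (real (Suc k)) * interference \<omega>))) \<longlonglongrightarrow> 0"
  proof -
    have "(\<lambda>k. exp (- (stable_rate * real (Suc k) powr \<delta>))) \<longlonglongrightarrow> 0"
      by (rule tendsto_exp_powr_zero[OF stable_rate_pos \<delta>(1)])
    then show ?thesis by (simp add: interference_laplace del: of_nat_Suc)
  qed
  ultimately have 0: "expectation (\<lambda>\<omega>. of_bool (interference \<omega> = 0) :: real) = 0" by (rule LIMSEQ_unique)
  have "expectation (\<lambda>\<omega>. of_bool (interference \<omega> < \<top>) :: real) = prob {\<omega> \<in> space M. interference \<omega> < \<top>}"
    "expectation (\<lambda>\<omega>. of_bool (interference \<omega> = 0) :: real) = prob {\<omega> \<in> space M. interference \<omega> = 0}"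
    by (simp_all add: expectation_of_bool)
  with 0 1 have "prob {\<omega> \<in> space M. interference \<omega> < \<top>} = 1" "prob {\<omega> \<in> space M. interference \<omega> = 0} = 0"
    by simp_all
  then have "AE \<omega> in M. interference \<omega> < \<top>" "AE \<omega> in M. interference \<omega> \<noteq> 0"
    by (auto simp: prob_Collect_eq_1 prob_eq_0)
  then show ?thesis by eventually_elim (auto simp: zero_less_iff_neq_zero)
qed

lemma AE_interference_real: "AE \<omega> in M. 0 < interference_real \<omega> \<and> interference \<omega> = ennreal (interference_real \<omega>)"
  using AE_interference by eventually_elim (auto simp: interference_real_def enn2real_positive_iff)

lemma AE_eexp_interference:
  "AE \<omega> in M. \<forall>t\<ge>0. eexp (ennreal t * interference \<omega>) = exp (- (t * interference_real \<omega>))"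
  using AE_interference_real by eventually_elim (auto simp: eexp_ennreal simp flip: ennreal_mult)

lemma nn_joint_laplace:
  assumes t: "0 \<le> t" and y: "0 < y"
  shows "(\<integral>\<^sup>+\<omega>. ennreal (exp (- (t * interference_real \<omega>))) * indicator {..y} (scaled_idle_max_real \<omega>) \<partial>M) =
    ennreal (exp (- (stable_rate * t powr \<delta>)) * exp (- (idle_rate * y powr - \<delta>)))"
proof -
  have "(\<integral>\<^sup>+\<omega>. ennreal (exp (- (t * interference_real \<omega>))) * indicator {..y} (scaled_idle_max_real \<omega>) \<partial>M) =
      (\<integral>\<^sup>+\<omega>. ennreal (eexp (ennreal t * interference \<omega>) * of_bool (scaled_idle_max \<omega> \<le> ennreal y)) \<partial>M)"
  proof (rule nn_integral_cong_AE, use AE_eexp_interference AE_scaled_idle_max_le_iff in eventually_elim)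
    case (elim \<omega>)
    then show ?case using t y by (auto simp: indicator_def)
  qed
  also have "\<dots> = ennreal (expectation (\<lambda>\<omega>. eexp (ennreal t * interference \<omega>) * of_bool (scaled_idle_max \<omega> \<le> ennreal y)))"
    by (intro nn_integral_eq_integral integrable_const_bound[of _ 1]) (auto simp: abs_mult)
  finally show ?thesis by (simp add: interference_idle_laplace[OF t y])
qed

text \<open>This is the derivative of \<open>joint_laplace\<close> at \<open>\<theta> = 0\<close>, taken along \<open>\<theta> = 1 / (k + 1)\<close>; the
  bound \<open>1 - exp (- \<theta> n) \<le> \<theta> n\<close> and Fatou's lemma give the two inequalities without knowing in
  advance that the count is integrable.\<close>

lemma palm_laplace:
  assumes t: "0 \<le> t" and j: "j \<in> {1..K}" and c: "0 < c" and y: "0 < y"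
  shows "(\<integral>\<^sup>+\<omega>. ennreal (exp (- (t * interference_real \<omega>))) * indicator {..y} (scaled_idle_max_real \<omega>) *
      active_count j c a \<omega> \<partial>M) =
    ennreal (intensity j True) * window_mass c a t *
      ennreal (exp (- (stable_rate * t powr \<delta>)) * exp (- (idle_rate * y powr - \<delta>)))"
    (is "?L = _")
proof -
  define \<kappa> where "\<kappa> = intensity j True * enn2real (window_mass c a t)"
  have \<kappa>: "0 \<le> \<kappa>" "ennreal (intensity j True) * window_mass c a t = ennreal \<kappa>"
    using window_mass_finite[OF c t, of a] intensity_nonneg[OF j, of True]
    by (simp_all add: \<kappa>_def ennreal_mult')
  define z where "z \<omega> = eexp (ennreal t * interference \<omega>) * of_bool (scaled_idle_max \<omega> \<le> ennreal y)" for \<omega>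
  have z01: "0 \<le> z \<omega>" "z \<omega> \<le> 1" for \<omega> by (auto simp: z_def)
  have z_meas [measurable]: "z \<in> borel_measurable M" unfolding z_def by measurable
  note [measurable] = active_count_measurable[OF j]
  define G0 where "G0 = exp (- (stable_rate * t powr \<delta>)) * exp (- (idle_rate * y powr - \<delta>))"
  have Ez: "expectation z = G0"
    unfolding z_def G0_def by (rule interference_idle_laplace[OF t y])
  have pos: "0 \<le> stable_rate * t powr \<delta>" "0 \<le> idle_rate * y powr - \<delta>"
    using stable_rate_pos idle_rate_nonneg by auto
  have G: "expectation (\<lambda>\<omega>. z \<omega> * eexp (ennreal \<theta> * active_count j c a \<omega>)) = G0 * exp (- ((1 - exp (- \<theta>)) * \<kappa>))"
    if \<theta>: "0 \<le> \<theta>" for \<theta>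
  proof -
    have "expectation (\<lambda>\<omega>. z \<omega> * eexp (ennreal \<theta> * active_count j c a \<omega>)) =
        eexp (ennreal (stable_rate * t powr \<delta>) + ennreal ((1 - exp (- \<theta>)) * \<kappa>) + ennreal (idle_rate * y powr - \<delta>))"
    proof -
      have "ennreal (intensity j True) * (ennreal (1 - exp (- \<theta>)) * window_mass c a t) =
          ennreal (1 - exp (- \<theta>)) * (ennreal (intensity j True) * window_mass c a t)"
        by (rule mult.left_commute)
      also have "\<dots> = ennreal ((1 - exp (- \<theta>)) * \<kappa>)"
        unfolding \<kappa>(2) using \<theta> by (intro ennreal_mult'[symmetric]) simp
      finally show ?thesis
        using joint_laplace[OF t \<theta> j c y, of a] by (simp add: z_def eexp_add mult_ac)
    qed
    then show ?thesis
      using pos \<kappa> \<theta> by (simp add: eexp_add eexp_ennreal G0_def)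
  qed
  define \<theta> where "\<theta> k = 1 / real (Suc k)" for k
  have \<theta>: "0 < \<theta> k" for k by (simp add: \<theta>_def)
  define q where "q k \<omega> = ennreal ((1 - eexp (ennreal (\<theta> k) * active_count j c a \<omega>)) / \<theta> k)" for k \<omega>
  have q_meas [measurable]: "q k \<in> borel_measurable M" for k unfolding q_def by measurable
  have q_le: "q k \<omega> \<le> active_count j c a \<omega>" for k \<omega>
  proof (cases "active_count j c a \<omega>")
    case (real n)
    have "1 - exp (- (\<theta> k * n)) \<le> \<theta> k * n" using exp_ge_add_one_self[of "- (\<theta> k * n)"] by simp
    then have "(1 - exp (- (\<theta> k * n))) / \<theta> k \<le> n" using \<theta>[of k] by (simp add: divide_le_eq mult.commute)
    then show ?thesis
      using real \<theta>[of k] by (simp add: q_def eexp_ennreal ennreal_leI flip: ennreal_mult)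
  qed simp
  have q_lim: "(\<lambda>k. q k \<omega>) \<longlonglongrightarrow> active_count j c a \<omega>" for \<omega>
  proof (cases "active_count j c a \<omega>")
    case (real n)
    have "(\<lambda>k. (1 - exp (- (\<theta> k * n))) / \<theta> k) \<longlonglongrightarrow> n"
    proof (cases "n = 0")
      case False
      with real have "0 < n" by simp
      then show ?thesis unfolding \<theta>_def by real_asymp
    qed simp
    then have "(\<lambda>k. ennreal ((1 - exp (- (\<theta> k * n))) / \<theta> k)) \<longlonglongrightarrow> ennreal n" by (rule tendsto_ennrealI)
    moreover have "q k \<omega> = ennreal ((1 - exp (- (\<theta> k * n))) / \<theta> k)" for k
      using real \<theta>[of k] by (simp add: q_def eexp_ennreal flip: ennreal_mult)
    ultimately show ?thesis using real by simp
  next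
    case top
    \<comment> \<open>For an infinite count \<open>eexp\<close> is 0, so the quotient is
      \<open>1 / \<theta> k = k + 1\<close> and still tends to the count.\<close>
    have "q k \<omega> = of_nat (Suc k)" for k
      using top \<theta>[of k] by (simp add: q_def ennreal_mult_top \<theta>_def ennreal_of_nat_eq_real_of_nat)
    moreover have "(\<lambda>k. of_nat (Suc k) :: ennreal) \<longlonglongrightarrow> \<top>"
      using of_nat_tendsto_top_ennreal LIMSEQ_Suc by blast
    ultimately show ?thesis using top by simp
  qed
  have Lz: "?L = (\<integral>\<^sup>+\<omega>. ennreal (z \<omega>) * active_count j c a \<omega> \<partial>M)"
  proof (rule nn_integral_cong_AE, use AE_eexp_interference AE_scaled_idle_max_le_iff in eventually_elim)
    case (elim \<omega>)
    then show ?case using t y by (auto simp: indicator_def z_def)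
  qed
  have zq: "(\<integral>\<^sup>+\<omega>. ennreal (z \<omega>) * q k \<omega> \<partial>M) = ennreal (G0 * (1 - exp (- ((1 - exp (- \<theta> k)) * \<kappa>))) / \<theta> k)" for k
  proof -
    let ?e = "\<lambda>\<omega>. eexp (ennreal (\<theta> k) * active_count j c a \<omega>)"
    have "(\<integral>\<^sup>+\<omega>. ennreal (z \<omega>) * q k \<omega> \<partial>M) = (\<integral>\<^sup>+\<omega>. ennreal ((z \<omega> - z \<omega> * ?e \<omega>) / \<theta> k) \<partial>M)"
    proof (rule nn_integral_cong)
      fix \<omega>
      have "z \<omega> * ((1 - ?e \<omega>) / \<theta> k) = (z \<omega> - z \<omega> * ?e \<omega>) / \<theta> k" by (simp add: algebra_simps)
      then show "ennreal (z \<omega>) * q k \<omega> = ennreal ((z \<omega> - z \<omega> * ?e \<omega>) / \<theta> k)"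
        unfolding q_def ennreal_mult'[OF z01(1), symmetric] by (simp only:)
    qed
    also have "\<dots> = ennreal (expectation (\<lambda>\<omega>. (z \<omega> - z \<omega> * ?e \<omega>) / \<theta> k))"
    proof (rule nn_integral_eq_integral)
      have "integrable M z" "integrable M (\<lambda>\<omega>. z \<omega> * ?e \<omega>)"
        using z01 by (auto intro!: integrable_const_bound[of _ 1] AE_I2 mult_le_one simp: abs_mult)
      then show "integrable M (\<lambda>\<omega>. (z \<omega> - z \<omega> * ?e \<omega>) / \<theta> k)" by simp
      show "AE \<omega> in M. 0 \<le> (z \<omega> - z \<omega> * ?e \<omega>) / \<theta> k"
        using z01 by (intro AE_I2 divide_nonneg_pos \<theta>) (simp add: mult_left_le)
    qed
    also have "expectation (\<lambda>\<omega>. (z \<omega> - z \<omega> * ?e \<omega>) / \<theta> k) = (expectation z - expectation (\<lambda>\<omega>. z \<omega> * ?e \<omega>)) / \<theta> k"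
    proof -
      have "integrable M z" "integrable M (\<lambda>\<omega>. z \<omega> * ?e \<omega>)"
        using z01 by (auto intro!: integrable_const_bound[of _ 1] AE_I2 mult_le_one simp: abs_mult)
      then show ?thesis by simp
    qed
    finally show ?thesis using \<theta>[of k] by (simp add: Ez G less_imp_le right_diff_distrib)
  qed
  have zq_lim: "(\<lambda>k. \<integral>\<^sup>+\<omega>. ennreal (z \<omega>) * q k \<omega> \<partial>M) \<longlonglongrightarrow> ennreal (G0 * \<kappa>)"
  proof -
    \<comment> \<open>A difference quotient at \<open>\<theta> = 0\<close>: the inner map
      \<open>1 - exp (- \<theta>)\<close> has slope 1 there, so the limit is
      \<open>G0 * \<kappa>\<close>.\<close>
    have "(\<lambda>k. G0 * (1 - exp (- ((1 - exp (- \<theta> k)) * \<kappa>))) / \<theta> k) \<longlonglongrightarrow> G0 * \<kappa>"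
    proof (cases "\<kappa> = 0")
      case False
      then have "0 < \<kappa>" "0 < G0" using \<kappa> by (auto simp: G0_def)
      then show ?thesis unfolding \<theta>_def by real_asymp
    qed simp
    then show ?thesis unfolding zq by (rule tendsto_ennrealI)
  qed
  have "ennreal (G0 * \<kappa>) \<le> ?L"
  proof (rule LIMSEQ_le_const2[OF zq_lim])
    show "\<exists>N. \<forall>k\<ge>N. (\<integral>\<^sup>+\<omega>. ennreal (z \<omega>) * q k \<omega> \<partial>M) \<le> ?L"
      unfolding Lz by (intro exI[of _ 0] allI impI nn_integral_mono mult_left_mono q_le) auto
  qed
  moreover have "?L \<le> ennreal (G0 * \<kappa>)"
  proof -
    have "?L = (\<integral>\<^sup>+\<omega>. liminf (\<lambda>k. ennreal (z \<omega>) * q k \<omega>) \<partial>M)"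
      unfolding Lz
    proof (rule nn_integral_cong)
      fix \<omega>
      have "(\<lambda>k. ennreal (z \<omega>) * q k \<omega>) \<longlonglongrightarrow> ennreal (z \<omega>) * active_count j c a \<omega>"
        by (intro ennreal_tendsto_cmult q_lim) simp
      then show "ennreal (z \<omega>) * active_count j c a \<omega> = liminf (\<lambda>k. ennreal (z \<omega>) * q k \<omega>)"
        by (simp add: lim_imp_Liminf)
    qed
    also have "\<dots> \<le> liminf (\<lambda>k. \<integral>\<^sup>+\<omega>. ennreal (z \<omega>) * q k \<omega> \<partial>M)"
      by (intro nn_integral_liminf) measurable
    also have "\<dots> = ennreal (G0 * \<kappa>)"
      using zq_lim by (simp add: lim_imp_Liminf)
    finally show ?thesis .
  qed
  ultimately have "?L = ennreal (G0 * \<kappa>)" by (simp add: antisym)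
  moreover have "ennreal (G0 * \<kappa>) = ennreal \<kappa> * ennreal G0"
    using \<kappa>(1) by (subst mult.commute) (rule ennreal_mult')
  ultimately show ?thesis unfolding \<kappa>(2) G0_def by (simp only:)
qed

end

section \<open>A Palm formula\<close>

lemma borel_measurable_triple [measurable]:
  fixes f g k :: "'x \<Rightarrow> real"
  assumes "f \<in> borel_measurable N" "g \<in> borel_measurable N" "k \<in> borel_measurable N"
  shows "(\<lambda>x. (f x, g x, k x)) \<in> borel_measurable N"
  using assms by (intro borel_measurable_Pair)

lemma borel_triple_boxes [measurable, simp]:
  "{..a} \<times> {..b} \<times> {..y} \<in> sets (borel :: (real \<times> real \<times> real) measure)"
  "UNIV \<times> UNIV \<times> {..<y} \<in> sets (borel :: (real \<times> real \<times> real) measure)"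
  by (rule borel_closed, intro closed_Times closed_atMost)
     (rule borel_open, intro open_Times open_UNIV open_lessThan)

context coverage_network
begin

lemma scaled_idle_max_real_not_neg [simp]: "\<not> scaled_idle_max_real \<omega> < 0"
  by (simp add: not_less)

lemma nn_interference_laplace:
  assumes "0 \<le> t"
  shows "(\<integral>\<^sup>+\<omega>. ennreal (exp (- (t * interference_real \<omega>))) \<partial>M) = ennreal (exp (- (stable_rate * t powr \<delta>)))"
proof -
  have "(\<integral>\<^sup>+\<omega>. ennreal (exp (- (t * interference_real \<omega>))) \<partial>M) = (\<integral>\<^sup>+\<omega>. ennreal (eexp (ennreal t * interference \<omega>)) \<partial>M)"
    by (rule nn_integral_cong_AE, use AE_eexp_interference in eventually_elim) (use assms in auto)
  also have "\<dots> = ennreal (expectation (\<lambda>\<omega>. eexp (ennreal t * interference \<omega>)))"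
    by (intro nn_integral_eq_integral integrable_const_bound[of _ 1]) auto
  finally show ?thesis by (simp add: interference_laplace[OF assms])
qed

lemma nn_idle_cdf:
  assumes "0 < y"
  shows "(\<integral>\<^sup>+\<omega>. indicator {..y} (scaled_idle_max_real \<omega>) \<partial>M) = ennreal (exp (- (idle_rate * y powr - \<delta>)))"
  using nn_joint_laplace[of 0 y] assms \<delta> by simp

text \<open>Slivnyak-Mecke for one extra station: a station of power \<open>s\<close> sees
  \<open>s\<close> plus a fresh copy of the interference and an independent idle maximum. Both sides
  integrate \<open>g\<close> against measures on triples, the right one finite because
  \<open>c > 0\<close>, so agreement on boxes suffices. With the power and idle bounds of a box
  fixed, the remaining interference marginals have equal Laplace transforms by
  \<open>palm_laplace\<close>.\<close>

theorem palm_formula: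
  fixes g :: "real \<times> real \<times> real \<Rightarrow> ennreal"
  assumes j: "j \<in> {1..K}" and c: "0 < c" and g [measurable]: "g \<in> borel_measurable borel"
  shows "(\<integral>\<^sup>+\<omega>. (\<Sum>n. if act j n \<omega> \<and> c < rx_power j n \<omega>
      then g (rx_power j n \<omega>, interference_real \<omega>, scaled_idle_max_real \<omega>) else 0) \<partial>M) =
    (\<integral>\<^sup>+s. ennreal (intensity j True) * indicator {c<..} s *
      (\<integral>\<^sup>+\<omega>. (\<integral>\<^sup>+\<omega>'. g (s, s + interference_real \<omega>, scaled_idle_max_real \<omega>') \<partial>M) \<partial>M) \<partial>power_intensity \<delta>)"
proof -
  note [measurable] = rx_power_measurable[OF j] act_pred[OF j] active_count_measurable[OF j]
  interpret L: sigma_finite_measure "power_intensity \<delta>" by (rule sigma_finite_power_intensity)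
  interpret MM: pair_prob_space M M ..
  interpret LM: pair_sigma_finite "power_intensity \<delta>" M ..
  interpret LMM: pair_sigma_finite "power_intensity \<delta>" "M \<Otimes>\<^sub>M M" ..
  let ?I = interference_real and ?D = scaled_idle_max_real and ?s = "rx_power j"
  define W where "W n \<omega> = (if act j n \<omega> \<and> c < ?s n \<omega> then 1 else 0 :: ennreal)" for n \<omega>
  have W_meas [measurable]: "W n \<in> borel_measurable M" for n unfolding W_def by measurable
  \<comment> \<open>The Campbell measure: summing over the station index becomes integration over
    \<open>count_space UNIV\<close>, so that the sum is the integral of \<open>g\<close> against one
    measure.\<close>
  define N1 where "N1 = distr (density (count_space UNIV \<Otimes>\<^sub>M M) (\<lambda>z. W (fst z) (snd z))) borel
    (\<lambda>z. (?s (fst z) (snd z), ?I (snd z), ?D (snd z)))"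
  define N2 where "N2 = distr (density (power_intensity \<delta> \<Otimes>\<^sub>M (M \<Otimes>\<^sub>M M)) (\<lambda>z. ennreal (intensity j True) * indicator {c<..} (fst z))) borel
    (\<lambda>z. (fst z, fst z + ?I (fst (snd z)), ?D (snd (snd z))))"
  have W_pair [measurable]: "(\<lambda>z. W (fst z) (snd z)) \<in> borel_measurable (count_space UNIV \<Otimes>\<^sub>M M)"
    by (rule measurable_pair_measure_countable1) auto
  have s_pair [measurable]: "(\<lambda>z. ?s (fst z) (snd z)) \<in> borel_measurable (count_space UNIV \<Otimes>\<^sub>M M)"
    by (rule measurable_pair_measure_countable1) auto
  have nn1: "(\<integral>\<^sup>+z. g z \<partial>N1) = (\<integral>\<^sup>+\<omega>. (\<Sum>n. W n \<omega> * g (?s n \<omega>, ?I \<omega>, ?D \<omega>)) \<partial>M)"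
    if [measurable]: "g \<in> borel_measurable borel" for g
  proof -
    have "(\<integral>\<^sup>+z. g z \<partial>N1) = (\<integral>\<^sup>+z. W (fst z) (snd z) * g (?s (fst z) (snd z), ?I (snd z), ?D (snd z)) \<partial>(count_space UNIV \<Otimes>\<^sub>M M))"
      unfolding N1_def by (subst nn_integral_distr, measurable, subst nn_integral_density) auto
    also have "\<dots> = (\<integral>\<^sup>+n. (\<integral>\<^sup>+\<omega>. W n \<omega> * g (?s n \<omega>, ?I \<omega>, ?D \<omega>) \<partial>M) \<partial>count_space UNIV)"
      by (subst nn_integral_fst[symmetric]) auto
    also have "\<dots> = (\<Sum>n. (\<integral>\<^sup>+\<omega>. W n \<omega> * g (?s n \<omega>, ?I \<omega>, ?D \<omega>) \<partial>M))"
      by (rule nn_integral_count_space_nat)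
    also have "\<dots> = (\<integral>\<^sup>+\<omega>. (\<Sum>n. W n \<omega> * g (?s n \<omega>, ?I \<omega>, ?D \<omega>)) \<partial>M)"
      by (rule nn_integral_suminf[symmetric]) measurable
    finally show ?thesis .
  qed
  have nn2: "(\<integral>\<^sup>+z. g z \<partial>N2) = (\<integral>\<^sup>+s. ennreal (intensity j True) * indicator {c<..} s *
      (\<integral>\<^sup>+\<omega>. (\<integral>\<^sup>+\<omega>'. g (s, s + ?I \<omega>, ?D \<omega>') \<partial>M) \<partial>M) \<partial>power_intensity \<delta>)"
    if [measurable]: "g \<in> borel_measurable borel" for g
  proof -
    have "(\<integral>\<^sup>+z. g z \<partial>N2) = (\<integral>\<^sup>+z. ennreal (intensity j True) * indicator {c<..} (fst z) *
        g (fst z, fst z + ?I (fst (snd z)), ?D (snd (snd z))) \<partial>(power_intensity \<delta> \<Otimes>\<^sub>M (M \<Otimes>\<^sub>M M)))"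
      unfolding N2_def by (subst nn_integral_distr, measurable, subst nn_integral_density) auto
    also have "\<dots> = (\<integral>\<^sup>+s. (\<integral>\<^sup>+w. ennreal (intensity j True) * indicator {c<..} s *
        g (s, s + ?I (fst w), ?D (snd w)) \<partial>(M \<Otimes>\<^sub>M M)) \<partial>power_intensity \<delta>)"
      by (subst MM.P.nn_integral_fst[symmetric]) auto
    also have "\<dots> = (\<integral>\<^sup>+s. ennreal (intensity j True) * indicator {c<..} s *
        (\<integral>\<^sup>+w. g (s, s + ?I (fst w), ?D (snd w)) \<partial>(M \<Otimes>\<^sub>M M)) \<partial>power_intensity \<delta>)"
      by (intro nn_integral_cong nn_integral_cmult) auto
    also have "\<dots> = (\<integral>\<^sup>+s. ennreal (intensity j True) * indicator {c<..} s *
      (\<integral>\<^sup>+\<omega>. (\<integral>\<^sup>+\<omega>'. g (s, s + ?I \<omega>, ?D \<omega>') \<partial>M) \<partial>M) \<partial>power_intensity \<delta>)"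
      by (intro nn_integral_cong arg_cong2[where f = "(*)"] refl, subst nn_integral_fst[symmetric]) auto
    finally show ?thesis .
  qed
  have "N1 = N2"
  proof (rule measure_eqI_boxes)
    show "sets N1 = sets borel" "sets N2 = sets borel" by (simp_all add: N1_def N2_def)
    show "finite_measure N2"
    proof (rule finite_measureI)
      have "emeasure N2 (space N2) = (\<integral>\<^sup>+z. 1 \<partial>N2)" by simp
      also have "\<dots> = ennreal (intensity j True) * emeasure (power_intensity \<delta>) {c<..}"
        by (subst nn2) (auto simp: emeasure_space_1 nn_integral_cmult)
      also have "\<dots> < \<infinity>"
        using emeasure_power_intensity(1)[OF \<delta>(1) c] by (simp add: ennreal_mult_less_top)
      finally show "emeasure N2 (space N2) \<noteq> \<infinity>" by simp
    qed
    have em: "emeasure N A = (\<integral>\<^sup>+z. indicator A z \<partial>N)" if "A \<in> sets N" for N :: "(real \<times> real \<times> real) measure" and A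
      using that by simp
    show "emeasure N1 (UNIV \<times> UNIV \<times> {..<0}) = 0"
      by (subst em, simp add: N1_def, subst nn1) (auto simp: indicator_def)
    show "emeasure N2 (UNIV \<times> UNIV \<times> {..<0}) = 0"
      by (subst em, simp add: N2_def, subst nn2) (auto simp: indicator_def)
    fix a b y :: real assume y: "0 < y"
    define F where "F = exp (- (idle_rate * y powr - \<delta>))"
    \<comment> \<open>The box bounds \<open>a\<close> and \<open>y\<close> are absorbed into the
      densities, and only the interference coordinate is left to compare.\<close>
    define L1 where "L1 = distr (density M (\<lambda>\<omega>. indicator {..y} (?D \<omega>) * active_count j c a \<omega>)) borel ?I"
    define L2 where "L2 = distr (density (power_intensity \<delta> \<Otimes>\<^sub>M M)
      (\<lambda>z. ennreal (intensity j True) * ennreal F * indicator {c<..a} (fst z))) borel (\<lambda>z. fst z + ?I (snd z))"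
    have nnL1: "(\<integral>\<^sup>+x. f x \<partial>L1) = (\<integral>\<^sup>+\<omega>. indicator {..y} (?D \<omega>) * active_count j c a \<omega> * f (?I \<omega>) \<partial>M)"
      if [measurable]: "f \<in> borel_measurable borel" for f
      unfolding L1_def by (subst nn_integral_distr, measurable, subst nn_integral_density) auto
    have nnL2: "(\<integral>\<^sup>+x. f x \<partial>L2) = (\<integral>\<^sup>+s. ennreal (intensity j True) * ennreal F * indicator {c<..a} s *
        (\<integral>\<^sup>+\<omega>. f (s + ?I \<omega>) \<partial>M) \<partial>power_intensity \<delta>)"
      if [measurable]: "f \<in> borel_measurable borel" for f
    proof -
      have "(\<integral>\<^sup>+x. f x \<partial>L2) = (\<integral>\<^sup>+z. ennreal (intensity j True) * ennreal F * indicator {c<..a} (fst z) *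
          f (fst z + ?I (snd z)) \<partial>(power_intensity \<delta> \<Otimes>\<^sub>M M))"
        unfolding L2_def by (subst nn_integral_distr, measurable, subst nn_integral_density) auto
      also have "\<dots> = (\<integral>\<^sup>+s. (\<integral>\<^sup>+\<omega>. ennreal (intensity j True) * ennreal F * indicator {c<..a} s *
          f (s + ?I \<omega>) \<partial>M) \<partial>power_intensity \<delta>)"
        by (subst nn_integral_fst[symmetric]) auto
      also have "\<dots> = (\<integral>\<^sup>+s. ennreal (intensity j True) * ennreal F * indicator {c<..a} s *
          (\<integral>\<^sup>+\<omega>. f (s + ?I \<omega>) \<partial>M) \<partial>power_intensity \<delta>)"
        by (intro nn_integral_cong nn_integral_cmult) auto
      finally show ?thesis .
    qed
    have lap2: "(\<integral>\<^sup>+x. ennreal (exp (- (t * x))) \<partial>L2) =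
        ennreal (intensity j True) * ennreal F * (window_mass c a t * ennreal (exp (- (stable_rate * t powr \<delta>))))"
      if t: "0 \<le> t" for t
    proof -
      have "(\<integral>\<^sup>+x. ennreal (exp (- (t * x))) \<partial>L2) = (\<integral>\<^sup>+s. ennreal (intensity j True) * ennreal F *
          (ennreal (exp (- (t * s))) * indicator {c<..a} s * ennreal (exp (- (stable_rate * t powr \<delta>)))) \<partial>power_intensity \<delta>)"
      proof (subst nnL2, simp, rule nn_integral_cong)
        fix s
        have "(\<integral>\<^sup>+\<omega>. ennreal (exp (- (t * (s + ?I \<omega>)))) \<partial>M) = (\<integral>\<^sup>+\<omega>. ennreal (exp (- (t * s))) * ennreal (exp (- (t * ?I \<omega>))) \<partial>M)"
          by (intro nn_integral_cong) (simp add: distrib_left flip: ennreal_mult' exp_add)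
        also have "\<dots> = ennreal (exp (- (t * s))) * ennreal (exp (- (stable_rate * t powr \<delta>)))"
          by (subst nn_integral_cmult) (simp_all add: nn_interference_laplace[OF t])
        finally show "ennreal (intensity j True) * ennreal F * indicator {c<..a} s *
            (\<integral>\<^sup>+\<omega>. ennreal (exp (- (t * (s + ?I \<omega>)))) \<partial>M) = ennreal (intensity j True) * ennreal F *
          (ennreal (exp (- (t * s))) * indicator {c<..a} s * ennreal (exp (- (stable_rate * t powr \<delta>))))"
          by (simp only: mult_ac)
      qed
      also have "\<dots> = ennreal (intensity j True) * ennreal F * (window_mass c a t * ennreal (exp (- (stable_rate * t powr \<delta>))))"
        unfolding window_mass_def by (subst nn_integral_cmult, measurable, subst nn_integral_multc) auto
      finally show ?thesis .
    qed
    have lap1: "(\<integral>\<^sup>+x. ennreal (exp (- (t * x))) \<partial>L1) =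
        ennreal (intensity j True) * ennreal F * (window_mass c a t * ennreal (exp (- (stable_rate * t powr \<delta>))))"
      if t: "0 \<le> t" for t
    proof -
      have "(\<integral>\<^sup>+x. ennreal (exp (- (t * x))) \<partial>L1) =
          (\<integral>\<^sup>+\<omega>. ennreal (exp (- (t * ?I \<omega>))) * indicator {..y} (?D \<omega>) * active_count j c a \<omega> \<partial>M)"
        by (subst nnL1, simp, intro nn_integral_cong) (simp only: mult_ac)
      also have "\<dots> = ennreal (intensity j True) * window_mass c a t * ennreal (exp (- (stable_rate * t powr \<delta>)) * F)"
        unfolding F_def by (rule palm_laplace[OF t j c y])
      also have "ennreal (exp (- (stable_rate * t powr \<delta>)) * F) = ennreal (exp (- (stable_rate * t powr \<delta>))) * ennreal F"
        by (rule ennreal_mult') simp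
      finally show ?thesis by (simp only: mult_ac)
    qed
    have L_eq: "emeasure L1 {..b} = emeasure L2 {..b}"
    proof (rule measure_atMost_eq_of_nn_laplace)
      show "sets L1 = sets borel" "sets L2 = sets borel" by (simp_all add: L1_def L2_def)
      show "AE x in L1. 0 \<le> x"
        unfolding L1_def by (rule AE_distr_iff[THEN iffD2]) auto
      show "AE x in L2. 0 \<le> x"
      proof -
        have "AE z in power_intensity \<delta> \<Otimes>\<^sub>M M. 0 < ennreal (intensity j True) * ennreal F * indicator {c<..a} (fst z) \<longrightarrow> 0 \<le> fst z + ?I (snd z)"
          using c by (intro AE_I2) (auto simp: indicator_def intro!: add_nonneg_nonneg)
        then show ?thesis
          unfolding L2_def by (intro AE_distr_iff[THEN iffD2] AE_density[THEN iffD2]) measurable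
      qed
      show "(\<integral>\<^sup>+x. ennreal (exp (- real t * x)) \<partial>L1) = (\<integral>\<^sup>+x. ennreal (exp (- real t * x)) \<partial>L2)" for t :: nat
        using lap1[of "real t"] lap2[of "real t"] by simp
      have "emeasure L2 UNIV = (\<integral>\<^sup>+x. ennreal (exp (- (0 * x))) \<partial>L2)"
        by (simp add: L2_def)
      also have "\<dots> < \<infinity>"
        using window_mass_finite[OF c order_refl, of a] by (subst lap2) (auto simp: ennreal_mult_less_top)
      finally show "emeasure L2 UNIV < \<infinity>" .
    qed
    have "emeasure N1 ({..a} \<times> {..b} \<times> {..y}) = (\<integral>\<^sup>+\<omega>. (\<Sum>n. W n \<omega> * indicator ({..a} \<times> {..b} \<times> {..y}) (?s n \<omega>, ?I \<omega>, ?D \<omega>)) \<partial>M)"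
      by (subst em, simp add: N1_def, subst nn1) auto
    also have "\<dots> = (\<integral>\<^sup>+\<omega>. indicator {..y} (?D \<omega>) * active_count j c a \<omega> * indicator {..b} (?I \<omega>) \<partial>M)"
    proof (rule nn_integral_cong)
      fix \<omega>
      have "(\<Sum>n. W n \<omega> * indicator ({..a} \<times> {..b} \<times> {..y}) (?s n \<omega>, ?I \<omega>, ?D \<omega>)) =
          (\<Sum>n. (indicator {..y} (?D \<omega>) * indicator {..b} (?I \<omega>)) * (if act j n \<omega> then indicator {c<..a} (?s n \<omega>) else 0))"
        by (intro suminf_cong) (auto simp: W_def indicator_def)
      also have "\<dots> = (indicator {..y} (?D \<omega>) * indicator {..b} (?I \<omega>)) * active_count j c a \<omega>"
        unfolding active_count_def by (rule ennreal_suminf_cmult)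
      finally show "(\<Sum>n. W n \<omega> * indicator ({..a} \<times> {..b} \<times> {..y}) (?s n \<omega>, ?I \<omega>, ?D \<omega>)) =
          indicator {..y} (?D \<omega>) * active_count j c a \<omega> * indicator {..b} (?I \<omega>)"
        by (simp only: mult_ac)
    qed
    also have "\<dots> = emeasure L1 {..b}"
      by (subst nnL1[symmetric]) (auto simp: L1_def)
    also have "\<dots> = emeasure L2 {..b}" by (fact L_eq)
    also have "\<dots> = (\<integral>\<^sup>+s. ennreal (intensity j True) * ennreal F * indicator {c<..a} s *
        (\<integral>\<^sup>+\<omega>. indicator {..b} (s + ?I \<omega>) \<partial>M) \<partial>power_intensity \<delta>)"
      by (subst nnL2[symmetric]) (auto simp: L2_def)
    also have "\<dots> = (\<integral>\<^sup>+s. ennreal (intensity j True) * indicator {c<..} s *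
        (\<integral>\<^sup>+\<omega>. (\<integral>\<^sup>+\<omega>'. indicator ({..a} \<times> {..b} \<times> {..y}) (s, s + ?I \<omega>, ?D \<omega>') \<partial>M) \<partial>M) \<partial>power_intensity \<delta>)"
    proof (rule nn_integral_cong)
      fix s
      have "(\<integral>\<^sup>+\<omega>. (\<integral>\<^sup>+\<omega>'. indicator ({..a} \<times> {..b} \<times> {..y}) (s, s + ?I \<omega>, ?D \<omega>') \<partial>M) \<partial>M) =
          (\<integral>\<^sup>+\<omega>. (indicator {..a} s * indicator {..b} (s + ?I \<omega>)) * (\<integral>\<^sup>+\<omega>'. indicator {..y} (?D \<omega>') \<partial>M) \<partial>M)"
        by (intro nn_integral_cong, subst nn_integral_cmult[symmetric]) (auto simp: indicator_def intro!: nn_integral_cong)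
      also have "\<dots> = indicator {..a} s * (\<integral>\<^sup>+\<omega>. indicator {..b} (s + ?I \<omega>) \<partial>M) * ennreal F"
        unfolding nn_idle_cdf[OF y] F_def[symmetric]
        by (subst nn_integral_multc, measurable, subst nn_integral_cmult) auto
      finally have *: "(\<integral>\<^sup>+\<omega>. (\<integral>\<^sup>+\<omega>'. indicator ({..a} \<times> {..b} \<times> {..y}) (s, s + ?I \<omega>, ?D \<omega>') \<partial>M) \<partial>M) =
          indicator {..a} s * (\<integral>\<^sup>+\<omega>. indicator {..b} (s + ?I \<omega>) \<partial>M) * ennreal F" .
      have "indicator {c<..a} s = (indicator {c<..} s * indicator {..a} s :: ennreal)"
        by (auto simp: indicator_def)
      then show "ennreal (intensity j True) * ennreal F * indicator {c<..a} s *
          (\<integral>\<^sup>+\<omega>. indicator {..b} (s + ?I \<omega>) \<partial>M) = ennreal (intensity j True) * indicator {c<..} s *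
        (\<integral>\<^sup>+\<omega>. (\<integral>\<^sup>+\<omega>'. indicator ({..a} \<times> {..b} \<times> {..y}) (s, s + ?I \<omega>, ?D \<omega>') \<partial>M) \<partial>M)"
        unfolding * by (simp only: mult_ac)
    qed
    also have "\<dots> = emeasure N2 ({..a} \<times> {..b} \<times> {..y})"
      by (subst em, simp add: N2_def, subst nn2) auto
    finally show "emeasure N1 ({..a} \<times> {..b} \<times> {..y}) = emeasure N2 ({..a} \<times> {..b} \<times> {..y})" .
  qed
  moreover have "(\<integral>\<^sup>+\<omega>. (\<Sum>n. if act j n \<omega> \<and> c < ?s n \<omega> then g (?s n \<omega>, ?I \<omega>, ?D \<omega>) else 0) \<partial>M) = (\<integral>\<^sup>+z. g z \<partial>N1)"
    unfolding nn1[OF g] by (intro nn_integral_cong suminf_cong) (auto simp: W_def)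
  ultimately show ?thesis using nn2[OF g] by simp
qed

text \<open>The joint transform of the interference and the event that the idle maximum stays below
  \<open>y\<close> factors. The constant first coordinate 0 lets the box criterion for triples serve
  for pairs.\<close>

theorem interference_idle_independent:
  fixes g :: "real \<times> real \<Rightarrow> ennreal"
  assumes g [measurable]: "g \<in> borel_measurable borel"
  shows "(\<integral>\<^sup>+\<omega>. g (interference_real \<omega>, scaled_idle_max_real \<omega>) \<partial>M) =
    (\<integral>\<^sup>+\<omega>. (\<integral>\<^sup>+\<omega>'. g (interference_real \<omega>, scaled_idle_max_real \<omega>') \<partial>M) \<partial>M)"
proof -
  interpret MM: pair_prob_space M M ..
  let ?I = interference_real and ?D = scaled_idle_max_real
  define N1 where "N1 = distr M borel (\<lambda>\<omega>. (0 :: real, ?I \<omega>, ?D \<omega>))"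
  define N2 where "N2 = distr (M \<Otimes>\<^sub>M M) borel (\<lambda>z. (0 :: real, ?I (fst z), ?D (snd z)))"
  have nn1: "(\<integral>\<^sup>+z. f z \<partial>N1) = (\<integral>\<^sup>+\<omega>. f (0, ?I \<omega>, ?D \<omega>) \<partial>M)" if "f \<in> borel_measurable borel" for f
    unfolding N1_def using that by (subst nn_integral_distr) auto
  have nn2: "(\<integral>\<^sup>+z. f z \<partial>N2) = (\<integral>\<^sup>+\<omega>. (\<integral>\<^sup>+\<omega>'. f (0, ?I \<omega>, ?D \<omega>') \<partial>M) \<partial>M)" if [measurable]: "f \<in> borel_measurable borel" for f
    unfolding N2_def by (subst nn_integral_distr, measurable, subst nn_integral_fst[symmetric]) auto
  have "N1 = N2"
  proof (rule measure_eqI_boxes)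
    show sets: "sets N1 = sets borel" "sets N2 = sets borel" by (simp_all add: N1_def N2_def)
    have "prob_space N2" unfolding N2_def by (rule MM.prob_space_distr) measurable
    then show "finite_measure N2" by (rule prob_space.finite_measure)
    have em: "emeasure N A = (\<integral>\<^sup>+z. indicator A z \<partial>N)" if "A \<in> sets N" for N :: "(real \<times> real \<times> real) measure" and A
      using that by simp
    show "emeasure N1 (UNIV \<times> UNIV \<times> {..<0}) = 0"
      by (subst em, simp add: N1_def, subst nn1) (auto simp: indicator_def)
    show "emeasure N2 (UNIV \<times> UNIV \<times> {..<0}) = 0"
      by (subst em, simp add: N2_def, subst nn2) (auto simp: indicator_def)
    fix a b y :: real assume y: "0 < y"
    define F where "F = exp (- (idle_rate * y powr - \<delta>))"
    define L1 where "L1 = distr (density M (\<lambda>\<omega>. indicator {..y} (?D \<omega>))) borel ?I"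
    define L2 where "L2 = distr (density M (\<lambda>\<omega>. ennreal F)) borel ?I"
    have nnL1: "(\<integral>\<^sup>+x. f x \<partial>L1) = (\<integral>\<^sup>+\<omega>. indicator {..y} (?D \<omega>) * f (?I \<omega>) \<partial>M)"
      if [measurable]: "f \<in> borel_measurable borel" for f
      unfolding L1_def by (subst nn_integral_distr, measurable, subst nn_integral_density) auto
    have nnL2: "(\<integral>\<^sup>+x. f x \<partial>L2) = ennreal F * (\<integral>\<^sup>+\<omega>. f (?I \<omega>) \<partial>M)"
      if [measurable]: "f \<in> borel_measurable borel" for f
      unfolding L2_def by (subst nn_integral_distr, measurable, subst nn_integral_density) (auto simp: nn_integral_cmult)
    have L_eq: "emeasure L1 {..b} = emeasure L2 {..b}"
    proof (rule measure_atMost_eq_of_nn_laplace)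
      show "sets L1 = sets borel" "sets L2 = sets borel" by (simp_all add: L1_def L2_def)
      show "AE x in L1. 0 \<le> x"
        unfolding L1_def by (rule AE_distr_iff[THEN iffD2]) auto
      show "AE x in L2. 0 \<le> x"
        unfolding L2_def by (rule AE_distr_iff[THEN iffD2]) auto
      show "(\<integral>\<^sup>+x. ennreal (exp (- real t * x)) \<partial>L1) = (\<integral>\<^sup>+x. ennreal (exp (- real t * x)) \<partial>L2)" for t :: nat
      proof -
        have "(\<integral>\<^sup>+x. ennreal (exp (- real t * x)) \<partial>L1) = ennreal (exp (- (stable_rate * real t powr \<delta>)) * F)"
          using nn_joint_laplace[of "real t" y] y by (subst nnL1) (simp_all add: F_def mult.commute)
        also have "\<dots> = (\<integral>\<^sup>+x. ennreal (exp (- real t * x)) \<partial>L2)"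
          using nn_interference_laplace[of "real t"] by (subst nnL2) (simp_all add: F_def mult.commute flip: ennreal_mult')
        finally show ?thesis .
      qed
      have "emeasure L2 UNIV = (\<integral>\<^sup>+x. 1 \<partial>L2)" by (simp add: L2_def)
      also have "\<dots> < \<infinity>" by (subst nnL2) (auto simp: emeasure_space_1)
      finally show "emeasure L2 UNIV < \<infinity>" .
    qed
    have "emeasure N1 ({..a} \<times> {..b} \<times> {..y}) = (\<integral>\<^sup>+\<omega>. indicator ({..a} \<times> {..b} \<times> {..y}) (0, ?I \<omega>, ?D \<omega>) \<partial>M)"
      by (subst em, simp add: N1_def, subst nn1) auto
    also have "\<dots> = (\<integral>\<^sup>+\<omega>. indicator {..a} (0 :: real) * (indicator {..y} (?D \<omega>) * indicator {..b} (?I \<omega>)) \<partial>M)"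
      by (intro nn_integral_cong) (auto simp: indicator_def)
    also have "\<dots> = indicator {..a} (0 :: real) * emeasure L1 {..b}"
      by (subst nn_integral_cmult, measurable, subst nnL1[symmetric]) (auto simp: L1_def)
    also have "\<dots> = indicator {..a} (0 :: real) * (ennreal F * (\<integral>\<^sup>+\<omega>. indicator {..b} (?I \<omega>) \<partial>M))"
      unfolding L_eq by (subst nnL2[symmetric]) (auto simp: L2_def)
    also have "\<dots> = (\<integral>\<^sup>+\<omega>. (\<integral>\<^sup>+\<omega>'. indicator ({..a} \<times> {..b} \<times> {..y}) (0, ?I \<omega>, ?D \<omega>') \<partial>M) \<partial>M)"
    proof -
      have "(\<integral>\<^sup>+\<omega>. (\<integral>\<^sup>+\<omega>'. indicator ({..a} \<times> {..b} \<times> {..y}) (0, ?I \<omega>, ?D \<omega>') \<partial>M) \<partial>M) =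
          (\<integral>\<^sup>+\<omega>. (indicator {..a} (0 :: real) * indicator {..b} (?I \<omega>)) * (\<integral>\<^sup>+\<omega>'. indicator {..y} (?D \<omega>') \<partial>M) \<partial>M)"
        by (intro nn_integral_cong, subst nn_integral_cmult[symmetric]) (auto simp: indicator_def intro!: nn_integral_cong)
      also have "\<dots> = indicator {..a} (0 :: real) * (\<integral>\<^sup>+\<omega>. indicator {..b} (?I \<omega>) \<partial>M) * ennreal F"
        unfolding nn_idle_cdf[OF y] F_def[symmetric]
        by (subst nn_integral_multc, measurable, subst nn_integral_cmult) auto
      finally show ?thesis by (simp only: mult_ac)
    qed
    also have "\<dots> = emeasure N2 ({..a} \<times> {..b} \<times> {..y})"
      by (subst em, simp add: N2_def, subst nn2) auto
    finally show "emeasure N1 ({..a} \<times> {..b} \<times> {..y}) = emeasure N2 ({..a} \<times> {..b} \<times> {..y})" .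
  qed
  moreover have g_meas: "(\<lambda>z :: real \<times> real \<times> real. g (snd z)) \<in> borel_measurable borel"
    by (intro measurable_compose[OF borel_measurable_continuous_onI g]) (auto intro: continuous_intros)
  ultimately show ?thesis using nn1[OF g_meas] nn2[OF g_meas] by simp
qed

end

section \<open>Series expansions\<close>

text \<open>Makes the Mittag-Leffler type series below converge geometrically, for a suitable \<open>T\<close>.\<close>

lemma Gamma_lower_bound:
  fixes r T :: real
  assumes r: "0 \<le> r" and T: "0 < T"
  shows "T powr r * exp (- T) \<le> Gamma (1 + r)"
proof -
  have "ennreal (T powr r * (0 - - exp (- T))) = ennreal (T powr r) * ennreal (0 - - exp (- T))"
    by (rule ennreal_mult') simp
  also have "ennreal (0 - - exp (- T)) = (\<integral>\<^sup>+t. ennreal (exp (- t)) * indicator {T..} t \<partial>lborel)"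
  proof (rule nn_integral_FTC_atLeast[symmetric])
    show "((\<lambda>t::real. - exp (- t)) \<longlongrightarrow> 0) at_top" by real_asymp
  qed (auto intro!: derivative_eq_intros)
  also have "ennreal (T powr r) * (\<integral>\<^sup>+t. ennreal (exp (- t)) * indicator {T..} t \<partial>lborel) =
      (\<integral>\<^sup>+t. ennreal (T powr r) * (ennreal (exp (- t)) * indicator {T..} t) \<partial>lborel)"
    by (rule nn_integral_cmult[symmetric]) measurable
  \<comment> \<open>Only the part \<open>t \<ge> T\<close> of Euler's integral is used, where
    \<open>t powr r\<close> is at least \<open>T powr r\<close>.\<close>
  also have "\<dots> \<le> (\<integral>\<^sup>+t. ennreal (indicator {0..} t * t powr (1 + r - 1) / exp t) \<partial>lborel)"
  proof (rule nn_integral_mono)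
    fix t :: real
    show "ennreal (T powr r) * (ennreal (exp (- t)) * indicator {T..} t) \<le> ennreal (indicator {0..} t * t powr (1 + r - 1) / exp t)"
    proof (cases "T \<le> t")
      case True
      then have "T powr r * exp (- t) \<le> t powr r * exp (- t)"
        using r T by (intro mult_right_mono powr_mono2) auto
      then show ?thesis
        using True T by (simp add: exp_minus divide_inverse ennreal_leI flip: ennreal_mult')
    qed simp
  qed
  also have "\<dots> = ennreal (Gamma (1 + r))"
    using r by (intro Gamma_conv_nn_integral_real[symmetric]) simp
  finally show ?thesis
    using r Gamma_real_pos[of "1 + r"] by (simp add: ennreal_le_iff)
qed

text \<open>\<open>T\<close> is chosen with \<open>T powr \<delta> = 4 * x + 1\<close>, so that
  \<open>1 / \<Gamma>(1 + \<delta> m)\<close> is at most \<open>exp T / (4 * x + 1) ^ m\<close>. The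
  constant 4 leaves room for the second claim: \<open>m + 1 \<le> 2 ^ m\<close>, and the ratio
  \<open>2 * x / (4 * x + 1)\<close> is still below 1.\<close>

lemma summable_power_over_Gamma:
  fixes x :: real
  assumes \<delta>: "0 < \<delta>" and x: "0 \<le> x"
  shows "summable (\<lambda>m. x ^ m / Gamma (1 + \<delta> * real m))"
    and "summable (\<lambda>m. real (Suc m) * x ^ m / Gamma (1 + \<delta> * real (Suc m)))"
proof -
  define T where "T = (4 * x + 1) powr (1 / \<delta>)"
  have T: "0 < T" using x by (simp add: T_def)
  have Tm: "T powr (\<delta> * real m) = (4 * x + 1) ^ m" for m
    using x \<delta> by (simp add: T_def powr_powr powr_realpow)
  have G: "1 / Gamma (1 + \<delta> * real m) \<le> exp T / (4 * x + 1) ^ m" and Gpos: "0 < Gamma (1 + \<delta> * real m)" for m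
  proof -
    show pos: "0 < Gamma (1 + \<delta> * real m)" using \<delta> by (intro Gamma_real_pos) (simp add: add_pos_nonneg)
    have "(4 * x + 1) ^ m * exp (- T) \<le> Gamma (1 + \<delta> * real m)"
      using Gamma_lower_bound[of "\<delta> * real m" T] \<delta> T by (simp add: Tm)
    then have "1 / Gamma (1 + \<delta> * real m) \<le> 1 / ((4 * x + 1) ^ m * exp (- T))"
      using x pos by (intro divide_left_mono) auto
    then show "1 / Gamma (1 + \<delta> * real m) \<le> exp T / (4 * x + 1) ^ m"
      by (simp add: exp_minus field_simps)
  qed
  have q: "0 \<le> x / (4 * x + 1)" "2 * x / (4 * x + 1) < 1" "x / (4 * x + 1) < 1" using x by (auto simp: divide_simps)
  show "summable (\<lambda>m. x ^ m / Gamma (1 + \<delta> * real m))"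
  proof (rule summable_comparison_test)
    show "summable (\<lambda>m. exp T * (x / (4 * x + 1)) ^ m)"
      by (intro summable_mult summable_geometric) (simp only: real_norm_def abs_of_nonneg[OF q(1)] q(3))
    have "norm (x ^ m / Gamma (1 + \<delta> * real m)) \<le> exp T * (x / (4 * x + 1)) ^ m" for m
      using mult_left_mono[OF G[of m], of "x ^ m"] x Gpos[of m] by (simp add: power_divide mult.commute)
    then show "\<exists>N. \<forall>m\<ge>N. norm (x ^ m / Gamma (1 + \<delta> * real m)) \<le> exp T * (x / (4 * x + 1)) ^ m" by blast
  qed
  show "summable (\<lambda>m. real (Suc m) * x ^ m / Gamma (1 + \<delta> * real (Suc m)))"
  proof (rule summable_comparison_test)
    have "0 \<le> 2 * x / (4 * x + 1)" using x by simp
    then show "summable (\<lambda>m. exp T * (2 * x / (4 * x + 1)) ^ m)"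
      by (intro summable_mult summable_geometric) (simp only: real_norm_def abs_of_nonneg q(2))
    have "norm (real (Suc m) * x ^ m / Gamma (1 + \<delta> * real (Suc m))) \<le> exp T * (2 * x / (4 * x + 1)) ^ m" for m
    proof -
      have "real (Suc m) \<le> 2 ^ m"
        using Suc_leI[OF less_exp[of m]] by (metis of_nat_le_iff of_nat_numeral of_nat_power)
      then have "real (Suc m) * x ^ m \<le> (2 * x) ^ m"
        using x by (simp add: power_mult_distrib mult_right_mono del: of_nat_Suc)
      moreover have "exp T / (4 * x + 1) ^ Suc m \<le> exp T / (4 * x + 1) ^ m"
        using x by (intro divide_left_mono power_increasing) auto
      then have "1 / Gamma (1 + \<delta> * real (Suc m)) \<le> exp T / (4 * x + 1) ^ m"
        using G[of "Suc m"] by linarith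
      ultimately have "(real (Suc m) * x ^ m) * (1 / Gamma (1 + \<delta> * real (Suc m))) \<le> (2 * x) ^ m * (exp T / (4 * x + 1) ^ m)"
        using x Gpos[of "Suc m"] by (intro mult_mono) auto
      then show ?thesis
        using x Gpos[of "Suc m"] by (simp add: power_divide mult.commute del: of_nat_Suc)
    qed
    then show "\<exists>N. \<forall>m\<ge>N. norm (real (Suc m) * x ^ m / Gamma (1 + \<delta> * real (Suc m))) \<le> exp T * (2 * x / (4 * x + 1)) ^ m" by blast
  qed
qed

text \<open>The substitution \<open>s = x * u\<close> extracts the homogeneous factor
  \<open>x powr - (\<delta> * (m + 1))\<close>. The parameters are
  \<open>a = \<delta> * (m + 1)\<close> and \<open>b = \<delta> * m\<close>, and the
  \<open>\<delta>\<close> of the density turns the factor \<open>1 / a\<close> into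
  \<open>1 / (m + 1)\<close>.\<close>

lemma nn_integral_shifted_power_scaled:
  fixes \<delta> \<beta> x :: real
  assumes \<delta>: "0 < \<delta>" and \<beta>: "0 < \<beta>" and x: "0 < x"
  shows "(\<integral>\<^sup>+s. ennreal ((s + x) powr - (\<delta> * real m)) * indicator {\<beta> * x..} s \<partial>power_intensity \<delta>) =
    ennreal (x powr - (\<delta> * real (Suc m))) *
    ennreal (\<beta> powr - \<delta> * (1 + \<beta>) powr - (\<delta> * real m) / real (Suc m) *
      (\<Sum>n. pochhammer (\<delta> * real m) n / pochhammer (\<delta> * real (Suc m) + 1) n * (1 / (1 + \<beta>)) ^ n))"
proof -
  let ?a = "\<delta> * real (Suc m)" and ?b = "\<delta> * real m"
  let ?S = "\<Sum>n. pochhammer ?b n / pochhammer (?a + 1) n * (1 / (1 + \<beta>)) ^ n"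
  have ab: "?a - ?b = \<delta>" by (simp add: algebra_simps)
  have "(\<integral>\<^sup>+s. ennreal ((s + x) powr - ?b) * indicator {\<beta> * x..} s \<partial>power_intensity \<delta>) =
      (\<integral>\<^sup>+s. ennreal (\<delta> * s powr (- \<delta> - 1)) * indicator {0<..} s * (ennreal ((s + x) powr - ?b) * indicator {\<beta> * x..} s) \<partial>lborel)"
    unfolding power_intensity_def by (rule nn_integral_density) measurable
  also have "\<dots> = ennreal \<bar>x\<bar> * (\<integral>\<^sup>+u. ennreal (\<delta> * (0 + x * u) powr (- \<delta> - 1)) * indicator {0<..} (0 + x * u) *
      (ennreal ((0 + x * u + x) powr - ?b) * indicator {\<beta> * x..} (0 + x * u)) \<partial>lborel)"
    using x by (intro nn_integral_real_affine) auto
  also have "(\<integral>\<^sup>+u. ennreal (\<delta> * (0 + x * u) powr (- \<delta> - 1)) * indicator {0<..} (0 + x * u) *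
      (ennreal ((0 + x * u + x) powr - ?b) * indicator {\<beta> * x..} (0 + x * u)) \<partial>lborel) =
    (\<integral>\<^sup>+u. ennreal (\<delta> * x powr (- \<delta> - 1) * x powr - ?b) * (ennreal (u powr (- \<delta> - 1) * (1 + u) powr - ?b) * indicator {\<beta>..} u) \<partial>lborel)"
  proof (rule nn_integral_cong)
    fix u :: real
    show "ennreal (\<delta> * (0 + x * u) powr (- \<delta> - 1)) * indicator {0<..} (0 + x * u) *
      (ennreal ((0 + x * u + x) powr - ?b) * indicator {\<beta> * x..} (0 + x * u)) =
      ennreal (\<delta> * x powr (- \<delta> - 1) * x powr - ?b) * (ennreal (u powr (- \<delta> - 1) * (1 + u) powr - ?b) * indicator {\<beta>..} u)"
    proof (cases "\<beta> \<le> u")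
      case True
      then have u: "0 < u" using \<beta> by simp
      have "0 + x * u + x = x * (1 + u)" by (simp add: algebra_simps)
      then have "(0 + x * u + x) powr - ?b = x powr - ?b * (1 + u) powr - ?b"
        using x u by (simp only:) (simp add: powr_mult)
      moreover have "(0 + x * u) powr (- \<delta> - 1) = x powr (- \<delta> - 1) * u powr (- \<delta> - 1)"
        using x u by (simp add: powr_mult)
      moreover have "\<beta> * x \<le> 0 + x * u" "0 < 0 + x * u" using x u True by (simp_all add: mult.commute)
      ultimately show ?thesis
        using True \<delta> by (simp only:) (simp add: ac_simps flip: ennreal_mult')
    next
      case False
      then have "\<not> \<beta> * x \<le> x * u" using x by (simp add: mult.commute)
      then show ?thesis using False by simp
    qed
  qed
  also have "\<dots> = ennreal (\<delta> * x powr (- \<delta> - 1) * x powr - ?b) *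
      (\<integral>\<^sup>+u. ennreal (u powr (- \<delta> - 1) * (1 + u) powr - ?b) * indicator {\<beta>..} u \<partial>lborel)"
    by (rule nn_integral_cmult) measurable
  also have "(\<integral>\<^sup>+u. ennreal (u powr (- \<delta> - 1) * (1 + u) powr - ?b) * indicator {\<beta>..} u \<partial>lborel) =
      ennreal (\<beta> powr - \<delta> * (1 + \<beta>) powr - ?b / ?a * ?S)"
    using nn_integral_shifted_power[of ?b ?a \<beta>] \<delta> \<beta> unfolding ab by simp
  also have "ennreal \<bar>x\<bar> * (ennreal (\<delta> * x powr (- \<delta> - 1) * x powr - ?b) * ennreal (\<beta> powr - \<delta> * (1 + \<beta>) powr - ?b / ?a * ?S)) =
      ennreal (\<bar>x\<bar> * ((\<delta> * x powr (- \<delta> - 1) * x powr - ?b) * (\<beta> powr - \<delta> * (1 + \<beta>) powr - ?b / ?a * ?S)))"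
    using \<delta> by (simp only: ennreal_mult' abs_ge_zero mult_nonneg_nonneg less_imp_le powr_ge_zero)
  also have "\<bar>x\<bar> * ((\<delta> * x powr (- \<delta> - 1) * x powr - ?b) * (\<beta> powr - \<delta> * (1 + \<beta>) powr - ?b / ?a * ?S)) =
      x powr - ?a * (\<beta> powr - \<delta> * (1 + \<beta>) powr - ?b / real (Suc m) * ?S)"
  proof -
    have "x powr - ?a = x * (x powr (- \<delta> - 1) * x powr - ?b)"
      using x by (simp add: algebra_simps powr_mult_base flip: powr_add)
    then show ?thesis using x \<delta> by (simp add: divide_inverse ac_simps del: of_nat_Suc)
  qed
  finally show ?thesis by (simp only: ennreal_mult'[OF powr_ge_zero])
qed

section \<open>Series for the idle event and for the expected number of strong stations\<close>

context coverage_network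
begin

text \<open>For positive arguments, the distribution function of the scaled idle maximum, of Frechet
  type.\<close>

definition idle_void :: "real \<Rightarrow> real" where
  "idle_void y = exp (- (idle_rate * y powr - \<delta>))"

lemma idle_void_measurable [measurable]: "idle_void \<in> borel_measurable borel"
  unfolding idle_void_def by measurable

text \<open>The distribution function is continuous at \<open>y\<close>, so approximating levels
  from below already exhaust the probability.\<close>

lemma nn_idle_strict_cdf:
  assumes y: "0 < y"
  shows "(\<integral>\<^sup>+\<omega>. indicator {..<y} (scaled_idle_max_real \<omega>) \<partial>M) = ennreal (idle_void y)"
proof (rule antisym)
  have "(\<integral>\<^sup>+\<omega>. indicator {..<y} (scaled_idle_max_real \<omega>) \<partial>M) \<le> (\<integral>\<^sup>+\<omega>. indicator {..y} (scaled_idle_max_real \<omega>) \<partial>M)"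
    by (intro nn_integral_mono) (auto simp: indicator_def)
  then show "(\<integral>\<^sup>+\<omega>. indicator {..<y} (scaled_idle_max_real \<omega>) \<partial>M) \<le> ennreal (idle_void y)"
    by (simp add: nn_idle_cdf[OF y] idle_void_def)
  \<comment> \<open>The denominator starts at 2, which keeps \<open>v k\<close> positive from
    \<open>k = 0\<close> on.\<close>
  define v where "v k = y * (1 - 1 / real (Suc (Suc k)))" for k
  have v: "0 < v k" "v k < y" for k
  proof -
    have "1 / real (Suc (Suc k)) < 1" "0 < 1 / real (Suc (Suc k))" by simp_all
    then show "0 < v k" "v k < y"
      using y mult_strict_left_mono[of "1 - 1 / real (Suc (Suc k))" 1 y] unfolding v_def
      by (auto intro!: mult_pos_pos simp del: of_nat_Suc)
  qed
  have "(\<lambda>k. v k) \<longlonglongrightarrow> y"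
  proof -
    have "(\<lambda>k. 1 - 1 / real (Suc (Suc k))) \<longlonglongrightarrow> 1" by real_asymp
    then show ?thesis unfolding v_def by (rule tendsto_mult_left[where l = 1 and c = y, simplified])
  qed
  then have "(\<lambda>k. ennreal (idle_void (v k))) \<longlonglongrightarrow> ennreal (idle_void y)"
    unfolding idle_void_def using y by (intro tendsto_intros) auto
  moreover have "ennreal (idle_void (v k)) \<le> (\<integral>\<^sup>+\<omega>. indicator {..<y} (scaled_idle_max_real \<omega>) \<partial>M)" for k
    unfolding idle_void_def nn_idle_cdf[OF v(1), symmetric] using v(2)[of k]
    by (intro nn_integral_mono) (auto simp: indicator_def)
  ultimately show "ennreal (idle_void y) \<le> (\<integral>\<^sup>+\<omega>. indicator {..<y} (scaled_idle_max_real \<omega>) \<partial>M)"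
    by (intro LIMSEQ_le_const2) auto
qed

lemma idle_below_interference:
  "(\<integral>\<^sup>+\<omega>. of_bool (scaled_idle_max_real \<omega> < interference_real \<omega>) \<partial>M) = (\<integral>\<^sup>+\<omega>. ennreal (idle_void (interference_real \<omega>)) \<partial>M)"
proof -
  have "{z :: real \<times> real. snd z < fst z} \<in> sets borel"
    by (intro borel_open open_Collect_less) (auto intro: continuous_intros)
  then have "(\<integral>\<^sup>+\<omega>. indicator {z. snd z < fst z} (interference_real \<omega>, scaled_idle_max_real \<omega>) \<partial>M) =
    (\<integral>\<^sup>+\<omega>. (\<integral>\<^sup>+\<omega>'. indicator {z. snd z < fst z} (interference_real \<omega>, scaled_idle_max_real \<omega>') \<partial>M) \<partial>M)"
    by (intro interference_idle_independent) simp
  also have "\<dots> = (\<integral>\<^sup>+\<omega>. ennreal (idle_void (interference_real \<omega>)) \<partial>M)"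
  proof (rule nn_integral_cong_AE, use AE_interference_real in eventually_elim)
    case (elim \<omega>)
    have "(\<integral>\<^sup>+\<omega>'. indicator {z. snd z < fst z} (interference_real \<omega>, scaled_idle_max_real \<omega>') \<partial>M) =
        (\<integral>\<^sup>+\<omega>'. indicator {..<interference_real \<omega>} (scaled_idle_max_real \<omega>') \<partial>M)"
      by (intro nn_integral_cong) (auto simp: indicator_def)
    then show ?case using nn_idle_strict_cdf elim by simp
  qed
  finally show ?thesis by (simp add: indicator_def)
qed

lemma negative_moment:
  "(\<integral>\<^sup>+\<omega>. ennreal (interference_real \<omega> powr - (\<delta> * real m)) \<partial>M) =
    ennreal (fact m / (Gamma (1 + \<delta> * real m) * stable_rate ^ m))"
proof -
  let ?N = "distr M borel interference_real"
  have "(\<integral>\<^sup>+x. ennreal (x powr - (\<delta> * real m)) \<partial>?N) = ennreal (fact m / (Gamma (1 + \<delta> * real m) * stable_rate ^ m))"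
  proof (rule negative_moment_of_stable_laplace)
    show "prob_space ?N" by (rule prob_space_distr) measurable
    show "AE x in ?N. 0 < x"
      by (rule AE_distr_iff[THEN iffD2]) (use AE_interference_real in \<open>auto elim: eventually_mono\<close>)
    fix t :: real assume t: "0 < t"
    have "(\<integral>x. exp (- (t * x)) \<partial>?N) = expectation (\<lambda>\<omega>. exp (- (t * interference_real \<omega>)))"
      by (rule integral_distr) measurable
    also have "\<dots> = expectation (\<lambda>\<omega>. eexp (ennreal t * interference \<omega>))"
      using AE_eexp_interference t by (intro integral_cong_AE) (auto elim!: eventually_mono)
    finally show "(\<integral>x. exp (- (t * x)) \<partial>?N) = exp (- stable_rate * t powr \<delta>)"
      using interference_laplace[of t] t by simp
  qed (use \<delta> stable_rate_pos in auto)
  then show ?thesis by (subst (asm) nn_integral_distr) auto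
qed

lemma idle_void_series: "(\<lambda>m. (- idle_rate) ^ m / fact m * y powr - (\<delta> * real m)) sums idle_void y" if "0 < y"
proof -
  have "(\<lambda>m. (- (idle_rate * y powr - \<delta>)) ^ m /\<^sub>R fact m) sums exp (- (idle_rate * y powr - \<delta>))"
    by (rule exp_converges)
  moreover have "(- (idle_rate * y powr - \<delta>)) ^ m /\<^sub>R fact m = (- idle_rate) ^ m / fact m * y powr - (\<delta> * real m)" for m
  proof -
    have "y powr - (\<delta> * real m) = (y powr - \<delta>) ^ m" using that by (simp add: powr_powr flip: powr_realpow)
    moreover have "(- (idle_rate * y powr - \<delta>)) ^ m = (- idle_rate) ^ m * (y powr - \<delta>) ^ m"
      by (subst power_mult_distrib[symmetric]) simp
    ultimately show ?thesis by (simp add: divide_inverse)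
  qed
  ultimately show ?thesis by (simp only: idle_void_def)
qed

text \<open>By independence the probability is the mean of \<open>idle_void\<close> at the
  interference. In its exponential series the factor \<open>1 / m!\<close> cancels the
  \<open>m!\<close> of the negative moment, leaving \<open>1 / \<Gamma>(1 + \<delta> m)\<close>; the
  resulting series converges absolutely, which permits the exchange.\<close>

lemma idle_below_interference_series:
  "(\<lambda>m. (- idle_rate / stable_rate) ^ m / Gamma (1 + \<delta> * real m)) sums
    enn2real (\<integral>\<^sup>+\<omega>. of_bool (scaled_idle_max_real \<omega> < interference_real \<omega>) \<partial>M)"
proof -
  let ?f = "\<lambda>m \<omega>. (- idle_rate) ^ m / fact m * interference_real \<omega> powr - (\<delta> * real m)"
  have int_pow: "integrable M (\<lambda>\<omega>. interference_real \<omega> powr - (\<delta> * real m))"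
    and E_pow: "expectation (\<lambda>\<omega>. interference_real \<omega> powr - (\<delta> * real m)) = fact m / (Gamma (1 + \<delta> * real m) * stable_rate ^ m)" for m
  proof -
    have G: "0 \<le> fact m / (Gamma (1 + \<delta> * real m) * stable_rate ^ m)"
      using stable_rate_pos \<delta> Gamma_real_pos[of "1 + \<delta> * real m"] by (auto intro!: divide_nonneg_nonneg mult_nonneg_nonneg simp: add_pos_nonneg)
    show "integrable M (\<lambda>\<omega>. interference_real \<omega> powr - (\<delta> * real m))"
      by (rule integrableI_nonneg) (auto simp: negative_moment)
    show "expectation (\<lambda>\<omega>. interference_real \<omega> powr - (\<delta> * real m)) = fact m / (Gamma (1 + \<delta> * real m) * stable_rate ^ m)"
      using G by (subst integral_eq_nn_integral) (auto simp: negative_moment)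
  qed
  have eq: "fact m / (Gamma (1 + \<delta> * real m) * stable_rate ^ m) * (c ^ m / fact m) = (c / stable_rate) ^ m / Gamma (1 + \<delta> * real m)" for c m
    by (simp add: power_divide)
  have "(\<lambda>m. expectation (?f m)) sums (expectation (\<lambda>\<omega>. \<Sum>m. ?f m \<omega>))"
  proof (rule sums_integral)
    show "integrable M (?f m)" for m using int_pow by simp
    show "AE \<omega> in M. summable (\<lambda>m. norm (?f m \<omega>))"
    proof (rule AE_I2)
      fix \<omega>
      have "summable (\<lambda>m. norm ((idle_rate * interference_real \<omega> powr - \<delta>) ^ m /\<^sub>R fact m))"
        by (rule summable_norm_exp)
      moreover have "norm ((idle_rate * interference_real \<omega> powr - \<delta>) ^ m /\<^sub>R fact m) = norm (?f m \<omega>)"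
        if "0 < interference_real \<omega>" for m
      proof -
        have "interference_real \<omega> powr - (\<delta> * real m) = (interference_real \<omega> powr - \<delta>) ^ m"
          using that by (simp add: powr_powr flip: powr_realpow)
        then show ?thesis by (simp add: abs_mult power_abs power_mult_distrib divide_inverse)
      qed
      moreover have "summable (\<lambda>m. norm (?f m \<omega>))" if "interference_real \<omega> = 0"
        using that by simp
      ultimately show "summable (\<lambda>m. norm (?f m \<omega>))"
        using interference_real_nonneg[of \<omega>] by (cases "interference_real \<omega> = 0") auto
    qed
    have "expectation (\<lambda>\<omega>. norm (?f m \<omega>)) = (idle_rate / stable_rate) ^ m / Gamma (1 + \<delta> * real m)" for m
    proof -
      have "expectation (\<lambda>\<omega>. norm (?f m \<omega>)) = expectation (\<lambda>\<omega>. interference_real \<omega> powr - (\<delta> * real m) * (idle_rate ^ m / fact m))"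
        using idle_rate_nonneg by (intro Bochner_Integration.integral_cong) (auto simp: abs_mult power_abs)
      also have "\<dots> = fact m / (Gamma (1 + \<delta> * real m) * stable_rate ^ m) * (idle_rate ^ m / fact m)"
        by (subst integral_mult_left_zero) (simp only: E_pow)
      finally show ?thesis unfolding eq .
    qed
    then show "summable (\<lambda>m. expectation (\<lambda>\<omega>. norm (?f m \<omega>)))"
      using summable_power_over_Gamma(1)[OF \<delta>(1), of "idle_rate / stable_rate"] idle_rate_nonneg stable_rate_pos by simp
  qed
  moreover have "expectation (?f m) = (- idle_rate / stable_rate) ^ m / Gamma (1 + \<delta> * real m)" for m
  proof -
    have "expectation (?f m) = expectation (\<lambda>\<omega>. interference_real \<omega> powr - (\<delta> * real m)) * ((- idle_rate) ^ m / fact m)"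
      by (subst integral_mult_left_zero[symmetric]) (simp only: mult.commute)
    then show ?thesis unfolding E_pow eq .
  qed
  moreover have "expectation (\<lambda>\<omega>. \<Sum>m. ?f m \<omega>) = expectation (\<lambda>\<omega>. idle_void (interference_real \<omega>))"
  proof (rule integral_cong_AE)
    show "AE \<omega> in M. (\<Sum>m. ?f m \<omega>) = idle_void (interference_real \<omega>)"
      using AE_interference_real by eventually_elim (rule sums_unique[OF idle_void_series, symmetric], blast)
  qed measurable
  moreover have "expectation (\<lambda>\<omega>. idle_void (interference_real \<omega>)) = enn2real (\<integral>\<^sup>+\<omega>. of_bool (scaled_idle_max_real \<omega> < interference_real \<omega>) \<partial>M)"
    unfolding idle_below_interference by (rule integral_eq_nn_integral) (auto simp: idle_void_def)
  ultimately show ?thesis by simp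
qed

text \<open>The factor \<open>m + 1\<close> is kept out so that it can cancel against
  \<open>fact (Suc m)\<close> later. For \<open>m > 0\<close> the series is the hypergeometric value
  in \<open>B_coeff\<close>; the power series also makes sense at \<open>m = 0\<close>, where
  Euler's integral would have parameter 0.\<close>

definition strong_series :: "nat \<Rightarrow> nat \<Rightarrow> real" where
  "strong_series j m = \<beta> j powr - \<delta> * (1 + \<beta> j) powr - (\<delta> * real m) *
    (\<Sum>n. pochhammer (\<delta> * real m) n / pochhammer (\<delta> * real (Suc m) + 1) n * (1 / (1 + \<beta> j)) ^ n)"

lemma strong_series_nn_integral:
  assumes j: "j \<in> {1..K}" and x: "0 < x"
  shows "(\<integral>\<^sup>+s. ennreal ((s + x) powr - (\<delta> * real m)) * indicator {\<beta> j * x..} s \<partial>power_intensity \<delta>) =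
    ennreal (x powr - (\<delta> * real (Suc m))) * ennreal (strong_series j m / real (Suc m))"
  using nn_integral_shifted_power_scaled[OF \<delta>(1) _ x, of "\<beta> j" m] \<beta>_gt_1[OF j]
  by (simp add: strong_series_def del: of_nat_Suc)

text \<open>For the upper bound the integral at \<open>x = 1\<close> is compared with the tail of
  \<open>power_intensity\<close> beyond \<open>\<beta> j\<close>, since
  \<open>(s + 1) powr - (\<delta> * m) \<le> 1\<close>. The bound dominates the later termwise
  integration.\<close>

lemma strong_series_bounds:
  assumes j: "j \<in> {1..K}"
  shows "0 \<le> strong_series j m" and "strong_series j m \<le> real (Suc m) * \<beta> j powr - \<delta>"
proof -
  have \<beta>: "0 < \<beta> j" using \<beta>_gt_1[OF j] by simp
  have "0 \<le> (\<Sum>n. pochhammer (\<delta> * real m) n / pochhammer (\<delta> * real (Suc m) + 1) n * (1 / (1 + \<beta> j)) ^ n)"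
  proof (rule suminf_nonneg)
    show "summable (\<lambda>n. pochhammer (\<delta> * real m) n / pochhammer (\<delta> * real (Suc m) + 1) n * (1 / (1 + \<beta> j)) ^ n)"
      using \<delta> \<beta> by (intro incomplete_beta_series(1)) (auto intro: mult_left_mono)
    show "0 \<le> pochhammer (\<delta> * real m) n / pochhammer (\<delta> * real (Suc m) + 1) n * (1 / (1 + \<beta> j)) ^ n" for n
      using \<delta> \<beta> unfolding pochhammer_prod
      by (intro mult_nonneg_nonneg divide_nonneg_nonneg prod_nonneg zero_le_power) auto
  qed
  then show "0 \<le> strong_series j m" by (simp add: strong_series_def del: of_nat_Suc)
  have "ennreal (strong_series j m / real (Suc m)) =
      (\<integral>\<^sup>+s. ennreal ((s + 1) powr - (\<delta> * real m)) * indicator {\<beta> j * 1..} s \<partial>power_intensity \<delta>)"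
    by (simp add: strong_series_nn_integral[OF j zero_less_one] del: of_nat_Suc mult_1_right)
  also have "\<dots> \<le> (\<integral>\<^sup>+s. indicator {\<beta> j..} s \<partial>power_intensity \<delta>)"
  proof (rule nn_integral_mono)
    fix s :: real
    show "ennreal ((s + 1) powr - (\<delta> * real m)) * indicator {\<beta> j * 1..} s \<le> indicator {\<beta> j..} s"
    proof (cases "\<beta> j \<le> s")
      case True
      then have "(s + 1) powr - (\<delta> * real m) \<le> (s + 1) powr 0"
        using \<beta> \<delta> by (intro powr_mono) auto
      also have "(s + 1) powr 0 = 1" using True \<beta> by simp
      finally show ?thesis using True by simp
    qed simp
  qed
  also have "\<dots> = ennreal (\<beta> j powr - \<delta>)"
    using emeasure_power_intensity(2)[OF \<delta>(1) \<beta>] by simp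
  finally show "strong_series j m \<le> real (Suc m) * \<beta> j powr - \<delta>"
    by (simp add: divide_le_eq mult.commute del: of_nat_Suc)
qed

text \<open>Counts the active stations of tier \<open>j\<close> that reach their threshold against
  the power of all other active stations. The inequality is cleared of its denominator, so a
  vanishing remainder needs no convention.\<close>

definition strong_count :: "nat \<Rightarrow> 'w \<Rightarrow> ennreal" where
  "strong_count j \<omega> = (\<Sum>n. of_bool (act j n \<omega> \<and> 0 < rx_power j n \<omega> \<and>
    \<beta> j * (interference_real \<omega> - rx_power j n \<omega>) \<le> rx_power j n \<omega>))"

lemma SUP_indicator_Suc: "(SUP k. indicator {1 / real (Suc k)<..} s) = (indicator {0<..} s :: ennreal)"
proof (cases "0 < s")
  case True
  then obtain k where "1 / real (Suc k) < s" using nat_approx_posE[of s] by auto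
  then have "(1 :: ennreal) \<le> (SUP k. indicator {1 / real (Suc k)<..} s)"
    by (intro SUP_upper2[of k]) auto
  moreover have "(SUP k. indicator {1 / real (Suc k)<..} s) \<le> (1 :: ennreal)"
    by (intro SUP_least) (auto simp: indicator_def)
  ultimately show ?thesis using True by simp
next
  case False
  then have "indicator {1 / real (Suc k)<..} s = (0 :: ennreal)" for k
    by (auto simp: indicator_def not_less intro: order_trans simp del: of_nat_Suc)
  then show ?thesis using False by simp
qed

lemma incseq_indicator_Suc: "k \<le> l \<Longrightarrow> indicator {1 / real (Suc k)<..} s \<le> (indicator {1 / real (Suc l)<..} s :: ennreal)"
proof -
  assume "k \<le> l"
  then have "1 / real (Suc l) \<le> 1 / real (Suc k)" by (intro divide_left_mono) auto
  then show ?thesis by (auto simp: indicator_def simp del: of_nat_Suc)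
qed

text \<open>In the Palm formula the interference becomes \<open>s\<close> plus a fresh copy, so the
  strength condition turns into \<open>s \<ge> \<beta> j\<close> times that copy, and the idle event
  into a void probability at the sum. The formula needs a positive cut-off; the levels
  \<open>1 / (k + 1)\<close> are removed by monotone convergence.\<close>

lemma strong_count_expectation:
  assumes j: "j \<in> {1..K}"
  shows "(\<integral>\<^sup>+\<omega>. strong_count j \<omega> * of_bool (scaled_idle_max_real \<omega> < interference_real \<omega>) \<partial>M) =
    ennreal (intensity j True) * (\<integral>\<^sup>+s. (\<integral>\<^sup>+\<omega>. ennreal (idle_void (s + interference_real \<omega>)) *
      indicator {\<beta> j * interference_real \<omega>..} s \<partial>M) \<partial>power_intensity \<delta>)"
proof -
  note [measurable] = rx_power_measurable[OF j] act_pred[OF j]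
  let ?I = interference_real and ?D = scaled_idle_max_real and ?s = "rx_power j" and ?ci = "\<lambda>k. indicator {1 / real (Suc k)<..} :: real \<Rightarrow> ennreal"
  let ?A = "{z :: real \<times> real \<times> real. \<beta> j * (fst (snd z) - fst z) \<le> fst z} \<inter> {z. snd (snd z) < fst (snd z)}"
  define g :: "real \<times> real \<times> real \<Rightarrow> ennreal" where "g = indicator ?A"
  have "?A \<in> sets borel"
    by (intro sets.Int borel_open[OF open_Collect_less] borel_closed[OF closed_Collect_le]) (auto intro!: continuous_intros)
  then have g_meas [measurable]: "g \<in> borel_measurable borel" by (simp add: g_def)
  let ?W = "\<lambda>n \<omega>. if act j n \<omega> then g (?s n \<omega>, ?I \<omega>, ?D \<omega>) else 0"
  have "(\<integral>\<^sup>+\<omega>. strong_count j \<omega> * of_bool (?D \<omega> < ?I \<omega>) \<partial>M) =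
      (\<integral>\<^sup>+\<omega>. (SUP k. \<Sum>n. ?ci k (?s n \<omega>) * ?W n \<omega>) \<partial>M)"
  proof (rule nn_integral_cong)
    fix \<omega>
    have "strong_count j \<omega> * of_bool (?D \<omega> < ?I \<omega>) = (\<Sum>n. (SUP k. ?ci k (?s n \<omega>)) * ?W n \<omega>)"
    proof -
      have "of_bool (act j n \<omega> \<and> 0 < ?s n \<omega> \<and> \<beta> j * (?I \<omega> - ?s n \<omega>) \<le> ?s n \<omega>) * of_bool (?D \<omega> < ?I \<omega>) =
          indicator {0<..} (?s n \<omega>) * ?W n \<omega>" for n
        by (auto simp: g_def indicator_def)
      then show ?thesis
        unfolding SUP_indicator_Suc strong_count_def ennreal_suminf_multc[symmetric] by (simp only:)
    qed
    also have "\<dots> = (\<integral>\<^sup>+n. (SUP k. ?ci k (?s n \<omega>) * ?W n \<omega>) \<partial>count_space UNIV)"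
      by (simp add: nn_integral_count_space_nat SUP_mult_right_ennreal)
    also have "\<dots> = (SUP k. \<integral>\<^sup>+n. ?ci k (?s n \<omega>) * ?W n \<omega> \<partial>count_space UNIV)"
      by (intro nn_integral_monotone_convergence_SUP)
        (auto simp: incseq_def le_fun_def intro!: mult_right_mono incseq_indicator_Suc simp del: of_nat_Suc)
    finally show "strong_count j \<omega> * of_bool (?D \<omega> < ?I \<omega>) = (SUP k. \<Sum>n. ?ci k (?s n \<omega>) * ?W n \<omega>)"
      by (simp add: nn_integral_count_space_nat)
  qed
  also have "\<dots> = (SUP k. \<integral>\<^sup>+\<omega>. (\<Sum>n. ?ci k (?s n \<omega>) * ?W n \<omega>) \<partial>M)"
  proof (rule nn_integral_monotone_convergence_SUP)
    show "incseq (\<lambda>k \<omega>. \<Sum>n. ?ci k (?s n \<omega>) * ?W n \<omega>)"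
      unfolding incseq_def le_fun_def
      by (intro allI impI suminf_le mult_right_mono incseq_indicator_Suc) auto
  qed measurable
  also have "\<dots> = (SUP k. \<integral>\<^sup>+s. ?ci k s * (ennreal (intensity j True) *
      (\<integral>\<^sup>+\<omega>. (\<integral>\<^sup>+\<omega>'. g (s, s + ?I \<omega>, ?D \<omega>') \<partial>M) \<partial>M)) \<partial>power_intensity \<delta>)"
  proof (rule SUP_cong)
    fix k :: nat
    have "(\<integral>\<^sup>+\<omega>. (\<Sum>n. ?ci k (?s n \<omega>) * ?W n \<omega>) \<partial>M) =
        (\<integral>\<^sup>+\<omega>. (\<Sum>n. if act j n \<omega> \<and> 1 / real (Suc k) < ?s n \<omega> then g (?s n \<omega>, ?I \<omega>, ?D \<omega>) else 0) \<partial>M)"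
      by (intro nn_integral_cong suminf_cong) (auto simp: indicator_def simp del: of_nat_Suc)
    also have "\<dots> = (\<integral>\<^sup>+s. ennreal (intensity j True) * ?ci k s *
        (\<integral>\<^sup>+\<omega>. (\<integral>\<^sup>+\<omega>'. g (s, s + ?I \<omega>, ?D \<omega>') \<partial>M) \<partial>M) \<partial>power_intensity \<delta>)"
      by (rule palm_formula[OF j _ g_meas]) simp
    finally show "(\<integral>\<^sup>+\<omega>. (\<Sum>n. ?ci k (?s n \<omega>) * ?W n \<omega>) \<partial>M) = (\<integral>\<^sup>+s. ?ci k s * (ennreal (intensity j True) *
      (\<integral>\<^sup>+\<omega>. (\<integral>\<^sup>+\<omega>'. g (s, s + ?I \<omega>, ?D \<omega>') \<partial>M) \<partial>M)) \<partial>power_intensity \<delta>)"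
      by (simp only: mult_ac)
  qed simp
  also have "\<dots> = (\<integral>\<^sup>+s. (SUP k. ?ci k s * (ennreal (intensity j True) *
      (\<integral>\<^sup>+\<omega>. (\<integral>\<^sup>+\<omega>'. g (s, s + ?I \<omega>, ?D \<omega>') \<partial>M) \<partial>M))) \<partial>power_intensity \<delta>)"
  proof (rule nn_integral_monotone_convergence_SUP[symmetric])
    show "incseq (\<lambda>k s. ?ci k s * (ennreal (intensity j True) *
      (\<integral>\<^sup>+\<omega>. (\<integral>\<^sup>+\<omega>'. g (s, s + ?I \<omega>, ?D \<omega>') \<partial>M) \<partial>M)))"
      unfolding incseq_def le_fun_def by (intro allI impI mult_right_mono incseq_indicator_Suc) auto
  qed measurable
  also have "\<dots> = (\<integral>\<^sup>+s. ennreal (intensity j True) * (\<integral>\<^sup>+\<omega>. ennreal (idle_void (s + ?I \<omega>)) *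
      indicator {\<beta> j * ?I \<omega>..} s \<partial>M) \<partial>power_intensity \<delta>)"
  proof (rule nn_integral_cong_AE, use AE_power_intensity_pos[of \<delta>] in eventually_elim)
    case (elim s)
    have "(\<integral>\<^sup>+\<omega>. (\<integral>\<^sup>+\<omega>'. g (s, s + ?I \<omega>, ?D \<omega>') \<partial>M) \<partial>M) =
        (\<integral>\<^sup>+\<omega>. ennreal (idle_void (s + ?I \<omega>)) * indicator {\<beta> j * ?I \<omega>..} s \<partial>M)"
    proof (rule nn_integral_cong)
      fix \<omega>
      have "(\<integral>\<^sup>+\<omega>'. g (s, s + ?I \<omega>, ?D \<omega>') \<partial>M) =
          (\<integral>\<^sup>+\<omega>'. indicator {\<beta> j * ?I \<omega>..} s * indicator {..<s + ?I \<omega>} (?D \<omega>') \<partial>M)"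
        by (intro nn_integral_cong) (auto simp: g_def indicator_def)
      also have "\<dots> = indicator {\<beta> j * ?I \<omega>..} s * ennreal (idle_void (s + ?I \<omega>))"
        using elim by (subst nn_integral_cmult) (simp_all add: nn_idle_strict_cdf add_pos_nonneg)
      finally show "(\<integral>\<^sup>+\<omega>'. g (s, s + ?I \<omega>, ?D \<omega>') \<partial>M) = ennreal (idle_void (s + ?I \<omega>)) * indicator {\<beta> j * ?I \<omega>..} s"
        by (simp only: mult.commute)
    qed
    then show ?case
      unfolding SUP_mult_right_ennreal[symmetric] SUP_indicator_Suc using elim by simp
  qed
  also have "\<dots> = ennreal (intensity j True) * (\<integral>\<^sup>+s. (\<integral>\<^sup>+\<omega>. ennreal (idle_void (s + ?I \<omega>)) *
      indicator {\<beta> j * ?I \<omega>..} s \<partial>M) \<partial>power_intensity \<delta>)"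
  proof (rule nn_integral_cmult)
    have "(\<lambda>s. \<integral>\<^sup>+\<omega>. ennreal (idle_void (s + ?I \<omega>)) * (if \<beta> j * ?I \<omega> \<le> s then 1 else 0) \<partial>M) \<in> borel_measurable (power_intensity \<delta>)"
      by measurable
    then show "(\<lambda>s. \<integral>\<^sup>+\<omega>. ennreal (idle_void (s + ?I \<omega>)) * indicator {\<beta> j * ?I \<omega>..} s \<partial>M) \<in> borel_measurable (power_intensity \<delta>)"
      by (simp add: indicator_def of_bool_def)
  qed
  finally show ?thesis .
qed

text \<open>The exponential series of \<open>idle_void\<close> is integrated termwise over the
  product of the power intensity and \<open>M\<close>. Each term is a negative moment of order
  \<open>\<delta> * (m + 1)\<close>: the extra \<open>\<delta>\<close> comes from integrating out
  the power \<open>s\<close>. The growth \<open>m + 1\<close> of \<open>strong_series\<close> is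
  absorbed by the second part of \<open>summable_power_over_Gamma\<close>.\<close>

lemma strong_count_series:
  assumes j: "j \<in> {1..K}"
  shows "(\<lambda>m. intensity j True * ((- idle_rate) ^ m / (Gamma (1 + \<delta> * real (Suc m)) * stable_rate ^ Suc m) * strong_series j m)) sums
    enn2real (\<integral>\<^sup>+\<omega>. strong_count j \<omega> * of_bool (scaled_idle_max_real \<omega> < interference_real \<omega>) \<partial>M)"
proof -
  interpret L: sigma_finite_measure "power_intensity \<delta>" by (rule sigma_finite_power_intensity)
  interpret LM: pair_sigma_finite "power_intensity \<delta>" M ..
  let ?I = interference_real
  let ?LM = "power_intensity \<delta> \<Otimes>\<^sub>M M"
  define q where "q m z = (fst z + ?I (snd z)) powr - (\<delta> * real m) * (if \<beta> j * ?I (snd z) \<le> fst z then 1 else 0)" for m z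
  have q_nonneg: "0 \<le> q m z" for m z by (simp add: q_def)
  have q_meas [measurable]: "q m \<in> borel_measurable ?LM" for m unfolding q_def by measurable
  let ?G = "\<lambda>m. Gamma (1 + \<delta> * real (Suc m)) * stable_rate ^ Suc m"
  have G: "0 < ?G m" for m
    using \<delta> stable_rate_pos by (intro mult_pos_pos zero_less_power Gamma_real_pos) (auto simp: add_pos_nonneg)
  let ?c = "\<lambda>m. fact (Suc m) / ?G m * (strong_series j m / real (Suc m))"
  have c_nonneg: "0 \<le> ?c m" for m
    using strong_series_bounds(1)[OF j, of m]
    by (intro mult_nonneg_nonneg[OF divide_nonneg_pos[OF _ G] divide_nonneg_pos]) auto
  have nn_q: "(\<integral>\<^sup>+z. ennreal (q m z) \<partial>?LM) = ennreal (?c m)" for m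
  proof -
    have "(\<integral>\<^sup>+z. ennreal (q m z) \<partial>?LM) = (\<integral>\<^sup>+\<omega>. (\<integral>\<^sup>+s. ennreal (q m (s, \<omega>)) \<partial>power_intensity \<delta>) \<partial>M)"
      by (rule LM.nn_integral_snd[symmetric]) measurable
    also have "\<dots> = (\<integral>\<^sup>+\<omega>. ennreal (?I \<omega> powr - (\<delta> * real (Suc m))) * ennreal (strong_series j m / real (Suc m)) \<partial>M)"
    proof (rule nn_integral_cong_AE, use AE_interference_real in eventually_elim)
      case (elim \<omega>)
      then have x: "0 < ?I \<omega>" by simp
      show ?case
        unfolding strong_series_nn_integral[OF j x, symmetric]
        by (intro nn_integral_cong) (auto simp: q_def indicator_def)
    qed
    also have "\<dots> = ennreal (fact (Suc m) / ?G m) * ennreal (strong_series j m / real (Suc m))"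
      by (subst nn_integral_multc) (simp_all only: negative_moment, measurable)
    also have "\<dots> = ennreal (?c m)"
      using G[of m] by (intro ennreal_mult'[symmetric] divide_nonneg_pos) auto
    finally show ?thesis .
  qed
  have q_int: "integrable ?LM (q m)" for m
    by (rule integrableI_nonneg) (auto simp: q_nonneg nn_q)
  have q_E: "(\<integral>z. q m z \<partial>?LM) = ?c m" for m
    using c_nonneg[of m] by (subst integral_eq_nn_integral) (auto simp: q_nonneg nn_q simp del: of_nat_Suc fact_Suc)
  \<comment> \<open>The factors \<open>(m + 1)!\<close>, \<open>1 / (m + 1)\<close> and
    \<open>1 / m!\<close> multiply to 1.\<close>
  have eq: "?c m * (r ^ m / fact m) = r ^ m / ?G m * strong_series j m" for m r
    by (simp add: fact_Suc del: of_nat_Suc)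
  let ?f = "\<lambda>m z. q m z * ((- idle_rate) ^ m / fact m)"
  have s1: "(\<lambda>m. \<integral>z. ?f m z \<partial>?LM) sums (\<integral>z. (\<Sum>m. ?f m z) \<partial>?LM)"
  proof (rule sums_integral)
    show "integrable ?LM (?f m)" for m using q_int by (rule integrable_mult_left)
    show "AE z in ?LM. summable (\<lambda>m. norm (?f m z))"
    proof (rule AE_I2)
      fix z
      let ?y = "fst z + ?I (snd z)"
      show "summable (\<lambda>m. norm (?f m z))"
      proof (rule summable_comparison_test)
        show "summable (\<lambda>m. norm ((idle_rate * ?y powr - \<delta>) ^ m /\<^sub>R fact m))"
          by (rule summable_norm_exp)
        have pos: "norm (norm (?f m z)) \<le> norm ((idle_rate * ?y powr - \<delta>) ^ m /\<^sub>R fact m)" if "0 < ?y" for m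
        proof -
          have "?y powr - (\<delta> * real m) = (?y powr - \<delta>) ^ m"
            using that by (simp add: powr_powr flip: powr_realpow)
          then show ?thesis by (simp add: q_def abs_mult power_abs power_mult_distrib divide_inverse)
        qed
        \<comment> \<open>At \<open>?y = 0\<close> a power of 0 is 0; \<open>?y < 0\<close> forces
          \<open>fst z < 0\<close>, which lies below the threshold, so the indicator in
          \<open>q\<close> vanishes.\<close>
        have neg: "norm (?f m z) = 0" if "\<not> 0 < ?y" for m
        proof (cases "?y = 0")
          case False
          with that have "?y < 0" by simp
          then have "fst z < 0" using interference_real_nonneg[of "snd z"] by linarith
          moreover have "0 \<le> \<beta> j * ?I (snd z)" using \<beta>_gt_1[OF j] by simp
          ultimately show ?thesis by (simp add: q_def)
        qed (simp add: q_def)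
        have "norm (norm (?f m z)) \<le> norm ((idle_rate * ?y powr - \<delta>) ^ m /\<^sub>R fact m)" for m
        proof (cases "0 < ?y")
          case False
          show ?thesis unfolding neg[OF False] by simp
        qed (rule pos)
        then show "\<exists>N. \<forall>m\<ge>N. norm (norm (?f m z)) \<le> norm ((idle_rate * ?y powr - \<delta>) ^ m /\<^sub>R fact m)"
          by blast
      qed
    qed
    have "(\<integral>z. norm (?f m z) \<partial>?LM) = idle_rate ^ m / ?G m * strong_series j m" for m
    proof -
      have "(\<integral>z. norm (?f m z) \<partial>?LM) = (\<integral>z. q m z * (idle_rate ^ m / fact m) \<partial>?LM)"
        using idle_rate_nonneg q_nonneg by (intro Bochner_Integration.integral_cong) (auto simp: abs_mult power_abs)
      also have "\<dots> = ?c m * (idle_rate ^ m / fact m)"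
        by (subst integral_mult_left_zero) (simp only: q_E)
      finally show ?thesis unfolding eq .
    qed
    moreover have "summable (\<lambda>m. idle_rate ^ m / ?G m * strong_series j m)"
    proof (rule summable_comparison_test)
      let ?x = "idle_rate / stable_rate"
      show "summable (\<lambda>m. \<beta> j powr - \<delta> / stable_rate * (real (Suc m) * ?x ^ m / Gamma (1 + \<delta> * real (Suc m))))"
        using idle_rate_nonneg stable_rate_pos by (intro summable_mult summable_power_over_Gamma(2) \<delta>(1)) simp
      have "norm (idle_rate ^ m / ?G m * strong_series j m) \<le> \<beta> j powr - \<delta> / stable_rate * (real (Suc m) * ?x ^ m / Gamma (1 + \<delta> * real (Suc m)))" for m
      proof -
        have nn: "0 \<le> idle_rate ^ m / ?G m" using idle_rate_nonneg G[of m] by (intro divide_nonneg_pos) auto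
        have "norm (idle_rate ^ m / ?G m * strong_series j m) = idle_rate ^ m / ?G m * strong_series j m"
          using mult_nonneg_nonneg[OF nn strong_series_bounds(1)[OF j]] by (simp only: real_norm_def abs_of_nonneg)
        also have "\<dots> \<le> idle_rate ^ m / ?G m * (real (Suc m) * \<beta> j powr - \<delta>)"
          using nn by (intro mult_left_mono strong_series_bounds(2)[OF j])
        also have "\<dots> = \<beta> j powr - \<delta> / stable_rate * (real (Suc m) * ?x ^ m / Gamma (1 + \<delta> * real (Suc m)))"
          by (simp add: power_divide ac_simps del: of_nat_Suc)
        finally show ?thesis .
      qed
      then show "\<exists>N. \<forall>m\<ge>N. norm (idle_rate ^ m / ?G m * strong_series j m) \<le>
          \<beta> j powr - \<delta> / stable_rate * (real (Suc m) * ?x ^ m / Gamma (1 + \<delta> * real (Suc m)))" by blast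
    qed
    ultimately show "summable (\<lambda>m. \<integral>z. norm (?f m z) \<partial>?LM)" by (simp only:)
  qed
  have s2: "(\<integral>z. ?f m z \<partial>?LM) = (- idle_rate) ^ m / ?G m * strong_series j m" for m
    by (subst integral_mult_left_zero) (simp only: q_E eq)
  have s3: "(\<integral>z. (\<Sum>m. ?f m z) \<partial>?LM) = (\<integral>z. idle_void (fst z + ?I (snd z)) * (if \<beta> j * ?I (snd z) \<le> fst z then 1 else 0) \<partial>?LM)"
  proof (rule integral_cong_AE)
    have "AE s in power_intensity \<delta>. AE \<omega> in M. 0 < s"
      using AE_power_intensity_pos[of \<delta>] by eventually_elim simp
    moreover have "{z \<in> space ?LM. 0 < fst z} \<in> sets ?LM" by measurable
    ultimately have "AE z in ?LM. 0 < fst z"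
      by (intro LM.AE_pair_measure) auto
    then show "AE z in ?LM. (\<Sum>m. ?f m z) = idle_void (fst z + ?I (snd z)) * (if \<beta> j * ?I (snd z) \<le> fst z then 1 else 0)"
    proof eventually_elim
      case (elim z)
      let ?y = "fst z + ?I (snd z)"
      have "0 < ?y" using elim interference_real_nonneg[of "snd z"] by linarith
      from sums_mult2[OF idle_void_series[OF this], of "if \<beta> j * ?I (snd z) \<le> fst z then 1 else 0"]
      have "(\<lambda>m. ?f m z) sums (idle_void ?y * (if \<beta> j * ?I (snd z) \<le> fst z then 1 else 0))"
        by (simp add: q_def mult_ac)
      then show ?case by (rule sums_unique[symmetric])
    qed
  qed measurable
  have s4: "intensity j True * (\<integral>z. idle_void (fst z + ?I (snd z)) * (if \<beta> j * ?I (snd z) \<le> fst z then 1 else 0) \<partial>?LM) =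
      enn2real (\<integral>\<^sup>+\<omega>. strong_count j \<omega> * of_bool (scaled_idle_max_real \<omega> < interference_real \<omega>) \<partial>M)"
  proof -
    have "(\<integral>z. idle_void (fst z + ?I (snd z)) * (if \<beta> j * ?I (snd z) \<le> fst z then 1 else 0) \<partial>?LM) =
        enn2real (\<integral>\<^sup>+z. ennreal (idle_void (fst z + ?I (snd z)) * (if \<beta> j * ?I (snd z) \<le> fst z then 1 else 0)) \<partial>?LM)"
      by (rule integral_eq_nn_integral) (auto simp: idle_void_def)
    also have "(\<integral>\<^sup>+z. ennreal (idle_void (fst z + ?I (snd z)) * (if \<beta> j * ?I (snd z) \<le> fst z then 1 else 0)) \<partial>?LM) =
        (\<integral>\<^sup>+s. (\<integral>\<^sup>+\<omega>. ennreal (idle_void (s + ?I \<omega>) * (if \<beta> j * ?I \<omega> \<le> s then 1 else 0)) \<partial>M) \<partial>power_intensity \<delta>)"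
      by (subst nn_integral_fst[symmetric]) auto
    also have "\<dots> = (\<integral>\<^sup>+s. (\<integral>\<^sup>+\<omega>. ennreal (idle_void (s + ?I \<omega>)) * indicator {\<beta> j * ?I \<omega>..} s \<partial>M) \<partial>power_intensity \<delta>)"
      by (intro nn_integral_cong) (auto simp: indicator_def)
    finally show ?thesis
      unfolding strong_count_expectation[OF j] enn2real_mult using intensity_nonneg[OF j] by simp
  qed
  show ?thesis
    using sums_mult[OF s1, of "intensity j True"] unfolding s2 s3 s4 .
qed

end

section \<open>Coverage by a unique strongest station\<close>

text \<open>The terms of a convergent series tend to 0, so only finitely many exceed a positive
  level below the supremum, which is therefore a maximum.\<close>

lemma ennreal_SUP_attained:
  fixes f :: "nat \<Rightarrow> ennreal"
  assumes fin: "(\<Sum>n. f n) < \<top>" and pos: "0 < (SUP n. f n)"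
  obtains n where "f n = (SUP n. f n)"
proof (rule ccontr)
  let ?s = "SUP n. f n"
  assume "\<not> thesis"
  then have less: "f n < ?s" for n
    using that SUP_upper[of n UNIV f] by (metis UNIV_I order_le_imp_less_or_eq)
  obtain t where t: "0 < t" "t < ?s" using dense[OF pos] by blast
  have "f \<longlonglongrightarrow> 0"
  proof -
    have f_top: "f n < \<top>" for n
      using fin sum_le_suminf[of f "{n}"] by (simp add: le_less_trans)
    define g where "g n = enn2real (f n)" for n
    have g: "f n = ennreal (g n)" "0 \<le> g n" for n using f_top[of n] by (simp_all add: g_def)
    have "(\<Sum>n. ennreal (g n)) \<noteq> \<top>"
      using fin by (simp add: g(1)[symmetric])
    then have "summable g"
      using g(2) by (intro summable_suminf_not_top)
    then have "g \<longlonglongrightarrow> 0" by (rule summable_LIMSEQ_zero)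
    then have "(\<lambda>n. ennreal (g n)) \<longlonglongrightarrow> ennreal 0" by (rule tendsto_ennrealI)
    then show ?thesis by (simp add: g(1)[symmetric])
  qed
  then have "\<forall>\<^sub>F n in sequentially. f n < t" using t(1) by (rule order_tendstoD)
  then obtain N where N: "f n < t" if "n \<ge> N" for n by (auto simp: eventually_sequentially)
  let ?m = "Max (insert t (f ` {..<N}))"
  have "?m < ?s" using t less by (subst Max_less_iff) auto
  moreover have "?s \<le> ?m"
  proof (rule SUP_least)
    fix n show "f n \<le> ?m"
    proof (cases "n < N")
      case False
      then have "f n \<le> t" using N[of n] by simp
      also have "t \<le> ?m" by simp
      finally show ?thesis .
    qed simp
  qed
  ultimately show False by (meson not_le)
qed

text \<open>Since every threshold exceeds 1, a station that beats its threshold against the sum of all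
  others is the unique strongest one, and only a strongest station can do so.\<close>

lemma strong_station_unique:
  fixes R :: "nat \<Rightarrow> nat \<Rightarrow> ennreal" and \<beta> :: "nat \<Rightarrow> real"
  assumes J: "finite J" "J \<noteq> {}"
    and I_def: "I = (\<Sum>i\<in>J. \<Sum>n. R i n)" and I: "0 < I" "I < \<top>"
    and \<beta>: "\<And>i. i \<in> J \<Longrightarrow> 1 < \<beta> i"
  shows "(\<Sum>i\<in>J. \<Sum>n. of_bool (0 < R i n \<and> ennreal (\<beta> i) * (I - R i n) \<le> R i n)) +
    of_bool (\<forall>i\<in>J. (SUP n. R i n) / (I - (MAX i\<in>J. SUP n. R i n)) < ennreal (\<beta> i)) = (1 :: ennreal)"
proof -
  define m where "m i = (SUP n. R i n)" for i
  define Mx where "Mx = (MAX i\<in>J. m i)"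
  let ?C = "\<lambda>i n. 0 < R i n \<and> ennreal (\<beta> i) * (I - R i n) \<le> R i n"
  have tier_le: "(\<Sum>n. R i n) \<le> I" if "i \<in> J" for i
    unfolding I_def using J that by (intro member_le_sum) auto
  have R_le: "R i n \<le> I" if "i \<in> J" for i n
    using sum_le_suminf[of "R i" "{n}"] tier_le[OF that] by (auto intro: order_trans)
  have pair_le: "R i n + R i' n' \<le> I" if "i \<in> J" "i' \<in> J" "(i, n) \<noteq> (i', n')" for i n i' n'
  proof (cases "i = i'")
    case True
    then have "R i n + R i' n' = (\<Sum>k\<in>{n, n'}. R i k)" using that by simp
    also have "\<dots> \<le> (\<Sum>k. R i k)" by (intro sum_le_suminf) auto
    finally show ?thesis using tier_le[OF that(1)] by simp
  next
    case False
    have "R i n + R i' n' \<le> (\<Sum>k. R i k) + (\<Sum>k. R i' k)"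
      using sum_le_suminf[of "R i" "{n}"] sum_le_suminf[of "R i'" "{n'}"] by (intro add_mono) auto
    also have "\<dots> = (\<Sum>j\<in>{i, i'}. \<Sum>k. R j k)" using False by simp
    also have "\<dots> \<le> I" unfolding I_def using J that by (intro sum_mono2) auto
    finally show ?thesis .
  qed
  have fin: "R i n < \<top>" if "i \<in> J" for i n using R_le[OF that, of n] I by simp
  \<comment> \<open>A rival at least as powerful is itself part of \<open>I - R i n\<close>. Then
    \<open>\<beta> i * R i n \<le> R i n\<close>, impossible for a positive finite power and
    \<open>\<beta> i > 1\<close>.\<close>
  have strict: "R i' n' < R i n" if "i \<in> J" "i' \<in> J" "(i, n) \<noteq> (i', n')" "?C i n" for i n i' n'
  proof (rule ccontr)
    assume "\<not> R i' n' < R i n"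
    then have "R i n \<le> R i' n'" by simp
    also have "R i' n' \<le> I - R i n"
      using pair_le[OF that(1-3)] fin[OF that(1), of n] by (simp add: ennreal_le_minus_iff add.commute)
    finally have "ennreal (\<beta> i) * R i n \<le> ennreal (\<beta> i) * (I - R i n)" by (rule mult_left_mono) simp
    also have "\<dots> \<le> R i n" using that(4) by simp
    finally have le: "ennreal (\<beta> i) * R i n \<le> R i n" .
    have "R i n < \<top>" using fin[OF that(1)] .
    then obtain r where r: "R i n = ennreal r" "0 \<le> r" by (cases "R i n") auto
    with that(4) have "0 < r" by simp
    then have "r < \<beta> i * r" using \<beta>[OF that(1)] by simp
    with le r \<beta>[OF that(1)] show False by (simp add: ennreal_le_iff flip: ennreal_mult)
  qed
  have m_le: "m i \<le> Mx" if "i \<in> J" for i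
    unfolding Mx_def using J that by (intro Max_ge) auto
  have "Mx \<in> m ` J" unfolding Mx_def using J by (intro Max_in) auto
  then obtain i0 where i0: "i0 \<in> J" "m i0 = Mx" by auto
  have "0 < Mx"
  proof (rule ccontr)
    assume "\<not> 0 < Mx"
    then have "R i n = 0" if "i \<in> J" for i n
      using m_le[OF that] SUP_upper[of n UNIV "R i"] by (simp add: m_def)
    then have "I = 0" by (simp add: I_def)
    with I show False by simp
  qed
  then obtain n0 where n0: "R i0 n0 = Mx"
    using ennreal_SUP_attained[of "R i0"] i0 tier_le[OF i0(1)] I
    by (metis le_less_trans m_def)
  have Mx_fin: "Mx < \<top>" using fin[OF i0(1), of n0] n0 by simp
  show ?thesis
  proof (cases "\<exists>i\<in>J. \<exists>n. ?C i n")
    case True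
    then obtain i n where i: "i \<in> J" and C: "?C i n" by blast
    \<comment> \<open>Two strong stations would each be strictly more powerful than the
      other.\<close>
    have only: "\<not> ?C i' n'" if "i' \<in> J" "(i', n') \<noteq> (i, n)" for i' n'
    proof
      assume C': "?C i' n'"
      have "R i' n' < R i n" "R i n < R i' n'"
        using strict[OF i that(1) _ C] strict[OF that(1) i _ C'] that(2) by auto
      then show False by simp
    qed
    have "(\<Sum>i'\<in>J. \<Sum>n'. of_bool (?C i' n')) = (\<Sum>i'\<in>J. \<Sum>n'. of_bool (i' = i \<and> n' = n) :: ennreal)"
    proof (intro sum.cong suminf_cong refl)
      fix i' n' assume i': "i' \<in> J"
      have "?C i' n' \<longleftrightarrow> i' = i \<and> n' = n"
        using C only[OF i', of n'] by (cases "i' = i \<and> n' = n") auto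
      then show "of_bool (?C i' n') = (of_bool (i' = i \<and> n' = n) :: ennreal)" by (simp only:)
    qed
    also have "\<dots> = (\<Sum>i'\<in>{i}. \<Sum>n'. of_bool (i' = i \<and> n' = n))"
      using J i by (intro sum.mono_neutral_right) auto
    also have "\<dots> = (\<Sum>n'. of_bool (n' = n))" by simp
    also have "\<dots> = (\<Sum>n'\<in>{n}. of_bool (n' = n))" by (intro suminf_finite) auto
    finally have 1: "(\<Sum>i'\<in>J. \<Sum>n'. of_bool (?C i' n')) = (1 :: ennreal)" by simp
    have "R i' n' \<le> R i n" if "i' \<in> J" for i' n'
      using strict[OF i that _ C, of n'] by (cases "(i, n) = (i', n')") auto
    then have "Mx \<le> R i n"
      using n0 i0 by metis
    moreover have "R i n \<le> m i" unfolding m_def by (rule SUP_upper) simp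
    ultimately have eq: "m i = Mx" "R i n = Mx" using m_le[OF i] by auto
    have "\<not> m i / (I - Mx) < ennreal (\<beta> i)"
    \<comment> \<open>If the rest carries no power, the quotient is
      \<open>Mx / 0 = \<infinity>\<close> and the strict bound fails, in agreement with the station
      being strong.\<close>
    proof (cases "I - Mx = 0")
      case True
      have "Mx \<noteq> 0" using \<open>0 < Mx\<close> by (simp add: zero_less_iff_neq_zero)
      with True show ?thesis using eq by simp
    next
      case False
      obtain a d where a: "Mx = ennreal a" "0 \<le> a" and d: "I - Mx = ennreal d" "0 \<le> d"
        using Mx_fin I by (cases Mx; cases "I - Mx") (auto simp: ennreal_minus_eq_top)
      with False have "0 < d" by (cases "d = 0") auto
      have "ennreal (\<beta> i) * ennreal d \<le> ennreal a" using C eq a d by simp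
      then have "\<beta> i * d \<le> a" using \<beta>[OF i] a d by (simp flip: ennreal_mult)
      then have "\<beta> i \<le> a / d" using \<open>0 < d\<close> by (simp add: le_divide_eq)
      then show ?thesis
        using a d \<open>0 < d\<close> eq \<beta>[OF i] by (simp add: divide_ennreal not_less ennreal_leI)
    qed
    then have "\<not> (\<forall>i\<in>J. m i / (I - Mx) < ennreal (\<beta> i))" using i by blast
    then show ?thesis using 1 by (simp add: m_def[symmetric] Mx_def[symmetric])
  next
    case False
    then have "(\<Sum>i'\<in>J. \<Sum>n'. of_bool (?C i' n')) = (\<Sum>i'\<in>J. \<Sum>n'. 0 :: ennreal)"
      by (intro sum.cong suminf_cong) auto
    then have 0: "(\<Sum>i'\<in>J. \<Sum>n'. of_bool (?C i' n')) = (0 :: ennreal)" by simp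
    have "m i / (I - Mx) < ennreal (\<beta> i)" if i: "i \<in> J" for i
    proof (cases "i = i0")
      case True
      have "\<not> ?C i0 n0" using False i0 by blast
      then have less: "Mx < ennreal (\<beta> i0) * (I - Mx)" using n0 \<open>0 < Mx\<close> by simp
      then have nz: "I - Mx \<noteq> 0" by auto
      obtain a d where a: "Mx = ennreal a" "0 \<le> a" and d: "I - Mx = ennreal d" "0 \<le> d"
        using Mx_fin I by (cases Mx; cases "I - Mx") (auto simp: ennreal_minus_eq_top)
      with nz have "0 < d" by (cases "d = 0") auto
      have "ennreal a < ennreal (\<beta> i0 * d)" using less a d \<beta>[OF i0(1)] by (simp add: ennreal_mult)
      then have "a < \<beta> i0 * d" using a by (simp add: ennreal_less_iff)
      then have "a / d < \<beta> i0" using \<open>0 < d\<close> by (simp add: divide_less_eq)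
      then show ?thesis
        using True a d \<open>0 < d\<close> i0 \<beta>[OF i0(1)] by (simp add: divide_ennreal ennreal_lessI)
    next
      case False
      \<comment> \<open>In a tier other than that of the strongest station, every station is part of
        the remainder, so the quotient is at most 1, below every threshold.\<close>
      have "m i \<le> I - Mx"
        unfolding m_def
      proof (rule SUP_least)
        fix n
        have "R i n + R i0 n0 \<le> I" using False by (intro pair_le i i0) auto
        then show "R i n \<le> I - Mx" using n0 Mx_fin by (simp add: ennreal_le_minus_iff add.commute)
      qed
      then obtain a d where a: "m i = ennreal a" "0 \<le> a" and d: "I - Mx = ennreal d" "0 \<le> d" and "a \<le> d"
        using I by (cases "m i"; cases "I - Mx") (auto simp: ennreal_minus_eq_top top_unique)
      show ?thesis
      proof (cases "d = 0")
        \<comment> \<open>Here \<open>a = 0\<close> as well, and \<open>0 / 0 = 0\<close> lies below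
          the threshold.\<close>
        case True
        then show ?thesis using \<open>a \<le> d\<close> a d \<beta>[OF i] by simp
      next
        case False
        then have "0 < d" using d by simp
        then have "a / d \<le> 1" using \<open>a \<le> d\<close> by simp
        then have "a / d < \<beta> i" using \<beta>[OF i] by simp
        then show ?thesis using a d \<open>0 < d\<close> \<beta>[OF i] by (simp add: divide_ennreal ennreal_lessI)
      qed
    qed
    then show ?thesis using 0 by (simp add: m_def[symmetric] Mx_def[symmetric])
  qed
qed

lemma infsum_ennreal_eq_suminf:
  fixes f :: "nat \<Rightarrow> ennreal"
  shows "infsum f A = (\<Sum>n. if n \<in> A then f n else 0)"
proof -
  have "infsum f A = infsum (\<lambda>n. if n \<in> A then f n else 0) UNIV"
    by (rule infsum_cong_neutral) auto
  moreover have "(\<lambda>n. if n \<in> A then f n else 0) sums infsum (\<lambda>n. if n \<in> A then f n else 0) UNIV"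
    by (intro has_sum_imp_sums has_sum_infsum nonneg_summable_on_complete) simp
  ultimately show ?thesis by (simp add: sums_unique)
qed

lemma SUP_restrict_ennreal:
  fixes f :: "nat \<Rightarrow> ennreal"
  shows "(SUP n\<in>{n. Q n}. f n) = (SUP n. if Q n then f n else 0)"
proof (rule antisym)
  show "(SUP n\<in>{n. Q n}. f n) \<le> (SUP n. if Q n then f n else 0)"
    by (rule SUP_mono) (auto intro!: exI[of _ "_ :: nat"])
  show "(SUP n. if Q n then f n else 0) \<le> (SUP n\<in>{n. Q n}. f n)"
    by (rule SUP_least) (auto intro: SUP_upper)
qed

lemma Gamma_reflection_real:
  fixes x :: real
  shows "Gamma x * Gamma (1 - x) = pi / sin (pi * x)"
proof -
  have "Gamma (complex_of_real x) * Gamma (complex_of_real (1 - x)) = complex_of_real pi / sin (complex_of_real (pi * x))"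
    using Gamma_reflection_complex[of "complex_of_real x"] by simp
  then show ?thesis
    by (simp only: Gamma_complex_of_real sin_of_real of_real_mult[symmetric] of_real_divide[symmetric] of_real_eq_iff)
qed

lemma ennreal_add_of_bool_eq_1: "c + of_bool Q = (1 :: ennreal) \<Longrightarrow> Q \<longleftrightarrow> c = 0"
  by (cases Q) auto

section \<open>From the indicator product to the coverage formula\<close>

context coverage_network
begin

lemma strong_count_measurable [measurable]:
  assumes j: "j \<in> {1..K}"
  shows "strong_count j \<in> borel_measurable M"
proof -
  note [measurable] = rx_power_measurable[OF j] act_pred[OF j]
  have "strong_count j = (\<lambda>\<omega>. \<Sum>n. if act j n \<omega> \<and> 0 < rx_power j n \<omega> \<and>
      \<beta> j * (interference_real \<omega> - rx_power j n \<omega>) \<le> rx_power j n \<omega> then 1 else 0)"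
    by (simp add: strong_count_def of_bool_def fun_eq_iff)
  then show ?thesis by simp
qed

lemma max_active_eq: "max_active \<alpha> P X act h i \<omega> = (SUP n. if act i n \<omega> then ennreal (rx_power i n \<omega>) else 0)"
  unfolding max_active_def received_power_def rx_power_def by (rule SUP_restrict_ennreal)

lemma max_idle_eq: "max_idle \<alpha> P X act h i \<omega> = (SUP n. if act i n \<omega> then 0 else ennreal (rx_power i n \<omega>))"
proof -
  have "(\<lambda>n. if \<not> act i n \<omega> then ennreal (rx_power i n \<omega>) else 0) = (\<lambda>n. if act i n \<omega> then 0 else ennreal (rx_power i n \<omega>))"
    by auto
  moreover have "max_idle \<alpha> P X act h i \<omega> = (SUP n. if \<not> act i n \<omega> then ennreal (rx_power i n \<omega>) else 0)"
    unfolding max_idle_def received_power_def rx_power_def by (rule SUP_restrict_ennreal)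
  ultimately show ?thesis by (simp only:)
qed

lemma total_active_eq: "total_active K \<alpha> P X act h \<omega> = interference \<omega>"
  unfolding total_active_def interference_def received_power_def rx_power_def infsum_ennreal_eq_suminf by simp

text \<open>The strict inequality survives the supremum over tiers because there are finitely many.
  Within a tier nothing is asked of attainment: the scaled supremum is a constant multiple of the
  unscaled one.\<close>

lemma scaled_idle_max_less_iff:
  assumes x: "0 < x"
  shows "scaled_idle_max \<omega> < ennreal x \<longleftrightarrow>
    (\<forall>i\<in>{1..K}. max_idle \<alpha> P X act h i \<omega> / ennreal x < ennreal (\<beta> i))"
proof -
  let ?D = "\<lambda>i. SUP n. if act i n \<omega> then 0 else ennreal (rx_power i n \<omega> / \<beta> i)"
  have J: "finite {1..K}" "{1..K} \<noteq> {}" using p_nonzero by auto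
  have "scaled_idle_max \<omega> = (MAX i\<in>{1..K}. ?D i)"
    unfolding scaled_idle_max_def using J by (intro cSup_eq_Max) auto
  then have "scaled_idle_max \<omega> < ennreal x \<longleftrightarrow> (\<forall>i\<in>{1..K}. ?D i < ennreal x)"
    using J by simp
  also have "\<dots> \<longleftrightarrow> (\<forall>i\<in>{1..K}. max_idle \<alpha> P X act h i \<omega> / ennreal x < ennreal (\<beta> i))"
  proof (rule ball_cong)
    fix i assume i: "i \<in> {1..K}"
    have \<beta>: "0 < \<beta> i" using \<beta>_gt_1[OF i] by simp
    have "?D i = (SUP n. ennreal (1 / \<beta> i) * (if act i n \<omega> then 0 else ennreal (rx_power i n \<omega>)))"
    proof (rule SUP_cong)
      fix n
      have "ennreal (rx_power i n \<omega> / \<beta> i) = ennreal (1 / \<beta> i) * ennreal (rx_power i n \<omega>)"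
        using \<beta> ennreal_mult'[of "1 / \<beta> i" "rx_power i n \<omega>"] by simp
      then show "(if act i n \<omega> then 0 else ennreal (rx_power i n \<omega> / \<beta> i)) =
          ennreal (1 / \<beta> i) * (if act i n \<omega> then 0 else ennreal (rx_power i n \<omega>))" by simp
    qed simp
    then have D: "?D i = ennreal (1 / \<beta> i) * max_idle \<alpha> P X act h i \<omega>"
      unfolding max_idle_eq SUP_mult_left_ennreal .
    show "?D i < ennreal x \<longleftrightarrow> max_idle \<alpha> P X act h i \<omega> / ennreal x < ennreal (\<beta> i)"
    proof (cases "max_idle \<alpha> P X act h i \<omega>")
      case (real r)
      then show ?thesis
        unfolding D using \<beta> x
        by (simp add: divide_ennreal ennreal_less_iff pos_divide_less_eq mult.commute flip: ennreal_mult)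
    next
      case top
      then show ?thesis
        unfolding D using \<beta> x by (simp add: ennreal_mult_top ennreal_top_divide)
    qed
  qed simp
  finally show ?thesis .
qed

text \<open>By \<open>strong_station_unique\<close> no active tier beats its threshold exactly when
  there is no strong station. The second conjunct records that the number of strong stations is 0 or
  1, so that its expectation is the probability that one exists.\<close>

lemma coverage_indicator:
  "AE \<omega> in M. (\<Prod>i\<in>{1..K}.
      of_bool (max_active \<alpha> P X act h i \<omega> / (total_active K \<alpha> P X act h \<omega> - max_active_all K \<alpha> P X act h \<omega>) < ennreal (\<beta> i)) *
      of_bool (max_idle \<alpha> P X act h i \<omega> / total_active K \<alpha> P X act h \<omega> < ennreal (\<beta> i))) =
      (of_bool ((\<Sum>j=1..K. strong_count j \<omega>) = 0 \<and> scaled_idle_max_real \<omega> < interference_real \<omega>) :: real) \<and>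
    (\<Sum>j=1..K. strong_count j \<omega>) + of_bool ((\<Sum>j=1..K. strong_count j \<omega>) = 0) = 1"
  using AE_interference_real AE_scaled_idle_max_finite
proof eventually_elim
  case (elim \<omega>)
  let ?x = "interference_real \<omega>" and ?R = "\<lambda>i n. if act i n \<omega> then ennreal (rx_power i n \<omega>) else 0"
  let ?U = "\<forall>i\<in>{1..K}. max_active \<alpha> P X act h i \<omega> / (total_active K \<alpha> P X act h \<omega> - max_active_all K \<alpha> P X act h \<omega>) < ennreal (\<beta> i)"
  have J: "finite {1..K}" "{1..K} \<noteq> {}" using p_nonzero by auto
  have x: "0 < ?x" "interference \<omega> = ennreal ?x" using elim by auto
  have count: "strong_count i \<omega> = (\<Sum>n. of_bool (0 < ?R i n \<and> ennreal (\<beta> i) * (interference \<omega> - ?R i n) \<le> ?R i n))"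
    if i: "i \<in> {1..K}" for i
    unfolding strong_count_def
  proof (rule suminf_cong)
    fix n
    have "0 < ennreal (rx_power i n \<omega>) \<and> ennreal (\<beta> i) * (interference \<omega> - ennreal (rx_power i n \<omega>)) \<le> ennreal (rx_power i n \<omega>) \<longleftrightarrow>
        0 < rx_power i n \<omega> \<and> \<beta> i * (?x - rx_power i n \<omega>) \<le> rx_power i n \<omega>"
    proof (cases "0 < rx_power i n \<omega>")
      case True
      have "ennreal (\<beta> i) * (interference \<omega> - ennreal (rx_power i n \<omega>)) = ennreal (\<beta> i * (?x - rx_power i n \<omega>))"
        using True x \<beta>_gt_1[OF i] by (simp add: ennreal_minus ennreal_mult')
      then show ?thesis using True by (simp add: ennreal_le_iff)
    qed (simp add: ennreal_neg)
    then show "of_bool (act i n \<omega> \<and> 0 < rx_power i n \<omega> \<and> \<beta> i * (?x - rx_power i n \<omega>) \<le> rx_power i n \<omega>) =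
        (of_bool (0 < ?R i n \<and> ennreal (\<beta> i) * (interference \<omega> - ?R i n) \<le> ?R i n) :: ennreal)"
      by (cases "act i n \<omega>") (auto simp: of_bool_def)
  qed
  have "(\<Sum>i=1..K. \<Sum>n. of_bool (0 < ?R i n \<and> ennreal (\<beta> i) * (interference \<omega> - ?R i n) \<le> ?R i n)) +
      of_bool (\<forall>i\<in>{1..K}. (SUP n. ?R i n) / (interference \<omega> - (MAX i\<in>{1..K}. SUP n. ?R i n)) < ennreal (\<beta> i)) = (1 :: ennreal)"
    using x by (intro strong_station_unique[OF J]) (auto simp: interference_def \<beta>_gt_1)
  then have one: "(\<Sum>j=1..K. strong_count j \<omega>) + of_bool ?U = 1"
    by (simp only: count max_active_eq max_active_all_def total_active_eq cong: sum.cong)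
  then have U: "?U \<longleftrightarrow> (\<Sum>j=1..K. strong_count j \<omega>) = 0"
    by (rule ennreal_add_of_bool_eq_1)
  have idle: "(\<forall>i\<in>{1..K}. max_idle \<alpha> P X act h i \<omega> / total_active K \<alpha> P X act h \<omega> < ennreal (\<beta> i)) \<longleftrightarrow>
      scaled_idle_max_real \<omega> < ?x"
  proof -
    obtain d where "scaled_idle_max \<omega> = ennreal d" "0 \<le> d" using elim(2) by (cases "scaled_idle_max \<omega>") auto
    then have "scaled_idle_max \<omega> < ennreal ?x \<longleftrightarrow> scaled_idle_max_real \<omega> < ?x"
      by (simp add: scaled_idle_max_real_def ennreal_less_iff)
    then show ?thesis using scaled_idle_max_less_iff[OF x(1), of \<omega>] by (simp only: total_active_eq x(2))
  qed
  have prod: "(\<Prod>i\<in>{1..K}. of_bool (F i) * of_bool (G i)) = (of_bool ((\<forall>i\<in>{1..K}. F i) \<and> (\<forall>i\<in>{1..K}. G i)) :: real)" for F G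
  proof (cases "(\<forall>i\<in>{1..K}. F i) \<and> (\<forall>i\<in>{1..K}. G i)")
    case False
    then have "\<exists>i\<in>{1..K}. of_bool (F i) * of_bool (G i) = (0 :: real)" by auto
    then have "(\<Prod>i\<in>{1..K}. of_bool (F i) * of_bool (G i)) = (0 :: real)" by (intro prod_zero) auto
    with False show ?thesis by (simp only: of_bool_eq)
  qed simp
  show ?case
    unfolding prod idle U using one unfolding U by simp
qed

text \<open>The indicator of having no strong station plus the number of strong stations is 1.
  Multiplying by the idle event and integrating gives the difference; subtraction is legitimate
  because all integrals are at most 1.\<close>

lemma coverage_expectation:
  "(\<integral>\<omega>. (\<Prod>i\<in>{1..K}.
      of_bool (max_active \<alpha> P X act h i \<omega> / (total_active K \<alpha> P X act h \<omega> - max_active_all K \<alpha> P X act h \<omega>) < ennreal (\<beta> i)) *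
      of_bool (max_idle \<alpha> P X act h i \<omega> / total_active K \<alpha> P X act h \<omega> < ennreal (\<beta> i))) \<partial>M) =
    enn2real (\<integral>\<^sup>+\<omega>. of_bool (scaled_idle_max_real \<omega> < interference_real \<omega>) \<partial>M) -
    (\<Sum>j=1..K. enn2real (\<integral>\<^sup>+\<omega>. strong_count j \<omega> * of_bool (scaled_idle_max_real \<omega> < interference_real \<omega>) \<partial>M))"
    (is "?E = enn2real ?q - (\<Sum>j=1..K. enn2real (?s j))")
proof -
  let ?B = "\<lambda>\<omega>. scaled_idle_max_real \<omega> < interference_real \<omega>" and ?N = "\<lambda>\<omega>. \<Sum>j=1..K. strong_count j \<omega>"
  have N_meas [measurable]: "?N \<in> borel_measurable M" by (intro borel_measurable_sum) (rule strong_count_measurable)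
  let ?V = "\<lambda>\<omega>. of_bool (?N \<omega> = 0 \<and> ?B \<omega>) :: real"
  have "?E = expectation ?V"
  proof (rule integral_cong_AE)
    have [measurable]: "max_active \<alpha> P X act h i \<in> borel_measurable M" "max_idle \<alpha> P X act h i \<in> borel_measurable M"
      if i: "i \<in> {1..K}" for i
    proof -
      note [measurable] = rx_power_measurable[OF i] act_pred[OF i]
      show "max_active \<alpha> P X act h i \<in> borel_measurable M" "max_idle \<alpha> P X act h i \<in> borel_measurable M"
        unfolding max_active_eq[abs_def] max_idle_eq[abs_def] by measurable
    qed
    have [measurable]: "max_active_all K \<alpha> P X act h \<in> borel_measurable M"
      unfolding max_active_all_def[abs_def] by (intro borel_measurable_Max) auto
    have [measurable]: "total_active K \<alpha> P X act h \<in> borel_measurable M"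
      unfolding total_active_eq[abs_def] by measurable
    show "(\<lambda>\<omega>. \<Prod>i\<in>{1..K}.
      of_bool (max_active \<alpha> P X act h i \<omega> / (total_active K \<alpha> P X act h \<omega> - max_active_all K \<alpha> P X act h \<omega>) < ennreal (\<beta> i)) *
      of_bool (max_idle \<alpha> P X act h i \<omega> / total_active K \<alpha> P X act h \<omega> < ennreal (\<beta> i)) :: real) \<in> borel_measurable M"
      by measurable
    show "AE \<omega> in M. (\<Prod>i\<in>{1..K}.
      of_bool (max_active \<alpha> P X act h i \<omega> / (total_active K \<alpha> P X act h \<omega> - max_active_all K \<alpha> P X act h \<omega>) < ennreal (\<beta> i)) *
      of_bool (max_idle \<alpha> P X act h i \<omega> / total_active K \<alpha> P X act h \<omega> < ennreal (\<beta> i))) = ?V \<omega>"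
      using coverage_indicator by eventually_elim (rule conjunct1)
  qed measurable
  also have "\<dots> = enn2real (\<integral>\<^sup>+\<omega>. ennreal (?V \<omega>) \<partial>M)"
    by (rule integral_eq_nn_integral) auto
  finally have E: "?E = enn2real (\<integral>\<^sup>+\<omega>. ennreal (?V \<omega>) \<partial>M)" .
  have "?q = (\<integral>\<^sup>+\<omega>. ennreal (?V \<omega>) + (\<Sum>j=1..K. strong_count j \<omega> * of_bool (?B \<omega>)) \<partial>M)"
  proof (rule nn_integral_cong_AE, use coverage_indicator in eventually_elim)
    case (elim \<omega>)
    then have "of_bool (?B \<omega>) = (?N \<omega> + of_bool (?N \<omega> = 0)) * (of_bool (?B \<omega>) :: ennreal)" by simp
    also have "\<dots> = ennreal (?V \<omega>) + (\<Sum>j=1..K. strong_count j \<omega> * of_bool (?B \<omega>))"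
      by (cases "?B \<omega>") (simp_all add: of_bool_def)
    finally show ?case .
  qed
  also have "\<dots> = (\<integral>\<^sup>+\<omega>. ennreal (?V \<omega>) \<partial>M) + (\<Sum>j=1..K. ?s j)"
  proof -
    have meas: "(\<lambda>\<omega>. strong_count j \<omega> * of_bool (?B \<omega>)) \<in> borel_measurable M" if "j \<in> {1..K}" for j
      using strong_count_measurable[OF that] by measurable
    have "(\<integral>\<^sup>+\<omega>. ennreal (?V \<omega>) + (\<Sum>j=1..K. strong_count j \<omega> * of_bool (?B \<omega>)) \<partial>M) =
        (\<integral>\<^sup>+\<omega>. ennreal (?V \<omega>) \<partial>M) + (\<integral>\<^sup>+\<omega>. (\<Sum>j=1..K. strong_count j \<omega> * of_bool (?B \<omega>)) \<partial>M)"
    proof (rule nn_integral_add)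
      show "(\<lambda>\<omega>. ennreal (?V \<omega>)) \<in> borel_measurable M" by measurable
      show "(\<lambda>\<omega>. \<Sum>j=1..K. strong_count j \<omega> * of_bool (?B \<omega>)) \<in> borel_measurable M"
        by (intro borel_measurable_sum meas)
    qed
    also have "(\<integral>\<^sup>+\<omega>. (\<Sum>j=1..K. strong_count j \<omega> * of_bool (?B \<omega>)) \<partial>M) = (\<Sum>j=1..K. ?s j)"
      by (rule nn_integral_sum) (rule meas)
    finally show ?thesis .
  qed
  finally have q: "?q = (\<integral>\<^sup>+\<omega>. ennreal (?V \<omega>) \<partial>M) + (\<Sum>j=1..K. ?s j)" .
  have "?q \<le> (\<integral>\<^sup>+\<omega>. 1 \<partial>M)" by (intro nn_integral_mono) (simp add: of_bool_def)
  then have q_fin: "?q < \<top>" by (auto simp: emeasure_space_1 le_less_trans)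
  then have s_fin: "(\<integral>\<^sup>+\<omega>. ennreal (?V \<omega>) \<partial>M) < \<top>" "(\<Sum>j=1..K. ?s j) < \<top>" unfolding q by auto
  then have "?s j < \<top>" if "j \<in> {1..K}" for j
    using that member_le_sum[of j "{1..K}" ?s] by (auto intro: le_less_trans)
  then have "enn2real (\<Sum>j=1..K. ?s j) = (\<Sum>j=1..K. enn2real (?s j))"
    by (subst enn2real_sum) auto
  moreover have "enn2real ?q = enn2real (\<integral>\<^sup>+\<omega>. ennreal (?V \<omega>) \<partial>M) + enn2real (\<Sum>j=1..K. ?s j)"
    unfolding q by (rule enn2real_plus) (rule s_fin)+
  ultimately show ?thesis using E by simp
qed

text \<open>The reflection formula at \<open>\<delta> = 2 / \<alpha>\<close> turns the cosecant in
  \<open>C_const\<close> into \<open>pi * Gamma (1 + \<delta>) * Gamma (1 - \<delta>)\<close>, the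
  two Gamma factors being those of the fading average and of the stable exponent.\<close>

lemma eta_const_eq: "eta_const K \<alpha> dens P p = stable_rate"
proof -
  have "C_const \<alpha> = pi * Gamma (1 + \<delta>) * Gamma (1 - \<delta>)"
  proof -
    have "\<delta> \<notin> \<int>\<^sub>\<le>\<^sub>0" using \<delta> nonpos_Ints_nonpos[of \<delta>] by auto
    then have "Gamma (1 + \<delta>) = \<delta> * Gamma \<delta>" using Gamma_plus1[of \<delta>] by (simp add: add.commute)
    moreover have "Gamma \<delta> * Gamma (1 - \<delta>) = pi / sin (pi * \<delta>)" by (rule Gamma_reflection_real)
    ultimately have "pi * Gamma (1 + \<delta>) * Gamma (1 - \<delta>) = pi * \<delta> * (pi / sin (pi * \<delta>))"
      by (metis mult.assoc)
    then show ?thesis by (simp add: C_const_def \<delta>_def power2_eq_square mult.commute)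
  qed
  then show ?thesis
    by (simp add: eta_const_def stable_rate_def intensity_def \<delta>_def[symmetric] sum_distrib_left sum_distrib_right mult_ac)
qed

lemma A_const_eq: "A_const K \<alpha> dens P p \<beta> = idle_rate"
  by (simp add: A_const_def idle_rate_def intensity_def \<delta>_def[symmetric] sum_distrib_left mult_ac
      flip: minus_divide_left)

text \<open>\<open>pochhammer 0 n\<close> vanishes for \<open>n > 0\<close>, so only the constant
  term 1 of the series survives.\<close>

lemma strong_series_0: "j \<in> {1..K} \<Longrightarrow> strong_series j 0 = \<beta> j powr - \<delta>"
proof -
  assume j: "j \<in> {1..K}"
  have "(\<Sum>n. pochhammer 0 n / pochhammer (\<delta> + 1) n * (1 / (1 + \<beta> j)) ^ n) =
      (\<Sum>n\<in>{0}. pochhammer 0 n / pochhammer (\<delta> + 1) n * (1 / (1 + \<beta> j)) ^ n)"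
    by (intro suminf_finite) (auto simp: pochhammer_0_left)
  then show ?thesis using \<beta>_gt_1[OF j] by (simp add: strong_series_def)
qed

text \<open>The assumption \<open>0 < m\<close> gives the second hypergeometric parameter
  \<open>\<delta> * m\<close> the positivity under which Euler's integral equals the series. The
  case \<open>m = 0\<close> is covered by \<open>strong_series_0\<close> instead.\<close>

lemma B_coeff_eq:
  assumes m: "0 < m"
  shows "pi * Gamma (1 + \<delta>) * B_coeff K \<alpha> dens P p \<beta> m = (\<Sum>j=1..K. intensity j True * strong_series j m)"
  unfolding B_coeff_def sum_distrib_left
proof (rule sum.cong)
  fix j assume j: "j \<in> {1..K}"
  have \<beta>: "1 < \<beta> j" by (rule \<beta>_gt_1[OF j])
  have args: "2 * real m / \<alpha> = \<delta> * real m" "1 + 2 * (real m + 1) / \<alpha> = \<delta> * real (Suc m) + 1" "- 2 / \<alpha> = - \<delta>" "2 / \<alpha> = \<delta>"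
    by (simp_all add: \<delta>_def add.commute)
  have "hyp2F1 1 (\<delta> * real m) (\<delta> * real (Suc m) + 1) (1 / (1 + \<beta> j)) =
      (\<Sum>n. pochhammer (\<delta> * real m) n / pochhammer (\<delta> * real (Suc m) + 1) n * (1 / (1 + \<beta> j)) ^ n)"
    using m \<delta> \<beta> by (intro hyp2F1_series) auto
  then show "pi * Gamma (1 + \<delta>) * (dens j * p j * P j powr (2 / \<alpha>) * \<beta> j powr (- 2 / \<alpha>) *
        hyp2F1 1 (2 * real m / \<alpha>) (1 + 2 * (real m + 1) / \<alpha>) (1 / (1 + \<beta> j)) /
        (1 + \<beta> j) powr (2 * real m / \<alpha>)) = intensity j True * strong_series j m"
    unfolding args intensity_def strong_series_def by (simp add: powr_minus_divide ac_simps del: of_nat_Suc)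
qed simp

text \<open>The two series add up termwise to \<open>t\<close>, whose sum is one minus the coverage
  probability. The terms of positive index are the coefficients \<open>g_coeff\<close>; the term
  \<open>t 0\<close> is split off and gives the closed leading part.\<close>

theorem coverage_formula:
  "summable (\<lambda>m. g_coeff K \<alpha> dens P p \<beta> (Suc m)) \<and>
    coverage_prob K \<alpha> P X act h M \<beta> =
      pi / C_const \<alpha> *
        ((\<Sum>i=1..K. p i * dens i * P i powr (2 / \<alpha>) * \<beta> i powr (- 2 / \<alpha>)) /
         (\<Sum>i=1..K. p i * dens i * P i powr (2 / \<alpha>)))
      - (\<Sum>m. g_coeff K \<alpha> dens P p \<beta> (Suc m))"
proof -
  let ?G = "\<lambda>m. Gamma (1 + \<delta> * real m)"
  define t where "t m = (- idle_rate / stable_rate) ^ m / ?G m -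
    (\<Sum>j=1..K. intensity j True * ((- idle_rate) ^ m / (?G (Suc m) * stable_rate ^ Suc m) * strong_series j m))" for m
  have t_sums: "t sums (1 - coverage_prob K \<alpha> P X act h M \<beta>)"
  proof -
    have "1 - coverage_prob K \<alpha> P X act h M \<beta> =
        enn2real (\<integral>\<^sup>+\<omega>. of_bool (scaled_idle_max_real \<omega> < interference_real \<omega>) \<partial>M) -
        (\<Sum>j=1..K. enn2real (\<integral>\<^sup>+\<omega>. strong_count j \<omega> * of_bool (scaled_idle_max_real \<omega> < interference_real \<omega>) \<partial>M))"
      unfolding coverage_prob_def coverage_expectation by simp
    then show ?thesis
      unfolding t_def by (simp only:) (intro sums_diff sums_sum idle_below_interference_series strong_count_series)
  qed
  have g: "g_coeff K \<alpha> dens P p \<beta> (Suc m) = t (Suc m)" for m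
  proof -
    let ?B = "B_coeff K \<alpha> dens P p \<beta> (Suc m)"
    have args: "1 + 2 * real (Suc m) / \<alpha> = 1 + \<delta> * real (Suc m)" "1 + 2 * (real (Suc m) + 1) / \<alpha> = 1 + \<delta> * real (Suc (Suc m))" "2 / \<alpha> = \<delta>"
      by (simp_all add: \<delta>_def)
    have "(\<Sum>j=1..K. intensity j True * ((- idle_rate) ^ Suc m / (?G (Suc (Suc m)) * stable_rate ^ Suc (Suc m)) * strong_series j (Suc m))) =
        (- idle_rate) ^ Suc m / (?G (Suc (Suc m)) * stable_rate ^ Suc (Suc m)) * (\<Sum>j=1..K. intensity j True * strong_series j (Suc m))"
      unfolding sum_distrib_left by (simp only: mult_ac)
    also have "\<dots> = (- idle_rate) ^ Suc m / (?G (Suc (Suc m)) * stable_rate ^ Suc (Suc m)) * (pi * Gamma (1 + \<delta>) * ?B)"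
      by (simp only: B_coeff_eq[OF zero_less_Suc])
    also have "\<dots> = (- idle_rate / stable_rate) ^ Suc m * (?B / stable_rate * (pi * Gamma (1 + \<delta>) / ?G (Suc (Suc m))))"
      unfolding power_divide power_Suc[of stable_rate "Suc m"] by (simp add: mult_ac del: power_Suc of_nat_Suc)
    finally show ?thesis
      unfolding g_coeff_def t_def A_const_eq eta_const_eq args
      by (simp only: right_diff_distrib times_divide_eq_right mult_1_right)
  qed
  \<comment> \<open>In \<open>t 0\<close> the first summand is \<open>1 / Gamma 1 = 1\<close> and
    cancels. In the rest \<open>Gamma (1 + \<delta>)\<close> cancels between
    \<open>intensity\<close> and the moment, leaving \<open>pi / C_const \<alpha>\<close> times the
    quotient of sums.\<close>
  have t0: "1 - t 0 = pi / C_const \<alpha> *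
        ((\<Sum>i=1..K. p i * dens i * P i powr (2 / \<alpha>) * \<beta> i powr (- 2 / \<alpha>)) /
         (\<Sum>i=1..K. p i * dens i * P i powr (2 / \<alpha>)))"
  proof -
    have G1: "0 < Gamma (1 + \<delta>)" using \<delta> by (intro Gamma_real_pos) simp
    have "1 - t 0 = (\<Sum>j=1..K. intensity j True * strong_series j 0) / (Gamma (1 + \<delta>) * stable_rate)"
      by (simp add: t_def sum_divide_distrib)
    also have "(\<Sum>j=1..K. intensity j True * strong_series j 0) = (\<Sum>j=1..K. intensity j True * \<beta> j powr - \<delta>)"
      by (rule sum.cong) (simp_all add: strong_series_0)
    also have "(\<Sum>j=1..K. intensity j True * \<beta> j powr - \<delta>) =
        Gamma (1 + \<delta>) * (pi * (\<Sum>i=1..K. p i * dens i * P i powr (2 / \<alpha>) * \<beta> i powr (- 2 / \<alpha>)))"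
      unfolding sum_distrib_left
      by (rule sum.cong) (simp_all add: intensity_def \<delta>_def)
    also have "stable_rate = C_const \<alpha> * (\<Sum>l=1..K. p l * dens l * P l powr (2 / \<alpha>))"
      by (simp add: eta_const_eq[symmetric] eta_const_def)
    finally show ?thesis using G1 by simp
  qed
  from t_sums have "(\<lambda>m. t (Suc m)) sums (1 - coverage_prob K \<alpha> P X act h M \<beta> - t 0)"
    by (simp add: sums_Suc_iff)
  then have "(\<lambda>m. g_coeff K \<alpha> dens P p \<beta> (Suc m)) sums (1 - coverage_prob K \<alpha> P X act h M \<beta> - t 0)"
    by (simp only: g)
  then show ?thesis
    unfolding t0[symmetric] by (auto simp: sums_iff)
qed

end

theorem theorem1:
  fixes M :: "'w measure" and K :: nat and \<alpha> :: real
    and dens P p \<beta> :: "nat \<Rightarrow> real"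
    and X :: "nat \<Rightarrow> nat \<Rightarrow> 'w \<Rightarrow> real ^ 2"
    and act :: "nat \<Rightarrow> nat \<Rightarrow> 'w \<Rightarrow> bool"
    and h :: "nat \<Rightarrow> nat \<Rightarrow> 'w \<Rightarrow> real"
  assumes "K \<ge> 1" and "\<alpha> > 2"
    and "\<And>i. i \<in> {1..K} \<Longrightarrow> dens i > 0"
    and "\<And>i. i \<in> {1..K} \<Longrightarrow> P i > 0"
    and "\<And>i. i \<in> {1..K} \<Longrightarrow> 0 \<le> p i \<and> p i \<le> 1"
    and "\<exists>i\<in>{1..K}. p i \<noteq> 0"
    and "\<And>i. i \<in> {1..K} \<Longrightarrow> \<beta> i > 1"
    and "multi_tier_network M K dens p X act h"
  shows "summable (\<lambda>m. g_coeff K \<alpha> dens P p \<beta> (Suc m)) \<and>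
    coverage_prob K \<alpha> P X act h M \<beta> =
      pi / C_const \<alpha> *
        ((\<Sum>i=1..K. p i * dens i * P i powr (2 / \<alpha>) * \<beta> i powr (- 2 / \<alpha>)) /
         (\<Sum>i=1..K. p i * dens i * P i powr (2 / \<alpha>)))
      - (\<Sum>m. g_coeff K \<alpha> dens P p \<beta> (Suc m))"
proof -
  interpret multi_tier_network M K dens p X act h by fact
  interpret coverage_network M K dens p X act h \<alpha> P \<beta>
    by unfold_locales (fact assms)+
  show ?thesis by (rule coverage_formula)
qed

end
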